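(* Let $1\to N\to G\xrightarrow{p}Q\to1$ be a short exact sequence of locally compact Hausdorff groups. Fix a character $\chi\colon Q\to\mathbb R$ and let $n\in\mathbb N$. 1. If $p$ has a section and $\chi\circ p\in\Sigma^n_{\mathrm{top}}(G)$, then $\chi\in\Sigma^n_{\mathrm{top}}(Q)$. 2. If $N$ is of type $\mathrm C_n$ and $\chi\in\Sigma^n_{\mathrm{top}}(Q)$, then $\chi\circ p\in\Sigma^n_{\mathrm{top}}(G)$. 3. If $N$ is of type $\mathrm C_n$ and $\chi\circ p\in\Sigma^{n+1}_{\mathrm{top}}(G)$, then $\chi\in\Sigma^{n+1}_{\mathrm{top}}(Q)$.
   Context: $\mathbb N$ contains $0$. A short exact sequence of locally compact Hausdorff groups is a short exact sequence of the underlying abstract groups with continuous maps, where $N$ and $Q$ carry the subspace and quotient topologies induced from $G$, respectively. A section of $p$ is a continuous group homomorphism $s\colon Q\to G$ with $p\circ s=\mathrm{id}_Q$. For a locally compact Hausdorff group $G$: a character is a continuous homomorphism $\chi\colon G\to\mathbb R$; $G_\chi:=\{g\in G\mid\chi(g)\ge0\}$. For a set $S$, $\mathrm E S$ is the simplicial set with $n$-simplices $S^{n+1}$, the $i$-th face (degeneracy) map deleting (doubling) the $i$-th entry. $\mathcal C(G)$ is the poset of compact subsets of $G$ ordered by inclusion. For $C\in\mathcal C(G)$, $G_\chi\cdot\mathrm E C\subseteq \mathrm E G$ is the simplicial subset of all simplices $(gx_0,\dots,gx_k)$ with $g\in G_\chi$, $x_i\in C$; $G\cdot\mathrm E C$ is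 defined the same way with $g\in G$. A filtration $(X_\alpha)_{\alpha\in A}$ of a connected simplicial set $X$ over a directed poset $A$ (simplicial subsets, increasing in $\alpha$, with union $X$) is essentially $n$-connected if for a vertex $x\in X$ (the choice is immaterial), every $k$ with $0\le k\le n$ and every $\alpha$ with $x\in X_\alpha$, there is $\beta\ge\alpha$ such that $\pi_k(X_\alpha,x)\to\pi_k(X_\beta,x)$ is trivial (homotopy groups are those of geometric realizations); essentially $(-1)$-connected is a vacuous condition. $G$ is of type $\mathrm C_n$ if the filtration $(G\cdot\mathrm E C)_{C\in\mathcal C(G)}$ of $\mathrm E G$ is essentially $(n-1)$-connected. $\Sigma^n_{\mathrm{top}}(G)$ is the set of characters $\chi$ for which the filtration $(G_\chi\cdot \mathrm E C)_{C\in\mathcal C(G)}$ of $\mathrm E G$ is essentially $(n-1)$-connected. *)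

theory Defs
  imports "HOL-Analysis.Analysis" "HOL-Homology.Homology"
begin

section \<open>Simplicial sets\<close>

text \<open>\<open>face X n i\<close> is the map \<open>d\<^sub>i\<close> from \<open>n\<close>-simplices to \<open>(n - 1)\<close>-simplices (\<open>n \<ge> 1\<close>, \<open>i \<le> n\<close>);
  \<open>degen X n i\<close> is the map \<open>s\<^sub>i\<close> from \<open>n\<close>-simplices to \<open>(n + 1)\<close>-simplices (\<open>i \<le> n\<close>).\<close>

record 'a sset =
  smp :: "nat \<Rightarrow> 'a set"
  face :: "nat \<Rightarrow> nat \<Rightarrow> 'a \<Rightarrow> 'a"
  degen :: "nat \<Rightarrow> nat \<Rightarrow> 'a \<Rightarrow> 'a"

definition simplicial_set :: "'a sset \<Rightarrow> bool" where
  "simplicial_set X \<longleftrightarrow>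
     (\<forall>n i. i \<le> Suc n \<longrightarrow> face X (Suc n) i \<in> smp X (Suc n) \<rightarrow> smp X n) \<and>
     (\<forall>n i. i \<le> n \<longrightarrow> degen X n i \<in> smp X n \<rightarrow> smp X (Suc n)) \<and>
     (\<forall>n i j. \<forall>\<sigma>\<in>smp X (Suc (Suc n)). i < j \<and> j \<le> Suc (Suc n) \<longrightarrow>
        face X (Suc n) i (face X (Suc (Suc n)) j \<sigma>)
          = face X (Suc n) (j - 1) (face X (Suc (Suc n)) i \<sigma>)) \<and>
     (\<forall>n i j. \<forall>\<sigma>\<in>smp X n. i \<le> j \<and> j \<le> n \<longrightarrow>
        degen X (Suc n) i (degen X n j \<sigma>) = degen X (Suc n) (Suc j) (degen X n i \<sigma>)) \<and>
     (\<forall>n i j. \<forall>\<sigma>\<in>smp X (Suc n). i < j \<and> j \<le> Suc n \<longrightarrow>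
        face X (Suc (Suc n)) i (degen X (Suc n) j \<sigma>) = degen X n (j - 1) (face X (Suc n) i \<sigma>)) \<and>
     (\<forall>n i j. \<forall>\<sigma>\<in>smp X n. (i = j \<or> i = Suc j) \<and> j \<le> n \<longrightarrow>
        face X (Suc n) i (degen X n j \<sigma>) = \<sigma>) \<and>
     (\<forall>n i j. \<forall>\<sigma>\<in>smp X (Suc n). Suc j < i \<and> i \<le> Suc (Suc n) \<longrightarrow>
        face X (Suc (Suc n)) i (degen X (Suc n) j \<sigma>) = degen X n j (face X (Suc n) (i - 1) \<sigma>))"

definition simplicial_subset :: "'a sset \<Rightarrow> 'a sset \<Rightarrow> bool" where
  "simplicial_subset Y X \<longleftrightarrow>
     simplicial_set Y \<and> (\<forall>n. smp Y n \<subseteq> smp X n) \<and> face Y = face X \<and> degen Y = degen X"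


section \<open>Geometric realization\<close>

text \<open>The realization is the quotient of the disjoint union of the spaces \<open>X\<^sub>n \<times> \<Delta>\<^sup>n\<close>
  (\<open>X\<^sub>n\<close> discrete).  A point of the disjoint union is written \<open>((n, \<sigma>), t)\<close> with \<open>\<sigma> \<in> X\<^sub>n\<close> and
  \<open>t \<in> \<Delta>\<^sup>n\<close>.\<close>

type_synonym 'a spt = "(nat \<times> 'a) \<times> (nat \<Rightarrow> real)"

definition pre_realization :: "'a sset \<Rightarrow> 'a spt topology" where
  "pre_realization X =
     sum_topology (\<lambda>(n, \<sigma>). subtopology (powertop_real UNIV) (standard_simplex n))
       (SIGMA n:UNIV. smp X n)"

text \<open>The affine map \<open>\<Delta>\<^bsup>n+1\<^esup> \<rightarrow> \<Delta>\<^sup>n\<close> that identifies the vertices \<open>i\<close> and \<open>i + 1\<close>; its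
  counterpart, the inclusion of the \<open>i\<close>-th facet, is the library's \<^const>\<open>simplical_face\<close>.\<close>

definition simplicial_codegen :: "nat \<Rightarrow> (nat \<Rightarrow> real) \<Rightarrow> nat \<Rightarrow> real" where
  "simplicial_codegen i t =
     (\<lambda>j. if j < i then t j else if j = i then t i + t (Suc i) else t (Suc j))"

inductive glue :: "'a sset \<Rightarrow> 'a spt \<Rightarrow> 'a spt \<Rightarrow> bool" for X where
  face: "\<lbrakk>\<sigma> \<in> smp X (Suc n); i \<le> Suc n; t \<in> standard_simplex n\<rbrakk> \<Longrightarrow>
     glue X ((n, face X (Suc n) i \<sigma>), t) ((Suc n, \<sigma>), simplical_face i t)"
| degen: "\<lbrakk>\<sigma> \<in> smp X n; i \<le> n; t \<in> standard_simplex (Suc n)\<rbrakk> \<Longrightarrow>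
     glue X ((Suc n, degen X n i \<sigma>), t) ((n, \<sigma>), simplicial_codegen i t)"

definition realization_point :: "'a sset \<Rightarrow> 'a spt \<Rightarrow> 'a spt set" where
  "realization_point X z = {w. equivclp (glue X) z w}"

definition quotient_space :: "'a topology \<Rightarrow> ('a \<Rightarrow> 'b) \<Rightarrow> 'b topology" where
  "quotient_space T q =
     topology (\<lambda>U. U \<subseteq> q ` topspace T \<and> openin T {x \<in> topspace T. q x \<in> U})"

definition realization :: "'a sset \<Rightarrow> 'a spt set topology" where
  "realization X = quotient_space (pre_realization X) (realization_point X)"

text \<open>The map of realizations induced by an inclusion \<open>X \<subseteq> Y\<close>.  A point of the realization of \<open>X\<close>
  is an equivalence class, which may be a proper subset of the corresponding class for \<open>Y\<close>;
  \<open>X\<close> itself is therefore not needed as an argument.\<close>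

definition realization_incl :: "'a sset \<Rightarrow> 'a spt set \<Rightarrow> 'a spt set" where
  "realization_incl Y c = (\<Union>z\<in>c. realization_point Y z)"

definition vertex_point :: "'a sset \<Rightarrow> 'a \<Rightarrow> 'a spt set" where
  "vertex_point X x = realization_point X ((0, x), (\<lambda>i. if i = 0 then 1 else 0))"


section \<open>Homotopy groups\<close>

text \<open>\<open>\<pi>\<^sub>k(X, x)\<close> is the set of homotopy classes of maps \<open>([0,1]\<^sup>k, \<partial>[0,1]\<^sup>k) \<rightarrow> (X, x)\<close>, for \<open>k = 0\<close>
  the set of path components.  Only the underlying pointed set is needed here, as a homomorphism is
  trivial iff it maps everything to the neutral element.\<close>

definition cube :: "nat \<Rightarrow> (nat \<Rightarrow> real) topology" where
  "cube k = product_topology (\<lambda>_. top_of_set {0..1}) {..<k}"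

definition cube_boundary :: "nat \<Rightarrow> (nat \<Rightarrow> real) set" where
  "cube_boundary k = {t \<in> topspace (cube k). \<exists>i<k. t i = 0 \<or> t i = 1}"

definition loops :: "nat \<Rightarrow> 'a topology \<Rightarrow> 'a \<Rightarrow> ((nat \<Rightarrow> real) \<Rightarrow> 'a) set" where
  "loops k X x = {f. continuous_map (cube k) X f \<and> f ` cube_boundary k \<subseteq> {x}}"

definition homotopy_class ::
  "nat \<Rightarrow> 'a topology \<Rightarrow> 'a \<Rightarrow> ((nat \<Rightarrow> real) \<Rightarrow> 'a) \<Rightarrow> ((nat \<Rightarrow> real) \<Rightarrow> 'a) set" where
  "homotopy_class k X x f =
     {g \<in> loops k X x. homotopic_with (\<lambda>h. h ` cube_boundary k \<subseteq> {x}) (cube k) X f g}"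

definition homotopy_group :: "nat \<Rightarrow> 'a topology \<Rightarrow> 'a \<Rightarrow> ((nat \<Rightarrow> real) \<Rightarrow> 'a) set set" where
  "homotopy_group k X x = homotopy_class k X x ` loops k X x"

definition homotopy_group_one :: "nat \<Rightarrow> 'a topology \<Rightarrow> 'a \<Rightarrow> ((nat \<Rightarrow> real) \<Rightarrow> 'a) set" where
  "homotopy_group_one k X x = homotopy_class k X x (\<lambda>_. x)"

definition homotopy_group_map ::
  "nat \<Rightarrow> 'b topology \<Rightarrow> 'b \<Rightarrow> ('a \<Rightarrow> 'b)
    \<Rightarrow> ((nat \<Rightarrow> real) \<Rightarrow> 'a) set \<Rightarrow> ((nat \<Rightarrow> real) \<Rightarrow> 'b) set" where
  "homotopy_group_map k Y y \<phi> c = (\<Union>f\<in>c. homotopy_class k Y y (\<phi> \<circ> f))"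


section \<open>Essentially connected filtrations\<close>

definition filtration :: "'a sset \<Rightarrow> 'i::order set \<Rightarrow> ('i \<Rightarrow> 'a sset) \<Rightarrow> bool" where
  "filtration X A F \<longleftrightarrow>
     simplicial_set X \<and>
     A \<noteq> {} \<and> (\<forall>\<alpha>\<in>A. \<forall>\<beta>\<in>A. \<exists>\<gamma>\<in>A. \<alpha> \<le> \<gamma> \<and> \<beta> \<le> \<gamma>) \<and>
     (\<forall>\<alpha>\<in>A. simplicial_subset (F \<alpha>) X) \<and>
     (\<forall>\<alpha>\<in>A. \<forall>\<beta>\<in>A. \<alpha> \<le> \<beta> \<longrightarrow> simplicial_subset (F \<alpha>) (F \<beta>)) \<and>
     (\<forall>n. (\<Union>\<alpha>\<in>A. smp (F \<alpha>) n) = smp X n)"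

text \<open>To be used for filtrations of a connected simplicial set \<open>X\<close> only.  The choice of the
  base vertex \<open>x\<close> is then immaterial; the condition is imposed on all of them.  The connectivity
  \<open>n\<close> is an integer so that it can be \<open>- 1\<close>.\<close>

definition essentially_connected ::
  "int \<Rightarrow> 'a sset \<Rightarrow> 'i::order set \<Rightarrow> ('i \<Rightarrow> 'a sset) \<Rightarrow> bool" where
  "essentially_connected n X A F \<longleftrightarrow>
     (\<forall>x\<in>smp X 0. \<forall>k::nat. int k \<le> n \<longrightarrow>
       (\<forall>\<alpha>\<in>A. x \<in> smp (F \<alpha>) 0 \<longrightarrow>
         (\<exists>\<beta>\<in>A. \<alpha> \<le> \<beta> \<and>
           (\<forall>c\<in>homotopy_group k (realization (F \<alpha>)) (vertex_point (F \<alpha>) x).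
              homotopy_group_map k (realization (F \<beta>)) (vertex_point (F \<beta>) x)
                  (realization_incl (F \<beta>)) c
                = homotopy_group_one k (realization (F \<beta>)) (vertex_point (F \<beta>) x)))))"


section \<open>Locally compact Hausdorff groups\<close>

definition lch_group :: "('a, 'm) monoid_scheme \<Rightarrow> 'a topology \<Rightarrow> bool" where
  "lch_group G T \<longleftrightarrow>
     group G \<and> topspace T = carrier G \<and>
     continuous_map (prod_topology T T) T (\<lambda>(x, y). x \<otimes>\<^bsub>G\<^esub> y) \<and>
     continuous_map T T (\<lambda>x. inv\<^bsub>G\<^esub> x) \<and>
     locally_compact_space T \<and> Hausdorff_space T"

definition lch_short_exact ::
  "('n, 'm1) monoid_scheme \<Rightarrow> 'n topology \<Rightarrow> ('g, 'm2) monoid_scheme \<Rightarrow> 'g topology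
    \<Rightarrow> ('q, 'm3) monoid_scheme \<Rightarrow> 'q topology \<Rightarrow> ('n \<Rightarrow> 'g) \<Rightarrow> ('g \<Rightarrow> 'q) \<Rightarrow> bool" where
  "lch_short_exact N TN G TG Q TQ \<iota> p \<longleftrightarrow>
     lch_group N TN \<and> lch_group G TG \<and> lch_group Q TQ \<and>
     \<iota> \<in> mon N G \<and> p \<in> epi G Q \<and> kernel G Q p = \<iota> ` carrier N \<and>
     embedding_map TN TG \<iota> \<and> quotient_map TG TQ p"

definition has_section ::
  "('g, 'm1) monoid_scheme \<Rightarrow> 'g topology \<Rightarrow> ('q, 'm2) monoid_scheme \<Rightarrow> 'q topology
    \<Rightarrow> ('g \<Rightarrow> 'q) \<Rightarrow> bool" where
  "has_section G TG Q TQ p \<longleftrightarrow>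
     (\<exists>s\<in>hom Q G. continuous_map TQ TG s \<and> (\<forall>x\<in>carrier Q. p (s x) = x))"

definition character :: "('a, 'm) monoid_scheme \<Rightarrow> 'a topology \<Rightarrow> ('a \<Rightarrow> real) \<Rightarrow> bool" where
  "character G T \<psi> \<longleftrightarrow>
     continuous_map T euclideanreal \<psi> \<and>
     (\<forall>x\<in>carrier G. \<forall>y\<in>carrier G. \<psi> (x \<otimes>\<^bsub>G\<^esub> y) = \<psi> x + \<psi> y)"

definition halfspace :: "('a, 'm) monoid_scheme \<Rightarrow> ('a \<Rightarrow> real) \<Rightarrow> 'a set" where
  "halfspace G \<psi> = {g \<in> carrier G. \<psi> g \<ge> 0}"

definition delete_at :: "nat \<Rightarrow> 'a list \<Rightarrow> 'a list" where
  "delete_at i xs = take i xs @ drop (Suc i) xs"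

definition double_at :: "nat \<Rightarrow> 'a list \<Rightarrow> 'a list" where
  "double_at i xs = take (Suc i) xs @ drop i xs"

text \<open>The simplicial set \<open>E S\<close>; an \<open>n\<close>-simplex is a list of length \<open>n + 1\<close>.\<close>

definition E_sset :: "'a set \<Rightarrow> 'a list sset" where
  "E_sset S = \<lparr>smp = (\<lambda>n. {xs. length xs = Suc n \<and> set xs \<subseteq> S}),
               face = (\<lambda>n. delete_at), degen = (\<lambda>n. double_at)\<rparr>"

text \<open>\<open>H \<cdot> E C\<close> for a subset \<open>H\<close> of \<open>G\<close>.\<close>

definition translates :: "('a, 'm) monoid_scheme \<Rightarrow> 'a set \<Rightarrow> 'a set \<Rightarrow> 'a list sset" where
  "translates G H C =
     (E_sset (carrier G)) \<lparr>smp := (\<lambda>n. \<Union>g\<in>H. map (\<lambda>x. g \<otimes>\<^bsub>G\<^esub> x) ` smp (E_sset C) n)\<rparr>"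

definition type_C :: "nat \<Rightarrow> ('a, 'm) monoid_scheme \<Rightarrow> 'a topology \<Rightarrow> bool" where
  "type_C n G T \<longleftrightarrow>
     essentially_connected (int n - 1) (E_sset (carrier G)) {C. compactin T C}
       (translates G (carrier G))"

definition Sigma_top :: "nat \<Rightarrow> ('a, 'm) monoid_scheme \<Rightarrow> 'a topology \<Rightarrow> ('a \<Rightarrow> real) set" where
  "Sigma_top n G T =
     {\<psi>. character G T \<psi> \<and>
          essentially_connected (int n - 1) (E_sset (carrier G)) {C. compactin T C}
            (translates G (halfspace G \<psi>))}"


section \<open>Well-definedness\<close>

lemma istopology_quotient:
  "istopology (\<lambda>U. U \<subseteq> q ` topspace T \<and> openin T {x \<in> topspace T. q x \<in> U})"
proof -
  have "openin T {x \<in> topspace T. q x \<in> S \<inter> S'}"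
    if "openin T {x \<in> topspace T. q x \<in> S}" "openin T {x \<in> topspace T. q x \<in> S'}" for S S'
  proof -
    have "{x \<in> topspace T. q x \<in> S \<inter> S'} = {x \<in> topspace T. q x \<in> S} \<inter> {x \<in> topspace T. q x \<in> S'}"
      by blast
    then show ?thesis
      using that by auto
  qed
  moreover have "openin T {x \<in> topspace T. q x \<in> \<Union>\<K>}"
    if "\<forall>K\<in>\<K>. openin T {x \<in> topspace T. q x \<in> K}" for \<K>
  proof -
    have "{x \<in> topspace T. q x \<in> \<Union>\<K>} = \<Union>((\<lambda>K. {x \<in> topspace T. q x \<in> K}) ` \<K>)"
      by blast
    then show ?thesis
      using that by auto
  qed
  ultimately show ?thesis
    unfolding istopology_def by blast
qed

lemma openin_quotient_space:
  "openin (quotient_space T q) U \<longleftrightarrow>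
     U \<subseteq> q ` topspace T \<and> openin T {x \<in> topspace T. q x \<in> U}"
  by (simp add: quotient_space_def istopology_quotient)

lemma topspace_quotient_space: "topspace (quotient_space T q) = q ` topspace T"
proof -
  have "{x \<in> topspace T. q x \<in> q ` topspace T} = topspace T"
    by blast
  then have "openin (quotient_space T q) (q ` topspace T)"
    by (simp add: openin_quotient_space)
  then show ?thesis
    by (meson openin_quotient_space openin_subset openin_topspace subset_antisym)
qed

lemma quotient_map_quotient_space: "quotient_map T (quotient_space T q) q"
  by (simp add: quotient_map_def topspace_quotient_space openin_quotient_space)

lemma glue_mono: "simplicial_subset X Y \<Longrightarrow> glue X z w \<Longrightarrow> glue Y z w"
  by (erule glue.cases) (auto simp: simplicial_subset_def intro!: glue.intros)

lemma realization_incl_point: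
  assumes "simplicial_subset X Y"
  shows "realization_incl Y (realization_point X z) = realization_point Y z"
proof -
  have sub: "equivclp (glue Y) z w" if "equivclp (glue X) z w" for w
    using that
  proof (induction rule: equivclp_induct)
    case base
    then show ?case by simp
  next
    case (step u v)
    then show ?case
      by (meson assms glue_mono equivclp_into_equivclp)
  qed
  show ?thesis
    unfolding realization_incl_def realization_point_def
  proof (intro subset_antisym subsetI)
    fix w
    assume "w \<in> (\<Union>u\<in>{u. equivclp (glue X) z u}. {w. equivclp (glue Y) u w})"
    then show "w \<in> {w. equivclp (glue Y) z w}"
      using sub by (blast intro: equivclp_trans)
  next
    fix w
    assume "w \<in> {w. equivclp (glue Y) z w}"
    moreover have "equivclp (glue X) z z"
      by simp
    ultimately show "w \<in> (\<Union>u\<in>{u. equivclp (glue X) z u}. {w. equivclp (glue Y) u w})"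
      by blast
  qed
qed

corollary realization_incl_vertex_point:
  "simplicial_subset X Y \<Longrightarrow> realization_incl Y (vertex_point X x) = vertex_point Y x"
  by (simp add: vertex_point_def realization_incl_point)

lemma length_delete_at: "i < length xs \<Longrightarrow> length (delete_at i xs) = length xs - 1"
  by (simp add: delete_at_def)

lemma length_double_at: "i < length xs \<Longrightarrow> length (double_at i xs) = Suc (length xs)"
  by (simp add: double_at_def)

lemma nth_delete_at:
  "i < length xs \<Longrightarrow> j < length xs - 1 \<Longrightarrow> delete_at i xs ! j = xs ! (if j < i then j else Suc j)"
  by (simp add: delete_at_def nth_append)

lemma nth_double_at:
  "i < length xs \<Longrightarrow> j < Suc (length xs) \<Longrightarrow> double_at i xs ! j = xs ! (if j \<le> i then j else j - 1)"
  by (cases "Suc i = length xs")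
    (auto simp: double_at_def nth_append less_Suc_eq_le le_less_Suc_eq dest: sym)

lemma set_delete_at: "set (delete_at i xs) \<subseteq> set xs"
  by (auto simp: delete_at_def dest: in_set_takeD in_set_dropD)

lemma set_double_at: "set (double_at i xs) \<subseteq> set xs"
  by (auto simp: double_at_def dest: in_set_takeD in_set_dropD)

lemma map_delete_at: "map f (delete_at i xs) = delete_at i (map f xs)"
  by (simp add: delete_at_def take_map drop_map)

lemma map_double_at: "map f (double_at i xs) = double_at i (map f xs)"
  by (simp add: double_at_def take_map drop_map)

lemmas delete_double_at = length_delete_at length_double_at nth_delete_at nth_double_at

lemma delete_delete:
  "i < j \<Longrightarrow> j < length xs \<Longrightarrow> delete_at i (delete_at j xs) = delete_at (j - 1) (delete_at i xs)"
  by (rule nth_equalityI) (simp_all add: delete_double_at, (simp split: if_splits)?, arith?)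

lemma double_double:
  "i \<le> j \<Longrightarrow> j < length xs \<Longrightarrow> double_at i (double_at j xs) = double_at (Suc j) (double_at i xs)"
  by (rule nth_equalityI) (simp_all add: delete_double_at, (simp split: if_splits)?, arith?)

lemma delete_double_less:
  "i < j \<Longrightarrow> j < length xs \<Longrightarrow> delete_at i (double_at j xs) = double_at (j - 1) (delete_at i xs)"
  by (rule nth_equalityI) (simp_all add: delete_double_at, (simp split: if_splits)?, arith?)

lemma delete_double_eq:
  "i = j \<or> i = Suc j \<Longrightarrow> j < length xs \<Longrightarrow> delete_at i (double_at j xs) = xs"
  by (elim disjE; hypsubst; rule nth_equalityI) (simp_all add: delete_double_at, (simp split: if_splits)?, arith?)

lemma delete_double_greater:
  "Suc j < i \<Longrightarrow> i \<le> length xs \<Longrightarrow> delete_at i (double_at j xs) = double_at j (delete_at (i - 1) xs)"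
  by (rule nth_equalityI) (simp_all add: delete_double_at, (simp split: if_splits)?, arith?)

lemma simplicial_set_E_like:
  assumes f: "face X = face (E_sset S)" and d: "degen X = degen (E_sset S)"
    and len: "\<And>n xs. xs \<in> smp X n \<Longrightarrow> length xs = Suc n"
    and cf: "\<And>n i xs. xs \<in> smp X (Suc n) \<Longrightarrow> i \<le> Suc n \<Longrightarrow> delete_at i xs \<in> smp X n"
    and cd: "\<And>n i xs. xs \<in> smp X n \<Longrightarrow> i \<le> n \<Longrightarrow> double_at i xs \<in> smp X (Suc n)"
  shows "simplicial_set X"
proof -
  have fd: "face X n = delete_at" "degen X n = double_at" for n
    by (simp_all add: f d E_sset_def)
  show ?thesis
    unfolding simplicial_set_def fd
    by (intro conjI allI ballI impI funcsetI cf cd delete_delete double_double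
        delete_double_less delete_double_eq delete_double_greater)
      (auto dest: len)
qed

lemma simplicial_set_E: "simplicial_set (E_sset S)"
proof (rule simplicial_set_E_like[OF refl refl])
  show "delete_at i xs \<in> smp (E_sset S) n" if "xs \<in> smp (E_sset S) (Suc n)" "i \<le> Suc n" for n i xs
    using that set_delete_at[of i xs] by (auto simp: E_sset_def length_delete_at)
  show "double_at i xs \<in> smp (E_sset S) (Suc n)" if "xs \<in> smp (E_sset S) n" "i \<le> n" for n i xs
    using that set_double_at[of i xs] by (auto simp: E_sset_def length_double_at)
qed (simp add: E_sset_def)

lemma simplicial_set_translates: "simplicial_set (translates G H C)"
proof -
  have smp: "xs \<in> smp (translates G H C) n \<longleftrightarrow>
      (\<exists>g\<in>H. \<exists>ys\<in>smp (E_sset C) n. xs = map (\<lambda>x. g \<otimes>\<^bsub>G\<^esub> x) ys)" for n xs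
    by (auto simp: translates_def)
  have E: "i \<le> Suc n \<Longrightarrow> ys \<in> smp (E_sset C) (Suc n) \<Longrightarrow> delete_at i ys \<in> smp (E_sset C) n"
          "i \<le> n \<Longrightarrow> ys \<in> smp (E_sset C) n \<Longrightarrow> double_at i ys \<in> smp (E_sset C) (Suc n)" for i n ys
    using simplicial_set_E[of C] by (auto simp: simplicial_set_def E_sset_def Pi_iff)
  show ?thesis
  proof (rule simplicial_set_E_like[where S = "carrier G"])
    show "length xs = Suc n" if "xs \<in> smp (translates G H C) n" for n xs
      using that by (auto simp: smp E_sset_def)
    show "delete_at i xs \<in> smp (translates G H C) n"
      if "xs \<in> smp (translates G H C) (Suc n)" "i \<le> Suc n" for n i xs
    proof -
      obtain g ys where "g \<in> H" "ys \<in> smp (E_sset C) (Suc n)" "xs = map (\<lambda>x. g \<otimes>\<^bsub>G\<^esub> x) ys"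
        using \<open>xs \<in> _\<close> smp by blast
      then show ?thesis
        unfolding smp using E(1)[OF \<open>i \<le> _\<close>] by (auto simp: map_delete_at[symmetric])
    qed
    show "double_at i xs \<in> smp (translates G H C) (Suc n)"
      if "xs \<in> smp (translates G H C) n" "i \<le> n" for n i xs
    proof -
      obtain g ys where "g \<in> H" "ys \<in> smp (E_sset C) n" "xs = map (\<lambda>x. g \<otimes>\<^bsub>G\<^esub> x) ys"
        using \<open>xs \<in> _\<close> smp by blast
      then show ?thesis
        unfolding smp using E(2)[OF \<open>i \<le> _\<close>] by (auto simp: map_double_at[symmetric])
    qed
  qed (simp_all add: translates_def)
qed

lemma filtration_translates:
  assumes G: "group G" "topspace T = carrier G" and H: "\<one>\<^bsub>G\<^esub> \<in> H" "H \<subseteq> carrier G"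
  shows "filtration (E_sset (carrier G)) {C. compactin T C} (translates G H)"
proof -
  interpret group G by fact
  have sub: "smp (translates G H C) n \<subseteq> smp (E_sset (carrier G)) n" if "compactin T C" for C n
    using compactin_subset_topspace[OF that] H(2) G(2)
    by (auto simp: translates_def E_sset_def) (meson m_closed subsetD)
  have un: "\<exists>C. compactin T C \<and> xs \<in> smp (translates G H C) n"
    if "xs \<in> smp (E_sset (carrier G)) n" for n xs
  proof (intro exI conjI)
    show "compactin T (set xs)"
      using that G(2) by (intro finite_imp_compactin) (auto simp: E_sset_def)
    have "map (\<lambda>x. \<one>\<^bsub>G\<^esub> \<otimes>\<^bsub>G\<^esub> x) xs = xs"
      using that by (intro map_idI) (auto simp: E_sset_def)
    then show "xs \<in> smp (translates G H (set xs)) n"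
      using that H(1) by (force simp: translates_def E_sset_def)
  qed
  have dir: "\<exists>C''. compactin T C'' \<and> C \<subseteq> C'' \<and> C' \<subseteq> C''"
    if "compactin T C" "compactin T C'" for C C'
    using that compactin_Un by blast
  have mono: "smp (translates G H C) n \<subseteq> smp (translates G H C') n" if "C \<subseteq> C'" for C C' n
    using that by (fastforce simp: translates_def E_sset_def)
  have fd: "face (translates G H C) = face (E_sset (carrier G))"
           "degen (translates G H C) = degen (E_sset (carrier G))" for C
    by (simp_all add: translates_def)
  have "(\<Union>C\<in>{C. compactin T C}. smp (translates G H C) n) = smp (E_sset (carrier G)) n" for n
    using sub un by fast
  moreover have "{C. compactin T C} \<noteq> {}"
    using compactin_empty by blast
  ultimately show ?thesis
    unfolding filtration_def simplicial_subset_def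
    using sub mono dir by (simp add: fd simplicial_set_E simplicial_set_translates)
qed

lemma one_in_halfspace:
  assumes "group G" "character G T \<psi>"
  shows "\<one>\<^bsub>G\<^esub> \<in> halfspace G \<psi>"
proof -
  interpret group G by fact
  have "\<psi> (\<one>\<^bsub>G\<^esub> \<otimes>\<^bsub>G\<^esub> \<one>\<^bsub>G\<^esub>) = \<psi> \<one>\<^bsub>G\<^esub> + \<psi> \<one>\<^bsub>G\<^esub>"
    using assms(2) one_closed unfolding character_def by blast
  then show ?thesis
    by (simp add: halfspace_def)
qed

end

theory Submission
  imports Defs
begin

text \<open>All homotopies take place in the realization of \<open>E G\<close>: a point of it has a finite support in \<open>G\<close>, and
  the realization of \<open>H \<cdot> E C\<close> is the closed subspace of the points with support in some \<open>h C\<close>, \<open>h \<in> H\<close>.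
  Cut the cube into small cubes, each of which is mapped to one translate of a compact set.  Over these a
  map into the realization of \<open>E Q\<close> can be lifted to \<open>E G\<close> cell by cell: the lift of a cell stays in
  the translates of a compact set by one fibre of \<open>p\<close>, where spheres of dimension less than \<open>n\<close> bound because
  \<open>N\<close> is of type \<open>C\<^sub>n\<close>.  Hence a null homotopy in \<open>Q\<close> lifts to \<open>G\<close> relative to its boundary (part 2),
  and a sphere in \<open>Q\<close> is, up to a homotopy through translates of a compact set, the image of a sphere in \<open>G\<close>,
  whose null homotopy can be projected to \<open>Q\<close> (part 3).  Part 1 is functoriality.\<close>

section \<open>Realizations\<close>

text \<open>The map \<open>p\<close> need not have a continuous section, yet maps have to be lifted
  along it. What helps is that the vertices of E G carry no topology: any function on vertices, such
  as an arbitrary choice of representatives, induces a continuous map of realizations. Only the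
  compact sets in which vertices move need control, and these pass from Q to G because
  \<open>p\<close> is open and G is locally compact. A lift F of a map Phi is not one on the nose: p
  F agrees with Phi on the boundary of the cube, and inside, cell by cell, both run in translates by
  the same label \<open>qc c\<close>. This suffices in part 2, since a label in the half-space has
  its whole fibre in the half-space. In part 3 it leaves a second homotopy to be found, between the
  sphere and the projection of its lift. The dimensions explain the indices. Type C with index n
  fills cubes up to dimension n, that is, spheres up to dimension n - 1. Part 2 lifts a homotopy, a
  cube of dimension k + 1 with k < n; part 3 lifts only the sphere, a cube of dimension k with k < n
  + 1. Compact sets are always fixed before the loop is; only the mesh of the grid and the labels
  depend on the loop.\<close>

abbreviation simplex_space :: "nat \<Rightarrow> (nat \<Rightarrow> real) topology" where
  "simplex_space n \<equiv> subtopology (powertop_real UNIV) (standard_simplex n)"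

lemma topspace_pre_realization:
  "topspace (pre_realization X) = {((n, \<sigma>), t). \<sigma> \<in> smp X n \<and> t \<in> standard_simplex n}"
  by (auto simp: pre_realization_def)

lemma topspace_realization:
  "topspace (realization X) = realization_point X ` {((n, \<sigma>), t). \<sigma> \<in> smp X n \<and> t \<in> standard_simplex n}"
  by (simp add: realization_def topspace_quotient_space topspace_pre_realization)

lemma realization_pointE:
  assumes "c \<in> topspace (realization X)"
  obtains n \<sigma> t where "\<sigma> \<in> smp X n" "t \<in> standard_simplex n" "c = realization_point X ((n, \<sigma>), t)"
  using assms by (auto simp: topspace_realization)

lemma realization_point_in [intro]:
  "\<sigma> \<in> smp X n \<Longrightarrow> t \<in> standard_simplex n \<Longrightarrow> realization_point X ((n, \<sigma>), t) \<in> topspace (realization X)"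
  by (auto simp: topspace_realization)

lemma realization_point_self [simp]: "z \<in> realization_point X z"
  by (simp add: realization_point_def)

lemma realization_point_glue:
  assumes "glue X z w"
  shows "realization_point X z = realization_point X w"
proof -
  have "equivclp (glue X) z w"
    using assms by (rule r_into_equivclp)
  then show ?thesis
    unfolding realization_point_def by (auto intro: equivclp_trans equivclp_sym)
qed

lemma quotient_map_realization:
  "quotient_map (pre_realization X) (realization X) (realization_point X)"
  by (simp add: realization_def quotient_map_quotient_space)

lemma openin_pre_realization:
  "openin (pre_realization X) {z \<in> topspace (pre_realization X). P z} \<longleftrightarrow>
    (\<forall>n. \<forall>\<sigma>\<in>smp X n. openin (simplex_space n) {t \<in> standard_simplex n. P ((n, \<sigma>), t)})"
proof -
  have "{t. ((n, \<sigma>), t) \<in> {z \<in> topspace (pre_realization X). P z}} = {t \<in> standard_simplex n. P ((n, \<sigma>), t)}"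
    if "\<sigma> \<in> smp X n" for n \<sigma>
    using that by (auto simp: topspace_pre_realization)
  then show ?thesis
    unfolding pre_realization_def by (auto simp: openin_sum_topology)
qed

lemma closedin_pre_realization:
  "closedin (pre_realization X) {z \<in> topspace (pre_realization X). P z} \<longleftrightarrow>
    (\<forall>n. \<forall>\<sigma>\<in>smp X n. closedin (simplex_space n) {t \<in> standard_simplex n. P ((n, \<sigma>), t)})"
proof -
  have "{t. ((n, \<sigma>), t) \<in> {z \<in> topspace (pre_realization X). P z}} = {t \<in> standard_simplex n. P ((n, \<sigma>), t)}"
    if "\<sigma> \<in> smp X n" for n \<sigma>
    using that by (auto simp: topspace_pre_realization)
  then show ?thesis
    unfolding pre_realization_def by (auto simp: closedin_sum_topology)
qed

lemma openin_realization:
  assumes "U \<subseteq> topspace (realization X)"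
  shows "openin (realization X) U \<longleftrightarrow>
    (\<forall>n. \<forall>\<sigma>\<in>smp X n. openin (simplex_space n) {t \<in> standard_simplex n. realization_point X ((n, \<sigma>), t) \<in> U})"
  using quotient_map_realization[of X] assms openin_pre_realization[of X "\<lambda>z. realization_point X z \<in> U"]
  unfolding quotient_map_def by blast

lemma closedin_realization:
  assumes "U \<subseteq> topspace (realization X)"
  shows "closedin (realization X) U \<longleftrightarrow>
    (\<forall>n. \<forall>\<sigma>\<in>smp X n. closedin (simplex_space n) {t \<in> standard_simplex n. realization_point X ((n, \<sigma>), t) \<in> U})"
  using quotient_map_realization[of X] assms closedin_pre_realization[of X "\<lambda>z. realization_point X z \<in> U"]
  unfolding quotient_map_closedin by blast

lemma continuous_map_realization_simplex:
  assumes "\<sigma> \<in> smp X n"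
  shows "continuous_map (simplex_space n) (realization X) (\<lambda>t. realization_point X ((n, \<sigma>), t))"
proof -
  have "continuous_map (simplex_space n) (pre_realization X) (\<lambda>t. ((n, \<sigma>), t))"
    using continuous_map_component_injection[of "(n, \<sigma>)" "SIGMA n:UNIV. smp X n"
        "\<lambda>(n, \<sigma>). simplex_space n"] assms
    by (simp add: pre_realization_def)
  then show ?thesis
    using continuous_map_compose quotient_imp_continuous_map[OF quotient_map_realization]
    by (force simp: o_def)
qed

section \<open>Maps out of a realization, with parameters\<close>

definition rlift :: "('a spt \<Rightarrow> 'b) \<Rightarrow> 'a spt set \<Rightarrow> 'b" where
  "rlift h c = h (SOME z. z \<in> c)"

text \<open>Compatibility with a single gluing step propagates along chains of steps, so the
  representative picked by \<open>SOME\<close> is immaterial.\<close>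

lemma rlift_point:
  assumes "\<And>z w. glue X z w \<Longrightarrow> h z = h w"
  shows "rlift h (realization_point X z) = h z"
proof -
  have eq: "h z = h w" if "equivclp (glue X) z w" for w
    using that by (induction rule: equivclp_induct) (auto dest: assms)
  have "(SOME w. w \<in> realization_point X z) \<in> realization_point X z"
    by (rule someI) (rule realization_point_self)
  then show ?thesis
    unfolding rlift_def realization_point_def by (auto dest: eq)
qed

text \<open>The summands of the disjoint union are open, so continuity may be tested on one simplex
  at a time, with the parameter carried along.\<close>

lemma continuous_map_pre_realization_prod:
  assumes "\<And>n \<sigma>. \<sigma> \<in> smp X n \<Longrightarrow> continuous_map (prod_topology Z (simplex_space n)) T (\<lambda>(s, t). h s ((n, \<sigma>), t))"
  shows "continuous_map (prod_topology Z (pre_realization X)) T (\<lambda>(s, z). h s z)"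
proof (rule pasting_lemma[where I = "SIGMA n:UNIV. smp X n"
      and T = "\<lambda>i. topspace Z \<times> ({i} \<times> standard_simplex (fst i))" and f = "\<lambda>_ (s, z). h s z"])
  show "openin (prod_topology Z (pre_realization X)) (topspace Z \<times> ({i} \<times> standard_simplex (fst i)))"
    if "i \<in> (SIGMA n:UNIV. smp X n)" for i
  proof -
    have "{z \<in> topspace (pre_realization X). fst z = i} = {i} \<times> standard_simplex (fst i)"
      using that by (auto simp: topspace_pre_realization)
    moreover have "openin (simplex_space n) {t \<in> standard_simplex n. fst ((n, \<sigma>), t) = i}" for n \<sigma>
    proof (cases "(n, \<sigma>) = i")
      case True
      then have "{t \<in> standard_simplex n. fst ((n, \<sigma>), t) = i} = topspace (simplex_space n)"
        by (simp add: topspace_standard_simplex)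
      then show ?thesis
        by (metis openin_topspace)
    qed simp
    ultimately have "openin (pre_realization X) ({i} \<times> standard_simplex (fst i))"
      using openin_pre_realization[of X "\<lambda>z. fst z = i"] by simp
    then show ?thesis
      by (simp add: openin_prod_Times_iff)
  qed
  show "continuous_map (subtopology (prod_topology Z (pre_realization X))
      (topspace Z \<times> ({i} \<times> standard_simplex (fst i)))) T (\<lambda>(s, z). h s z)"
    if i: "i \<in> (SIGMA n:UNIV. smp X n)" for i
  proof -
    obtain n \<sigma> where n: "i = (n, \<sigma>)" "\<sigma> \<in> smp X n"
      using i by auto
    \<comment> \<open>Dropping the tag of a summand is continuous on that summand.\<close>
    have "continuous_map (subtopology (pre_realization X) ({i} \<times> standard_simplex n)) (simplex_space n) snd"
      unfolding continuous_map_def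
    proof (intro conjI allI impI)
      show "snd \<in> topspace (subtopology (pre_realization X) ({i} \<times> standard_simplex n)) \<rightarrow> topspace (simplex_space n)"
        by auto
      fix U assume U: "openin (simplex_space n) U"
      then have Us: "U \<subseteq> standard_simplex n"
        using openin_subset by fastforce
      have "openin (simplex_space m) {t \<in> standard_simplex m. ((m, \<tau>), t) \<in> {i} \<times> U}" for m \<tau>
      proof (cases "(m, \<tau>) = i")
        case True
        then have "{t \<in> standard_simplex m. ((m, \<tau>), t) \<in> {i} \<times> U} = U"
          using Us n by auto
        then show ?thesis
          using U n True by simp
      qed simp
      then have "openin (pre_realization X) {z \<in> topspace (pre_realization X). z \<in> {i} \<times> U}"
        by (subst openin_pre_realization) auto
      moreover have "{z \<in> topspace (subtopology (pre_realization X) ({i} \<times> standard_simplex n)). snd z \<in> U}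
        = {z \<in> topspace (pre_realization X). z \<in> {i} \<times> U} \<inter> ({i} \<times> standard_simplex n)"
        using Us by auto
      ultimately show "openin (subtopology (pre_realization X) ({i} \<times> standard_simplex n))
          {z \<in> topspace (subtopology (pre_realization X) ({i} \<times> standard_simplex n)). snd z \<in> U}"
        by (simp add: openin_subtopology_Int)
    qed
    then have "continuous_map (prod_topology Z (subtopology (pre_realization X) ({i} \<times> standard_simplex n)))
       (prod_topology Z (simplex_space n)) (\<lambda>(s, z). (s, snd z))"
      by (simp add: continuous_map_prod_top)
    then have "continuous_map (prod_topology Z (subtopology (pre_realization X) ({i} \<times> standard_simplex n))) T
       ((\<lambda>(s, t). h s ((n, \<sigma>), t)) \<circ> (\<lambda>(s, z). (s, snd z)))"
      using assms[OF n(2)] by (rule continuous_map_compose)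
    then show ?thesis
      unfolding n(1) fst_conv prod_topology_subtopology(2)[symmetric] subtopology_Times subtopology_topspace
      by (rule continuous_map_eq) auto
  qed
qed (auto simp: topspace_pre_realization)

text \<open>The product of a quotient map with a locally compact Hausdorff space is again a quotient
  map. This is what allows homotopies on a realization to be defined simplex by simplex.\<close>

lemma continuous_map_rlift_prod:
  assumes glue: "\<And>s z w. glue X z w \<Longrightarrow> h s z = h s w"
    and cont: "\<And>n \<sigma>. \<sigma> \<in> smp X n \<Longrightarrow> continuous_map (prod_topology Z (simplex_space n)) T (\<lambda>(s, t). h s ((n, \<sigma>), t))"
    and Z: "locally_compact_space Z" "Hausdorff_space Z"
  shows "continuous_map (prod_topology Z (realization X)) T (\<lambda>(s, c). rlift (h s) c)"
proof -
  have q: "quotient_map (prod_topology Z (pre_realization X)) (prod_topology Z (realization X))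
     (\<lambda>(s, z). (s, realization_point X z))"
    using Z quotient_map_realization by (intro quotient_map_prod_right) auto
  have "(\<lambda>(s, c). rlift (h s) c) \<circ> (\<lambda>(s, z). (s, realization_point X z)) = (\<lambda>(s, z). h s z)"
    by (auto simp: rlift_point[OF glue])
  then show ?thesis
    using continuous_compose_quotient_map[OF q] continuous_map_pre_realization_prod[of X Z T h, OF cont]
    by metis
qed

lemma continuous_map_rlift:
  assumes glue: "\<And>z w. glue X z w \<Longrightarrow> h z = h w"
    and cont: "\<And>n \<sigma>. \<sigma> \<in> smp X n \<Longrightarrow> continuous_map (simplex_space n) T (\<lambda>t. h ((n, \<sigma>), t))"
  shows "continuous_map (realization X) T (rlift h)"
proof -
  \<comment> \<open>A one-point parameter space reduces the claim to the version with
    parameters.\<close>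
  have "continuous_map (prod_topology (top_of_set {0::real}) (realization X)) T (\<lambda>(s, c). rlift h c)"
    using continuous_map_compose[OF continuous_map_snd cont]
    by (intro continuous_map_rlift_prod glue) (auto simp: o_def case_prod_unfold intro!: compact_imp_locally_compact_space Hausdorff_space_subtopology compact_space_subtopology)
  moreover have "continuous_map (realization X) (prod_topology (top_of_set {0::real}) (realization X)) (\<lambda>c. (0, c))"
    by (auto simp: continuous_map_pairwise o_def)
  ultimately show ?thesis
    using continuous_map_compose by (force simp: o_def)
qed

section \<open>Simplicial sets of tuples\<close>

text \<open>An \<open>n\<close>-simplex is an \<open>(n + 1)\<close>-tuple, possibly with repetitions, whose set of entries satisfies
  \<open>K\<close>; both \<open>E S\<close> and \<open>H \<cdot> E C\<close> are of this form.\<close>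

definition vset_sset :: "('a set \<Rightarrow> bool) \<Rightarrow> 'a list sset" where
  "vset_sset K = \<lparr>smp = (\<lambda>n. {xs. length xs = Suc n \<and> K (set xs)}),
     face = (\<lambda>n. delete_at), degen = (\<lambda>n. double_at)\<rparr>"

definition hereditary :: "('a set \<Rightarrow> bool) \<Rightarrow> bool" where
  "hereditary K \<longleftrightarrow> (\<forall>F F'. K F \<longrightarrow> F' \<subseteq> F \<longrightarrow> K F')"

lemma hereditaryD: "hereditary K \<Longrightarrow> K F \<Longrightarrow> F' \<subseteq> F \<Longrightarrow> K F'"
  unfolding hereditary_def by blast

lemma smp_vset [simp]: "xs \<in> smp (vset_sset K) n \<longleftrightarrow> length xs = Suc n \<and> K (set xs)"
  by (simp add: vset_sset_def)

lemma face_vset [simp]: "face (vset_sset K) n i xs = delete_at i xs"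
  by (simp add: vset_sset_def)

lemma degen_vset [simp]: "degen (vset_sset K) n i xs = double_at i xs"
  by (simp add: vset_sset_def)

section \<open>Barycentric coordinates under faces and degeneracies\<close>

lemma standard_simplexD:
  assumes "t \<in> standard_simplex n"
  shows "0 \<le> t i" "t i \<le> 1" "i > n \<Longrightarrow> t i = 0" "(\<Sum>i\<le>n. t i) = 1"
  using assms by (auto simp: standard_simplex_def)

lemma standard_simplexI:
  assumes "\<And>i. 0 \<le> t i" "\<And>i. i > n \<Longrightarrow> t i = 0" "(\<Sum>i\<le>n. t i) = 1"
  shows "t \<in> standard_simplex n"
proof -
  have "t i \<le> 1" for i
    using assms member_le_sum[of i "{..n}" t] by (cases "i \<le> n") auto
  then show ?thesis
    using assms by (auto simp: standard_simplex_def)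
qed

lemma standard_simplex_pos:
  assumes "t \<in> standard_simplex n"
  obtains i where "i \<le> n" "t i > 0"
proof -
  have "\<exists>i\<le>n. t i > 0"
  proof (rule ccontr)
    assume "\<not> ?thesis"
    then have "(\<Sum>i\<le>n. t i) = 0"
      using standard_simplexD(1)[OF assms] by (intro sum.neutral) (metis atMost_iff leD le_less)
    then show False
      using standard_simplexD(4)[OF assms] by simp
  qed
  then show thesis
    using that by blast
qed

lemma simplical_face_mem:
  "t \<in> standard_simplex n \<Longrightarrow> i \<le> Suc n \<Longrightarrow> simplical_face i t \<in> standard_simplex (Suc n)"
  using simplical_face_in_standard_simplex[of "Suc n" i t] by simp

lemma sum_simplicial_codegen:
  assumes "i \<le> n"
  shows "(\<Sum>j\<le>n. simplicial_codegen i t j) = (\<Sum>j\<le>Suc n. t j)"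
  using assms
proof (induction n)
  case 0
  then show ?case by (simp add: simplicial_codegen_def)
next
  case (Suc n)
  show ?case
  proof (cases "i = Suc n")
    case True
    then have "(\<Sum>j\<le>n. simplicial_codegen i t j) = (\<Sum>j\<le>n. t j)"
      by (intro sum.cong) (auto simp: simplicial_codegen_def)
    then show ?thesis
      using True by (simp add: simplicial_codegen_def)
  next
    case False
    then show ?thesis
      using Suc by (simp add: simplicial_codegen_def)
  qed
qed

lemma simplicial_codegen_mem:
  assumes "t \<in> standard_simplex (Suc n)" "i \<le> n"
  shows "simplicial_codegen i t \<in> standard_simplex n"
proof (rule standard_simplexI)
  show "(\<Sum>j\<le>n. simplicial_codegen i t j) = 1"
    using sum_simplicial_codegen[OF assms(2)] standard_simplexD(4)[OF assms(1)] by simp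
qed (use assms standard_simplexD[OF assms(1)] in \<open>auto simp: simplicial_codegen_def\<close>)

section \<open>The support (carrier) of a point\<close>

fun pre_supp :: "'a list spt \<Rightarrow> 'a set" where
  "pre_supp ((n, xs), t) = {xs ! i | i. i \<le> n \<and> t i > 0}"

lemma glue_vset_cases:
  assumes "glue (vset_sset K) z w"
  obtains (face) xs n i t where "length xs = Suc (Suc n)" "K (set xs)" "i \<le> Suc n" "t \<in> standard_simplex n"
      "z = ((n, delete_at i xs), t)" "w = ((Suc n, xs), simplical_face i t)"
    | (degen) xs n i t where "length xs = Suc n" "K (set xs)" "i \<le> n" "t \<in> standard_simplex (Suc n)"
      "z = ((Suc n, double_at i xs), t)" "w = ((n, xs), simplicial_codegen i t)"
  using assms by (cases rule: glue.cases) auto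

text \<open>A face relation only inserts a vertex of weight 0. A degeneracy relation adds the
  weights of two copies of one vertex, and for nonnegative weights the sum is positive iff one
  summand is. So the set of vertices of positive weight, unlike the list of all vertices, does not
  depend on the representative.\<close>

lemma pre_supp_glue:
  assumes "glue (vset_sset K) z w"
  shows "pre_supp z = pre_supp w"
  using assms
proof (cases rule: glue_vset_cases)
  case (face xs n i t)
  have "(\<exists>j\<le>n. v = delete_at i xs ! j \<and> t j > 0) \<longleftrightarrow> (\<exists>j\<le>Suc n. v = xs ! j \<and> simplical_face i t j > 0)" for v
  proof
    assume "\<exists>j\<le>n. v = delete_at i xs ! j \<and> t j > 0"
    then obtain j where "j \<le> n" "v = delete_at i xs ! j" "t j > 0" by blast
    then show "\<exists>j\<le>Suc n. v = xs ! j \<and> simplical_face i t j > 0"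
      using face(1,3) by (intro exI[of _ "if j < i then j else Suc j"]) (auto simp: nth_delete_at simplical_face_def)
  next
    assume "\<exists>j\<le>Suc n. v = xs ! j \<and> simplical_face i t j > 0"
    then obtain j where "j \<le> Suc n" "v = xs ! j" "simplical_face i t j > 0" by blast
    then show "\<exists>j\<le>n. v = delete_at i xs ! j \<and> t j > 0"
      using face(1,3) by (intro exI[of _ "if j < i then j else j - 1"])
        (auto simp: nth_delete_at simplical_face_def split: if_splits)
  qed
  then show ?thesis
    unfolding face(5,6) by auto
next
  case (degen xs n i t)
  note nonneg = standard_simplexD(1)[OF degen(4)]
  have "(\<exists>j\<le>Suc n. v = double_at i xs ! j \<and> t j > 0) \<longleftrightarrow> (\<exists>j\<le>n. v = xs ! j \<and> simplicial_codegen i t j > 0)" for v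
  proof
    assume "\<exists>j\<le>Suc n. v = double_at i xs ! j \<and> t j > 0"
    then obtain j where j: "j \<le> Suc n" "v = double_at i xs ! j" "t j > 0" by blast
    then show "\<exists>j\<le>n. v = xs ! j \<and> simplicial_codegen i t j > 0"
      using degen(1,3) nonneg[of i] nonneg[of "Suc i"]
      by (intro exI[of _ "if j \<le> i then j else j - 1"])
        (auto simp: nth_double_at simplicial_codegen_def add_pos_nonneg add_nonneg_pos not_le less_Suc_eq_le intro: add_pos_nonneg add_nonneg_pos)
  next
    assume "\<exists>j\<le>n. v = xs ! j \<and> simplicial_codegen i t j > 0"
    then obtain j where j: "j \<le> n" "v = xs ! j" "simplicial_codegen i t j > 0" by blast
    \<comment> \<open>Of the two positions merged into \<open>i\<close>, one with positive weight is
      taken.\<close>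
    then show "\<exists>j\<le>Suc n. v = double_at i xs ! j \<and> t j > 0"
      using degen(1,3) nonneg[of i] nonneg[of "Suc i"]
      by (intro exI[of _ "if j < i \<or> (j = i \<and> t i > 0) then j else Suc j"])
        (auto simp: nth_double_at simplicial_codegen_def split: if_splits)
  qed
  then show ?thesis
    unfolding degen(5,6) by auto
qed

definition supp :: "'a list spt set \<Rightarrow> 'a set" where
  "supp = rlift pre_supp"

lemma supp_point [simp]:
  "supp (realization_point (vset_sset K) ((n, xs), t)) = {xs ! i | i. i \<le> n \<and> t i > 0}"
proof -
  have "supp (realization_point (vset_sset K) z) = pre_supp z" for z
    unfolding supp_def by (rule rlift_point) (rule pre_supp_glue)
  then show ?thesis by simp
qed

lemma supp_props:
  assumes "c \<in> topspace (realization (vset_sset K))" "hereditary K"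
  shows "finite (supp c)" "supp c \<noteq> {}" "K (supp c)"
proof -
  obtain n xs t where c: "length xs = Suc n" "K (set xs)" "t \<in> standard_simplex n"
    "c = realization_point (vset_sset K) ((n, xs), t)"
    using assms by (auto elim!: realization_pointE)
  have "supp c \<subseteq> set xs"
    using c(1) by (auto simp: c(4) less_Suc_eq_le)
  then show "finite (supp c)" "K (supp c)"
    using c(2) assms(2) by (auto intro: finite_subset hereditaryD)
  show "supp c \<noteq> {}"
    using standard_simplex_pos[OF c(3)] by (auto simp: c(4))
qed

lemma continuous_map_simplex_coord: "continuous_map (simplex_space n) euclideanreal (\<lambda>t. t i)"
  by (intro continuous_map_from_subtopology continuous_map_product_projection) auto

text \<open>The open star of a vertex: on each simplex it is the union, over the positions where
  \<open>v\<close> occurs, of the open sets on which that coordinate is positive. Pulled back to a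
  cube, the stars form the cover that determines the mesh of the grid.\<close>

lemma openin_star:
  "openin (realization (vset_sset K)) {c \<in> topspace (realization (vset_sset K)). v \<in> supp c}"
proof -
  have "openin (simplex_space n) {t \<in> standard_simplex n.
      realization_point (vset_sset K) ((n, xs), t) \<in> {c \<in> topspace (realization (vset_sset K)). v \<in> supp c}}"
    if "xs \<in> smp (vset_sset K) n" for n xs
  proof -
    have "openin (simplex_space n) {t \<in> topspace (simplex_space n). t i \<in> {0<..}}" for i
      by (rule openin_continuous_map_preimage[OF continuous_map_simplex_coord]) auto
    then have "openin (simplex_space n) (\<Union>i\<in>{i. i \<le> n \<and> xs ! i = v}. {t \<in> standard_simplex n. 0 < t i})"
      by (intro openin_Union) (auto simp: topspace_standard_simplex)
    moreover have "{t \<in> standard_simplex n.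
        realization_point (vset_sset K) ((n, xs), t) \<in> {c \<in> topspace (realization (vset_sset K)). v \<in> supp c}}
      = (\<Union>i\<in>{i. i \<le> n \<and> xs ! i = v}. {t \<in> standard_simplex n. 0 < t i})"
      using that by (auto intro!: realization_point_in)
    ultimately show ?thesis by simp
  qed
  then show ?thesis
    by (subst openin_realization) auto
qed

lemma realization_point_face:
  assumes "length xs = Suc (Suc n)" "K (set xs)" "i \<le> Suc n" "t \<in> standard_simplex n"
  shows "realization_point (vset_sset K) ((Suc n, xs), simplical_face i t)
    = realization_point (vset_sset K) ((n, delete_at i xs), t)"
  using realization_point_glue[OF glue.face[of xs "vset_sset K" n i t]] assms by simp

lemma realization_point_degen:
  assumes "length xs = Suc n" "K (set xs)" "i \<le> n" "t \<in> standard_simplex (Suc n)"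
  shows "realization_point (vset_sset K) ((n, xs), simplicial_codegen i t)
    = realization_point (vset_sset K) ((Suc n, double_at i xs), t)"
  using realization_point_glue[OF glue.degen[of xs "vset_sset K" n i t]] assms by simp

lemma zero_coordinate_face:
  assumes "t \<in> standard_simplex (Suc n)" "i \<le> Suc n" "t i = 0"
  obtains u where "u \<in> standard_simplex n" "t = simplical_face i u" "\<And>j. u j = t (if j < i then j else Suc j)"
proof
  let ?u = "\<lambda>j. t (if j < i then j else Suc j)"
  show "?u j = t (if j < i then j else Suc j)" for j
    by (rule refl)
  show t: "t = simplical_face i ?u"
    using assms(3) by (auto simp: simplical_face_def fun_eq_iff)
  have "(\<Sum>j\<le>n. ?u j) = (\<Sum>j\<in>{..Suc n} - {i}. t j)"
    by (rule sum.reindex_bij_witness[of _ "\<lambda>j. if j < i then j else j - 1" "\<lambda>j. if j < i then j else Suc j"])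
      (use assms(2) in auto)
  also have "\<dots> = (\<Sum>j\<le>Suc n. t j)"
    using assms by (simp add: sum_diff1)
  finally show "?u \<in> standard_simplex n"
    using standard_simplexD[OF assms(1)] assms(2) by (intro standard_simplexI) auto
qed

text \<open>Vertices of weight zero may be exchanged at will. If some coordinate vanishes, both
  points lie on the facet opposite to it and the induction hypothesis applies there; if none
  vanishes, the two lists are equal.\<close>

lemma realization_point_cong:
  assumes "hereditary K" "length xs = Suc n" "length ys = Suc n" "K (set xs)" "K (set ys)"
    and "t \<in> standard_simplex n" "\<And>i. i \<le> n \<Longrightarrow> t i > 0 \<Longrightarrow> xs ! i = ys ! i"
  shows "realization_point (vset_sset K) ((n, xs), t) = realization_point (vset_sset K) ((n, ys), t)"
  using assms(2-)
proof (induction n arbitrary: xs ys t)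
  case 0
  then have "t 0 > 0"
    using standard_simplex_pos[of t 0] by (metis le_zero_eq)
  then have "xs = ys"
    using 0 by (intro nth_equalityI) auto
  then show ?case by simp
next
  case (Suc n)
  show ?case
  proof (cases "\<exists>i\<le>Suc n. t i = 0")
    case True
    then obtain i where i: "i \<le> Suc n" "t i = 0" by blast
    obtain u where u: "u \<in> standard_simplex n" "t = simplical_face i u" "\<And>j. u j = t (if j < i then j else Suc j)"
      using zero_coordinate_face[OF Suc.prems(5) i] by metis
    have "realization_point (vset_sset K) ((n, delete_at i xs), u) = realization_point (vset_sset K) ((n, delete_at i ys), u)"
    proof (rule Suc.IH)
      show "K (set (delete_at i xs))" "K (set (delete_at i ys))"
        using Suc.prems hereditaryD[OF assms(1)] set_delete_at by metis+
      show "delete_at i xs ! j = delete_at i ys ! j" if "j \<le> n" "u j > 0" for j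
        using that Suc.prems i u(3) by (auto simp: nth_delete_at)
    qed (use Suc.prems(1,2) u(1) i(1) in \<open>auto simp: length_delete_at\<close>)
    then show ?thesis
      using Suc.prems(1-4) i(1) u(1,2) by (simp add: realization_point_face)
  next
    case False
    then have "t i > 0" if "i \<le> Suc n" for i
      using that standard_simplexD(1)[OF Suc.prems(5), of i] by (metis le_less)
    then have "xs = ys"
      using Suc.prems by (intro nth_equalityI) auto
    then show ?thesis by simp
  qed
qed

section \<open>Induced maps and homotopies between contiguous maps\<close>

definition rmap :: "('b set \<Rightarrow> bool) \<Rightarrow> ('a \<Rightarrow> 'b) \<Rightarrow> 'a list spt set \<Rightarrow> 'b list spt set" where
  "rmap K \<phi> = rlift (\<lambda>((n, xs), t). realization_point (vset_sset K) ((n, map \<phi> xs), t))"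

locale vertex_map =
  fixes L :: "'a set \<Rightarrow> bool" and K :: "'b set \<Rightarrow> bool" and \<phi> :: "'a \<Rightarrow> 'b"
  assumes K_image: "L F \<Longrightarrow> K (\<phi> ` F)"
begin

lemma rmap_glue:
  assumes "glue (vset_sset L) z w"
  shows "(\<lambda>((n, xs), t). realization_point (vset_sset K) ((n, map \<phi> xs), t)) z
    = (\<lambda>((n, xs), t). realization_point (vset_sset K) ((n, map \<phi> xs), t)) w"
  using assms
proof (cases rule: glue_vset_cases)
  case (face xs n i t)
  then show ?thesis
    using realization_point_face[of "map \<phi> xs" n K i t] K_image[of "set xs"] by (simp add: map_delete_at)
next
  case (degen xs n i t)
  then show ?thesis
    using realization_point_degen[of "map \<phi> xs" n K i t] K_image[of "set xs"] by (simp add: map_double_at)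
qed

lemma rmap_point [simp]:
  "rmap K \<phi> (realization_point (vset_sset L) ((n, xs), t)) = realization_point (vset_sset K) ((n, map \<phi> xs), t)"
  unfolding rmap_def using rlift_point[of "vset_sset L", OF rmap_glue] by simp

lemma continuous_map_rmap:
  "continuous_map (realization (vset_sset L)) (realization (vset_sset K)) (rmap K \<phi>)"
  unfolding rmap_def
proof (rule continuous_map_rlift)
  fix n xs
  assume "xs \<in> smp (vset_sset L) n"
  then show "continuous_map (simplex_space n) (realization (vset_sset K))
      (\<lambda>t. (\<lambda>((n, xs), t). realization_point (vset_sset K) ((n, map \<phi> xs), t)) ((n, xs), t))"
    using continuous_map_realization_simplex[of "map \<phi> xs" "vset_sset K" n] K_image[of "set xs"] by simp
qed (rule rmap_glue)

lemma supp_rmap: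
  assumes "c \<in> topspace (realization (vset_sset L))"
  shows "supp (rmap K \<phi> c) = \<phi> ` supp c"
proof -
  obtain n xs t where "length xs = Suc n" "c = realization_point (vset_sset L) ((n, xs), t)"
    using assms by (auto elim!: realization_pointE)
  then show ?thesis
    by force
qed

end

text \<open>The weights of the point that divides the segment from \<open>t\<close> to a second copy of \<open>t\<close> in the
  ratio \<open>s : 1 - s\<close>, in the join of two \<open>n\<close>-simplices.\<close>

definition join_weights :: "nat \<Rightarrow> real \<Rightarrow> (nat \<Rightarrow> real) \<Rightarrow> nat \<Rightarrow> real" where
  "join_weights n s t = (\<lambda>i. if i \<le> n then (1 - s) * t i else if i \<le> 2 * n + 1 then s * t (i - Suc n) else 0)"

lemma join_weights_mem:
  assumes "t \<in> standard_simplex n" "s \<in> {0..1}"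
  shows "join_weights n s t \<in> standard_simplex (2 * n + 1)"
proof (rule standard_simplexI)
  have "{..2 * n + 1} = {..n} \<union> {Suc n..2 * n + 1}"
    by auto
  then have "(\<Sum>i\<le>2 * n + 1. join_weights n s t i)
      = (\<Sum>i\<le>n. join_weights n s t i) + (\<Sum>i\<in>{Suc n..2 * n + 1}. join_weights n s t i)"
    by (simp only: sum.union_disjoint finite_atMost finite_atLeastAtMost) (rule sum.union_disjoint; auto)
  also have "(\<Sum>i\<in>{Suc n..2 * n + 1}. join_weights n s t i) = (\<Sum>i\<le>n. s * t i)"
    by (rule sum.reindex_bij_witness[of _ "\<lambda>i. i + Suc n" "\<lambda>i. i - Suc n"]) (auto simp: join_weights_def)
  also have "(\<Sum>i\<le>n. join_weights n s t i) = (\<Sum>i\<le>n. (1 - s) * t i)"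
    by (rule sum.cong) (auto simp: join_weights_def)
  finally show "(\<Sum>i\<le>2 * n + 1. join_weights n s t i) = 1"
    using standard_simplexD(4)[OF assms(1)] by (simp add: sum_distrib_left[symmetric])
qed (use assms standard_simplexD[OF assms(1)] in \<open>auto simp: join_weights_def\<close>)

text \<open>A zero coordinate of \<open>t\<close> occurs once in each block of the join. The inner
  insertion is the one in the second block, made while that block still starts at n + 1. For
  degeneracies the order is reversed: merging in the first block comes first and brings the start of
  the second block down to n + 1.\<close>

lemma join_weights_face:
  assumes "i \<le> Suc n"
  shows "join_weights (Suc n) s (simplical_face i t)
    = simplical_face i (simplical_face (n + 1 + i) (join_weights n s t))"
  using assms by (auto simp: join_weights_def simplical_face_def fun_eq_iff)

lemma join_weights_degen:
  assumes "i \<le> n"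
  shows "join_weights n s (simplicial_codegen i t)
    = simplicial_codegen (n + 1 + i) (simplicial_codegen i (join_weights (Suc n) s t))"
  using assms by (auto simp: join_weights_def simplicial_codegen_def fun_eq_iff algebra_simps Suc_diff_Suc)

text \<open>The straight-line homotopy from \<open>\<phi>\<close> at s = 0 to \<open>\<psi>\<close>
  at s = 1. Using one simplex on all 2n + 2 vertices avoids a triangulation of the prism.\<close>

definition rjoin :: "('b set \<Rightarrow> bool) \<Rightarrow> ('a \<Rightarrow> 'b) \<Rightarrow> ('a \<Rightarrow> 'b) \<Rightarrow> real \<Rightarrow> 'a list spt set \<Rightarrow> 'b list spt set" where
  "rjoin K \<phi> \<psi> s =
     rlift (\<lambda>((n, xs), t). realization_point (vset_sset K) ((2 * n + 1, map \<phi> xs @ map \<psi> xs), join_weights n s t))"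

text \<open>The appended vertices have weight zero and are removed one at a time, from the end, by
  face relations.\<close>

lemma realization_point_append_right:
  assumes "length xs = Suc n" "K (set xs \<union> set ys)" "hereditary K" "t \<in> standard_simplex n"
  shows "realization_point (vset_sset K) ((n + length ys, xs @ ys), t) = realization_point (vset_sset K) ((n, xs), t)"
  using assms(2)
proof (induction ys rule: rev_induct)
  case (snoc y ys)
  have t: "t \<in> standard_simplex (n + length ys)"
    using assms(4) standard_simplex_mono by (meson le_add1 subsetD)
  have "t = simplical_face (Suc (n + length ys)) t"
    using standard_simplexD(3)[OF assms(4)] by (auto simp: simplical_face_def fun_eq_iff)
  moreover have "delete_at (Suc (n + length ys)) (xs @ ys @ [y]) = xs @ ys"
    using assms(1) by (simp add: delete_at_def)
  ultimately have "realization_point (vset_sset K) ((n + length (ys @ [y]), xs @ ys @ [y]), t)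
    = realization_point (vset_sset K) ((n + length ys, xs @ ys), t)"
    using realization_point_face[of "xs @ ys @ [y]" "n + length ys" K "Suc (n + length ys)" t] snoc assms t by simp
  also have "\<dots> = realization_point (vset_sset K) ((n, xs), t)"
    using snoc hereditaryD[OF assms(3)] by (metis Un_mono order_refl set_append sup_ge1)
  finally show ?case .
qed simp

text \<open>Here the weights are shifted as well. That the shifted weights form a point of the
  simplex is proved along, because the face relation in the induction step requires it.\<close>

lemma realization_point_append_left:
  assumes "length xs = Suc n" "K (set ys \<union> set xs)" "hereditary K" "t \<in> standard_simplex n"
  shows "realization_point (vset_sset K) ((length ys + n, ys @ xs), \<lambda>i. if i < length ys then 0 else t (i - length ys))
    = realization_point (vset_sset K) ((n, xs), t)
    \<and> (\<lambda>i. if i < length ys then 0 else t (i - length ys)) \<in> standard_simplex (length ys + n)"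
  using assms(2)
proof (induction ys)
  case Nil
  then show ?case using assms by simp
next
  case (Cons y ys)
  let ?t = "\<lambda>i. if i < length ys then 0 else t (i - length ys)"
  have K: "K (set ys \<union> set xs)"
    by (rule hereditaryD[OF assms(3) Cons.prems]) auto
  note IH = Cons.IH[OF K]
  have "(\<lambda>i. if i < length (y # ys) then 0 else t (i - length (y # ys))) = simplical_face 0 ?t"
    by (auto simp: simplical_face_def fun_eq_iff)
  moreover have "delete_at 0 (y # ys @ xs) = ys @ xs"
    by (simp add: delete_at_def)
  ultimately show ?case
    using realization_point_face[of "y # ys @ xs" "length ys + n" K 0 ?t] IH Cons.prems assms(1)
      simplical_face_mem[of ?t "length ys + n" 0]
    by simp
qed

lemma delete_at_append:
  "delete_at i (xs @ ys) = (if i < length xs then delete_at i xs @ ys else xs @ delete_at (i - length xs) ys)"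
  by (auto simp: delete_at_def Suc_diff_le)

lemma double_at_append:
  "double_at i (xs @ ys) = (if i < length xs then double_at i xs @ ys else xs @ double_at (i - length xs) ys)"
  by (auto simp: double_at_def Suc_diff_le)

locale contiguous_maps =
  fixes L :: "'a set \<Rightarrow> bool" and K :: "'b set \<Rightarrow> bool" and \<phi> \<psi> :: "'a \<Rightarrow> 'b"
  assumes hereditary: "hereditary K" and K_join: "L F \<Longrightarrow> K (\<phi> ` F \<union> \<psi> ` F)"
begin

lemma rjoin_glue:
  assumes "glue (vset_sset L) z w" "s \<in> {0..1}"
  shows "(\<lambda>((n, xs), t). realization_point (vset_sset K) ((2 * n + 1, map \<phi> xs @ map \<psi> xs), join_weights n s t)) z
    = (\<lambda>((n, xs), t). realization_point (vset_sset K) ((2 * n + 1, map \<phi> xs @ map \<psi> xs), join_weights n s t)) w"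
  using assms(1)
proof (cases rule: glue_vset_cases)
  case (face xs n i t)
  let ?L = "map \<phi> xs @ map \<psi> xs" and ?u = "join_weights n s t"
  let ?D = "delete_at i ?L"
  have u: "?u \<in> standard_simplex (2 * n + 1)" "simplical_face (n + 1 + i) ?u \<in> standard_simplex (2 * n + 2)"
    using join_weights_mem[OF face(4) assms(2)] simplical_face_mem[of ?u "2 * n + 1" "n + 1 + i"] face(3) by auto
  have K: "K (set ?L)"
    using K_join[OF face(2)] by simp
  then have KD: "K (set ?D)"
    using hereditaryD[OF hereditary] set_delete_at by metis
  have "realization_point (vset_sset K) ((2 * Suc n + 1, ?L), join_weights (Suc n) s (simplical_face i t))
    = realization_point (vset_sset K) ((2 * n + 2, ?D), simplical_face (n + 1 + i) ?u)"
    using realization_point_face[of ?L "2 * n + 2" K i "simplical_face (n + 1 + i) ?u"] face K u(2)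
    by (simp add: join_weights_face)
  also have "\<dots> = realization_point (vset_sset K) ((2 * n + 1, delete_at (n + 1 + i) ?D), ?u)"
    using realization_point_face[of ?D "2 * n + 1" K "n + 1 + i" ?u] face KD u(1)
    by (simp add: length_delete_at)
  also have "delete_at (n + 1 + i) ?D = map \<phi> (delete_at i xs) @ map \<psi> (delete_at i xs)"
    using face(1,3) by (simp add: delete_at_append map_delete_at length_delete_at)
  finally show ?thesis
    using face by simp
next
  case (degen xs n i t)
  let ?L = "map \<phi> xs @ map \<psi> xs" and ?u = "join_weights (Suc n) s t"
  let ?D = "double_at (n + 1 + i) ?L"
  have u: "?u \<in> standard_simplex (2 * n + 3)" "simplicial_codegen i ?u \<in> standard_simplex (2 * n + 2)"
    using join_weights_mem[OF degen(4) assms(2)] simplicial_codegen_mem[of ?u "2 * n + 2" i] degen(3)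
    by (auto simp: numeral_3_eq_3)
  have K: "K (set ?L)"
    using K_join[OF degen(2)] by simp
  then have KD: "K (set ?D)"
    using hereditaryD[OF hereditary] set_double_at by metis
  have "realization_point (vset_sset K) ((2 * n + 1, ?L), join_weights n s (simplicial_codegen i t))
    = realization_point (vset_sset K) ((2 * n + 2, ?D), simplicial_codegen i ?u)"
    using realization_point_degen[of ?L "2 * n + 1" K "n + 1 + i" "simplicial_codegen i ?u"] degen K u(2)
    by (simp add: join_weights_degen)
  also have "\<dots> = realization_point (vset_sset K) ((2 * n + 3, double_at i ?D), ?u)"
    using realization_point_degen[of ?D "2 * n + 2" K i ?u] degen KD u(1)
    by (simp add: length_double_at numeral_3_eq_3)
  also have "double_at i ?D = map \<phi> (double_at i xs) @ map \<psi> (double_at i xs)"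
    using degen(1,3) by (simp add: double_at_append map_double_at)
  finally show ?thesis
    using degen by (simp add: numeral_3_eq_3)
qed

lemma rjoin_point [simp]:
  "s \<in> {0..1} \<Longrightarrow> rjoin K \<phi> \<psi> s (realization_point (vset_sset L) ((n, xs), t))
    = realization_point (vset_sset K) ((2 * n + 1, map \<phi> xs @ map \<psi> xs), join_weights n s t)"
  unfolding rjoin_def using rlift_point[of "vset_sset L", OF rjoin_glue] by simp

lemma rjoin_0:
  assumes "c \<in> topspace (realization (vset_sset L))"
  shows "rjoin K \<phi> \<psi> 0 c = rmap K \<phi> c"
proof -
  interpret vertex_map L K \<phi>
    using K_join hereditaryD[OF hereditary] by unfold_locales blast
  obtain n xs t where c: "length xs = Suc n" "L (set xs)" "t \<in> standard_simplex n"
    "c = realization_point (vset_sset L) ((n, xs), t)"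
    using assms by (auto elim!: realization_pointE)
  have "join_weights n 0 t = t"
    using standard_simplexD(3)[OF c(3)] by (auto simp: join_weights_def fun_eq_iff)
  then show ?thesis
    using realization_point_append_right[of "map \<phi> xs" n K "map \<psi> xs" t] K_join[OF c(2)] c hereditary
    by (simp add: mult_2)
qed

lemma rjoin_1:
  assumes "c \<in> topspace (realization (vset_sset L))"
  shows "rjoin K \<phi> \<psi> 1 c = rmap K \<psi> c"
proof -
  interpret vertex_map L K \<psi>
    using K_join hereditaryD[OF hereditary] by unfold_locales blast
  obtain n xs t where c: "length xs = Suc n" "L (set xs)" "t \<in> standard_simplex n"
    "c = realization_point (vset_sset L) ((n, xs), t)"
    using assms by (auto elim!: realization_pointE)
  have "join_weights n 1 t = (\<lambda>i. if i < Suc n then 0 else t (i - Suc n))"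
    using standard_simplexD(3)[OF c(3)] by (auto simp: join_weights_def fun_eq_iff)
  then show ?thesis
    using realization_point_append_left[of "map \<psi> xs" n K "map \<phi> xs" t, unfolded length_map c(1)] K_join[OF c(2)] c hereditary
    by (simp add: mult_2)
qed

lemma supp_rjoin:
  assumes "c \<in> topspace (realization (vset_sset L))" "s \<in> {0..1}"
  shows "supp (rjoin K \<phi> \<psi> s c) \<subseteq> \<phi> ` supp c \<union> \<psi> ` supp c"
proof -
  obtain n xs t where c: "length xs = Suc n" "L (set xs)" "t \<in> standard_simplex n"
    "c = realization_point (vset_sset L) ((n, xs), t)"
    using assms by (auto elim!: realization_pointE)
  have "(map \<phi> xs @ map \<psi> xs) ! i \<in> \<phi> ` {xs ! i | i. i \<le> n \<and> t i > 0} \<union> \<psi> ` {xs ! i | i. i \<le> n \<and> t i > 0}"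
    if "i \<le> 2 * n + 1" "join_weights n s t i > 0" for i
  proof (cases "i \<le> n")
    case True
    then have "t i > 0"
      using that(2) assms(2) by (auto simp: join_weights_def zero_less_mult_iff)
    then show ?thesis
      using True c(1) by (auto simp: nth_append)
  next
    case False
    then have "t (i - Suc n) > 0"
      using that assms(2) by (auto simp: join_weights_def zero_less_mult_iff)
    then show ?thesis
      using False that c(1) by (auto simp: nth_append intro!: image_eqI[where x = "xs ! (i - Suc n)"] exI[of _ "i - Suc n"])
  qed
  then show ?thesis
    using assms(2) by (auto simp: c(4))
qed

lemma continuous_map_join_weights:
  "continuous_map (prod_topology (top_of_set {0..1}) (simplex_space n)) (simplex_space (2 * n + 1))
     (\<lambda>(s, t). join_weights n s t)"
proof -
  have "continuous_map (prod_topology (top_of_set {0..1}) (simplex_space n)) euclideanreal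
     (\<lambda>x. join_weights n (fst x) (snd x) i)" for i
  proof -
    have 1: "continuous_map (prod_topology (top_of_set {0..1::real}) (simplex_space n)) euclideanreal fst"
      using continuous_map_fst continuous_map_into_fulltopology by blast
    have 2: "continuous_map (prod_topology (top_of_set {0..1::real}) (simplex_space n)) euclideanreal (\<lambda>x. snd x j)" for j
      using continuous_map_compose[OF continuous_map_snd continuous_map_simplex_coord] by (simp add: o_def)
    consider "i \<le> n" | "i > n" "i \<le> 2 * n + 1" | "i > 2 * n + 1" by linarith
    then show ?thesis
    proof cases
      case 3
      then show ?thesis by (simp add: join_weights_def)
    qed (use 1 2 in \<open>auto simp: join_weights_def intro!: continuous_intros continuous_map_real_mult continuous_map_diff\<close>)
  qed
  then show ?thesis
    using join_weights_mem[of _ n]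
    by (auto simp: continuous_map_in_subtopology continuous_map_componentwise_UNIV case_prod_unfold
        topspace_standard_simplex)
qed

lemma continuous_map_rjoin:
  "continuous_map (prod_topology (top_of_set {0..1}) (realization (vset_sset L))) (realization (vset_sset K))
     (\<lambda>(s, c). rjoin K \<phi> \<psi> s c)"
proof -
  \<comment> \<open>The parameter is clamped to the unit interval: gluing has to be respected for
    every real \<open>s\<close>, whereas the join weights lie in the simplex only for
    \<open>s\<close> between 0 and 1.\<close>
  define h where "h s = (\<lambda>((n, xs), t). realization_point (vset_sset K)
      ((2 * n + 1, map \<phi> xs @ map \<psi> xs), join_weights n (max 0 (min 1 s)) t))" for s
  have "continuous_map (prod_topology (top_of_set {0..1}) (realization (vset_sset L))) (realization (vset_sset K))
     (\<lambda>(s, c). rlift (h s) c)"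
  proof (rule continuous_map_rlift_prod)
    show "h s z = h s w" if "glue (vset_sset L) z w" for s z w
      unfolding h_def by (rule rjoin_glue[OF that]) auto
    show "continuous_map (prod_topology (top_of_set {0..1}) (simplex_space n)) (realization (vset_sset K))
        (\<lambda>(s, t). h s ((n, xs), t))" if "xs \<in> smp (vset_sset L) n" for n xs
    proof -
      have "continuous_map (simplex_space (2 * n + 1)) (realization (vset_sset K))
         (\<lambda>t. realization_point (vset_sset K) ((2 * n + 1, map \<phi> xs @ map \<psi> xs), t))"
        using that K_join[of "set xs"] by (intro continuous_map_realization_simplex) auto
      from continuous_map_compose[OF continuous_map_join_weights this]
      show ?thesis
        by (rule continuous_map_eq) (auto simp: h_def min_absorb2 max_absorb2)
    qed
  qed (auto intro!: compact_imp_locally_compact_space Hausdorff_space_subtopology compact_space_subtopology)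
  then show ?thesis
    by (rule continuous_map_eq) (auto simp: h_def rjoin_def)
qed

end

section \<open>Subcomplexes as closed subspaces of a realization\<close>

lemma simplicial_set_vset:
  assumes "hereditary K"
  shows "simplicial_set (vset_sset K)"
proof (rule simplicial_set_E_like[where S = UNIV])
  show "delete_at i xs \<in> smp (vset_sset K) n" if "xs \<in> smp (vset_sset K) (Suc n)" "i \<le> Suc n" for n i xs
    using that hereditaryD[OF assms _ set_delete_at] by (auto simp: length_delete_at)
  show "double_at i xs \<in> smp (vset_sset K) (Suc n)" if "xs \<in> smp (vset_sset K) n" "i \<le> n" for n i xs
    using that hereditaryD[OF assms _ set_double_at] by (auto simp: length_double_at)
qed (auto simp: vset_sset_def E_sset_def)

lemma simplicial_subset_vset:
  assumes "hereditary K" "\<And>F. K F \<Longrightarrow> L F"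
  shows "simplicial_subset (vset_sset K) (vset_sset L)"
  unfolding simplicial_subset_def
proof (intro conjI allI subsetI)
  show "\<sigma> \<in> smp (vset_sset L) n" if "\<sigma> \<in> smp (vset_sset K) n" for \<sigma> n
    using that assms(2) by simp
qed (simp_all add: simplicial_set_vset[OF assms(1)], simp_all add: vset_sset_def)

locale subcomplex =
  fixes K L :: "'a set \<Rightarrow> bool"
  assumes hereditary_K: "hereditary K" and hereditary_L: "hereditary L" and K_imp_L: "K F \<Longrightarrow> L F"
begin

text \<open>A point of the larger realization whose support satisfies \<open>K\<close> is represented by a simplex of the
  smaller complex once its vertices of weight zero are exchanged; this inverts the inclusion.\<close>

definition reps :: "nat \<Rightarrow> 'a list \<Rightarrow> (nat \<Rightarrow> real) \<Rightarrow> 'a list set" where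
  "reps n xs t = {ys. length ys = Suc n \<and> K (set ys) \<and> (\<forall>i\<le>n. t i > 0 \<longrightarrow> xs ! i = ys ! i)}"

lemma reps_exists:
  assumes "length xs = Suc n" "t \<in> standard_simplex n" "K {xs ! i | i. i \<le> n \<and> t i > 0}"
  obtains ys where "ys \<in> reps n xs t" "set ys \<subseteq> set xs"
proof -
  obtain i0 where i0: "i0 \<le> n" "t i0 > 0"
    using standard_simplex_pos[OF assms(2)] .
  \<comment> \<open>Every weight-zero vertex is replaced by the vertex at \<open>i0\<close>, which
    belongs to the support, so that no vertex outside the support is left.\<close>
  let ?ys = "map (\<lambda>i. if t i > 0 then xs ! i else xs ! i0) [0..<Suc n]"
  have sub: "set ?ys \<subseteq> {xs ! i | i. i \<le> n \<and> t i > 0}"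
    using i0 by (auto simp: less_Suc_eq_le)
  then have "K (set ?ys)"
    using hereditaryD[OF hereditary_K assms(3)] by blast
  moreover have "?ys ! i = (if t i > 0 then xs ! i else xs ! i0)" if "i \<le> n" for i
    using that by (simp add: nth_append less_Suc_eq_le del: upt_Suc)
  ultimately have "?ys \<in> reps n xs t"
    by (simp add: reps_def del: upt_Suc)
  moreover have "set ?ys \<subseteq> set xs"
    using sub assms(1) by (auto simp: less_Suc_eq_le)
  ultimately show thesis
    using that by blast
qed

lemma reps_iff:
  assumes "length xs = Suc n" "t \<in> standard_simplex n"
  shows "reps n xs t \<noteq> {} \<longleftrightarrow> K {xs ! i | i. i \<le> n \<and> t i > 0}"
proof
  assume "reps n xs t \<noteq> {}"
  then obtain ys where ys: "length ys = Suc n" "K (set ys)" "\<And>i. i \<le> n \<Longrightarrow> t i > 0 \<Longrightarrow> xs ! i = ys ! i"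
    by (auto simp: reps_def)
  then have "{xs ! i | i. i \<le> n \<and> t i > 0} \<subseteq> set ys"
    by (auto simp: less_Suc_eq_le)
  then show "K {xs ! i | i. i \<le> n \<and> t i > 0}"
    using hereditaryD[OF hereditary_K ys(2)] by blast
qed (use reps_exists[OF assms] in blast)

text \<open>All members of \<open>reps\<close> yield the same class (\<open>retr_eq\<close>), so the
  union is that class, or empty when the support violates \<open>K\<close>. This makes the map total
  without a case distinction.\<close>

definition retr :: "'a list spt \<Rightarrow> 'a list spt set" where
  "retr = (\<lambda>((n, xs), t). \<Union>ys\<in>reps n xs t. realization_point (vset_sset K) ((n, ys), t))"

lemma retr_eq:
  assumes "length xs = Suc n" "t \<in> standard_simplex n" "ys \<in> reps n xs t"
  shows "retr ((n, xs), t) = realization_point (vset_sset K) ((n, ys), t)"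
proof -
  have "realization_point (vset_sset K) ((n, zs), t) = realization_point (vset_sset K) ((n, ys), t)"
    if "zs \<in> reps n xs t" for zs
    using that assms by (intro realization_point_cong hereditary_K) (auto simp: reps_def)
  then have "(\<Union>zs\<in>reps n xs t. realization_point (vset_sset K) ((n, zs), t))
      = (\<Union>zs\<in>reps n xs t. realization_point (vset_sset K) ((n, ys), t))"
    by simp
  then show ?thesis
    using assms(3) by (auto simp: retr_def)
qed

text \<open>Both sides have the same support, so either both values are empty, or there is a
  representative on the right-hand side; applying to it the face or degeneracy in question gives a
  representative on the left-hand side.\<close>

lemma retr_glue:
  assumes "glue (vset_sset L) z w"
  shows "retr z = retr w"
proof (cases "K (pre_supp w)")
  case False
  then have "\<not> K (pre_supp z)"
    using pre_supp_glue[OF assms] by metis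
  have empty: "retr ((n, xs), t) = {}" if "\<not> K (pre_supp ((n, xs), t))" "length xs = Suc n" "t \<in> standard_simplex n" for n xs t
    using that(1) reps_iff[OF that(2,3)] by (auto simp: retr_def)
  show ?thesis
    using assms
  proof (cases rule: glue_vset_cases)
    case (face xs n i t)
    then show ?thesis
      using False \<open>\<not> K (pre_supp z)\<close> empty by (simp add: length_delete_at simplical_face_mem del: pre_supp.simps)
  next
    case (degen xs n i t)
    then show ?thesis
      using False \<open>\<not> K (pre_supp z)\<close> empty by (simp add: length_double_at simplicial_codegen_mem del: pre_supp.simps)
  qed
next
  case True
  show ?thesis
    using assms
  proof (cases rule: glue_vset_cases)
    case (face xs n i t)
    have u: "simplical_face i t \<in> standard_simplex (Suc n)"
      using face by (simp add: simplical_face_mem)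
    obtain ys where ys: "ys \<in> reps (Suc n) xs (simplical_face i t)"
      using reps_exists[OF face(1) u] True face(6) by auto
    have "xs ! (if j < i then j else Suc j) = ys ! (if j < i then j else Suc j)" if "j \<le> n" "t j > 0" for j
    proof -
      have "(if j < i then j else Suc j) \<le> Suc n" "simplical_face i t (if j < i then j else Suc j) > 0"
        using that by (auto simp: simplical_face_def)
      then show ?thesis
        using ys by (simp add: reps_def del: if_image_distrib)
    qed
    then have "delete_at i ys \<in> reps n (delete_at i xs) t"
      using ys face(1,3) hereditaryD[OF hereditary_K _ set_delete_at]
      by (auto simp: reps_def length_delete_at nth_delete_at)
    then have "retr z = realization_point (vset_sset K) ((n, delete_at i ys), t)"
      using face by (simp add: retr_eq length_delete_at)
    also have "\<dots> = realization_point (vset_sset K) ((Suc n, ys), simplical_face i t)"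
      using ys face by (simp add: realization_point_face reps_def)
    also have "\<dots> = retr w"
      using face u ys by (simp add: retr_eq)
    finally show ?thesis .
  next
    case (degen xs n i t)
    have u: "simplicial_codegen i t \<in> standard_simplex n"
      using degen by (simp add: simplicial_codegen_mem)
    obtain ys where ys: "ys \<in> reps n xs (simplicial_codegen i t)"
      using reps_exists[OF degen(1) u] True degen(6) by auto
    have "xs ! (if j \<le> i then j else j - 1) = ys ! (if j \<le> i then j else j - 1)" if "j \<le> Suc n" "t j > 0" for j
    proof -
      have "(if j \<le> i then j else j - 1) \<le> n" "simplicial_codegen i t (if j \<le> i then j else j - 1) > 0"
        using that degen(3) standard_simplexD(1)[OF degen(4), of i] standard_simplexD(1)[OF degen(4), of "Suc i"]
        by (auto simp: simplicial_codegen_def add_pos_nonneg add_nonneg_pos not_le)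
      then show ?thesis
        using ys by (simp add: reps_def del: if_image_distrib)
    qed
    then have "double_at i ys \<in> reps (Suc n) (double_at i xs) t"
      using ys degen(1,3) hereditaryD[OF hereditary_K _ set_double_at]
      by (auto simp: reps_def length_double_at nth_double_at)
    then have "retr z = realization_point (vset_sset K) ((Suc n, double_at i ys), t)"
      using degen by (simp add: retr_eq length_double_at)
    also have "\<dots> = realization_point (vset_sset K) ((n, ys), simplicial_codegen i t)"
      using ys degen by (simp add: realization_point_degen reps_def)
    also have "\<dots> = retr w"
      using degen u ys by (simp add: retr_eq)
    finally show ?thesis .
  qed
qed

lemma incl_point:
  "realization_incl (vset_sset L) (realization_point (vset_sset K) z) = realization_point (vset_sset L) z"
  by (rule realization_incl_point) (rule simplicial_subset_vset[OF hereditary_K K_imp_L])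

lemma rlift_retr_point: "rlift retr (realization_point (vset_sset L) z) = retr z"
  by (rule rlift_point) (rule retr_glue)

lemma rlift_retr_incl:
  assumes "c \<in> topspace (realization (vset_sset K))"
  shows "rlift retr (realization_incl (vset_sset L) c) = c"
proof -
  obtain n xs t where c: "length xs = Suc n" "K (set xs)" "t \<in> standard_simplex n"
    "c = realization_point (vset_sset K) ((n, xs), t)"
    using assms by (auto elim!: realization_pointE)
  then have "xs \<in> reps n xs t"
    by (simp add: reps_def)
  then show ?thesis
    using c by (simp add: incl_point rlift_retr_point retr_eq)
qed

lemma incl_rlift_retr:
  assumes "c \<in> topspace (realization (vset_sset L))" "K (supp c)"
  shows "rlift retr c \<in> topspace (realization (vset_sset K))"
    "realization_incl (vset_sset L) (rlift retr c) = c"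
proof -
  obtain n xs t where c: "length xs = Suc n" "L (set xs)" "t \<in> standard_simplex n"
    "c = realization_point (vset_sset L) ((n, xs), t)"
    using assms by (auto elim!: realization_pointE)
  obtain ys where ys: "ys \<in> reps n xs t"
    using reps_exists[OF c(1,3)] assms(2) by (auto simp: c(4))
  then have "realization_point (vset_sset L) ((n, ys), t) = c"
    unfolding c(4) using c K_imp_L by (intro realization_point_cong hereditary_L) (auto simp: reps_def)
  then show "rlift retr c \<in> topspace (realization (vset_sset K))"
    "realization_incl (vset_sset L) (rlift retr c) = c"
    using ys c(1,3) unfolding c(4) rlift_retr_point retr_eq[OF c(1,3) ys] incl_point
    by (auto simp: reps_def)
qed

lemma incl_image:
  "realization_incl (vset_sset L) ` topspace (realization (vset_sset K))
    = {c \<in> topspace (realization (vset_sset L)). K (supp c)}"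
proof (intro subset_antisym subsetI)
  fix c assume "c \<in> realization_incl (vset_sset L) ` topspace (realization (vset_sset K))"
  then obtain n xs t where c: "length xs = Suc n" "K (set xs)" "t \<in> standard_simplex n"
    "c = realization_point (vset_sset L) ((n, xs), t)"
    by (auto elim!: realization_pointE simp: incl_point)
  moreover have "{xs ! i | i. i \<le> n \<and> t i > 0} \<subseteq> set xs"
    using c(1) by (auto simp: less_Suc_eq_le)
  ultimately show "c \<in> {c \<in> topspace (realization (vset_sset L)). K (supp c)}"
    using K_imp_L hereditaryD[OF hereditary_K] by auto
next
  fix c assume "c \<in> {c \<in> topspace (realization (vset_sset L)). K (supp c)}"
  then show "c \<in> realization_incl (vset_sset L) ` topspace (realization (vset_sset K))"
    using incl_rlift_retr by (metis (mono_tags, lifting) imageI mem_Collect_eq)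
qed

lemma continuous_map_incl:
  "continuous_map (realization (vset_sset K)) (realization (vset_sset L)) (realization_incl (vset_sset L))"
proof -
  have "continuous_map (realization (vset_sset K)) (realization (vset_sset L))
      (rlift (realization_point (vset_sset L)))"
  proof (rule continuous_map_rlift)
    show "realization_point (vset_sset L) z = realization_point (vset_sset L) w" if "glue (vset_sset K) z w" for z w
      using realization_point_glue[OF that] by (metis incl_point)
  qed (use K_imp_L in \<open>auto intro!: continuous_map_realization_simplex\<close>)
  moreover have "rlift (realization_point (vset_sset L)) c = realization_incl (vset_sset L) c"
    if c: "c \<in> topspace (realization (vset_sset K))" for c
  proof -
    obtain z where z: "c = realization_point (vset_sset K) z"
      using realization_pointE[OF c] by blast
    have "rlift (realization_point (vset_sset L)) (realization_point (vset_sset K) z) = realization_point (vset_sset L) z"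
      by (rule rlift_point) (metis realization_point_glue incl_point)
    then show ?thesis
      by (simp add: z incl_point)
  qed
  ultimately show ?thesis
    by (rule continuous_map_eq)
qed

text \<open>On a simplex \<open>xs\<close> of the large complex, the image of \<open>C\<close> is
  cut out by a union over the lists \<open>ys\<close> that span simplices of \<open>K\<close> and
  use only vertices of \<open>xs\<close>: the coordinates where \<open>xs\<close> and
  \<open>ys\<close> differ vanish, and the point of \<open>ys\<close> lies in \<open>C\<close>.
  There are finitely many such lists, and each condition is closed.\<close>

lemma closed_map_incl:
  "closed_map (realization (vset_sset K)) (realization (vset_sset L)) (realization_incl (vset_sset L))"
  unfolding closed_map_def
proof (intro allI impI)
  fix C assume C: "closedin (realization (vset_sset K)) C"
  then have Csub: "C \<subseteq> topspace (realization (vset_sset K))"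
    by (rule closedin_subset)
  have incl: "c \<in> realization_incl (vset_sset L) ` C \<longleftrightarrow> rlift retr c \<in> C"
    if "c \<in> topspace (realization (vset_sset L))" "K (supp c)" for c
  proof
    assume "c \<in> realization_incl (vset_sset L) ` C"
    then show "rlift retr c \<in> C"
      using Csub rlift_retr_incl by auto
  next
    assume "rlift retr c \<in> C"
    then show "c \<in> realization_incl (vset_sset L) ` C"
      using incl_rlift_retr(2)[OF that] by (metis imageI)
  qed
  have sub: "realization_incl (vset_sset L) ` C \<subseteq> {c \<in> topspace (realization (vset_sset L)). K (supp c)}"
    using Csub incl_image by blast
  have "closedin (simplex_space n) {t \<in> standard_simplex n.
      realization_point (vset_sset L) ((n, xs), t) \<in> realization_incl (vset_sset L) ` C}"
    if xs: "length xs = Suc n" "L (set xs)" for n xs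
  proof -
    let ?V = "{ys. length ys = Suc n \<and> set ys \<subseteq> set xs \<and> K (set ys)}"
    let ?T = "\<lambda>ys. {t \<in> standard_simplex n. \<forall>i\<in>{i. i \<le> n \<and> xs ! i \<noteq> ys ! i}. t i = 0}
      \<inter> {t \<in> standard_simplex n. realization_point (vset_sset K) ((n, ys), t) \<in> C}"
    have "finite {ys. set ys \<subseteq> set xs \<and> length ys = Suc n}"
      by (rule finite_lists_length_eq) simp
    then have "finite ?V"
      by (rule rev_finite_subset) auto
    moreover have "closedin (simplex_space n) (?T ys)" if "ys \<in> ?V" for ys
    proof (rule closedin_Int)
      have "closedin (simplex_space n) {t \<in> topspace (simplex_space n). t i \<in> {0}}" for i
        by (rule closedin_continuous_map_preimage[OF continuous_map_simplex_coord]) auto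
      then have 1: "closedin (simplex_space n) {t \<in> standard_simplex n. t i = 0}" for i
        by (simp add: topspace_standard_simplex)
      have eq: "{t \<in> standard_simplex n. \<forall>i\<in>I. t i = 0} = topspace (simplex_space n) \<inter> (\<Inter>i\<in>I. {t \<in> standard_simplex n. t i = 0})" for I
        by (auto simp: topspace_standard_simplex)
      show "closedin (simplex_space n) {t \<in> standard_simplex n. \<forall>i\<in>{i. i \<le> n \<and> xs ! i \<noteq> ys ! i}. t i = 0}"
        unfolding eq
      \<comment> \<open>An intersection over no indices would be \<open>UNIV\<close>, hence the
        separate case of no constraint.\<close>
      proof (cases "{i. i \<le> n \<and> xs ! i \<noteq> ys ! i} = {}")
        case False
        then show "closedin (simplex_space n) (topspace (simplex_space n) \<inter>
            (\<Inter>i\<in>{i. i \<le> n \<and> xs ! i \<noteq> ys ! i}. {t \<in> standard_simplex n. t i = 0}))"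
          using 1 by (intro closedin_Int closedin_topspace closedin_Inter) auto
      qed (simp only: image_empty Inter_empty Int_UNIV_right closedin_topspace)
      show "closedin (simplex_space n) {t \<in> standard_simplex n. realization_point (vset_sset K) ((n, ys), t) \<in> C}"
        using C Csub that by (simp add: closedin_realization)
    qed
    ultimately have "closedin (simplex_space n) (\<Union>ys\<in>?V. ?T ys)"
      by (intro closedin_Union) auto
    moreover have "{t \<in> standard_simplex n. realization_point (vset_sset L) ((n, xs), t) \<in> realization_incl (vset_sset L) ` C}
      = (\<Union>ys\<in>?V. ?T ys)"
    proof (intro subset_antisym subsetI)
      fix t assume t: "t \<in> {t \<in> standard_simplex n. realization_point (vset_sset L) ((n, xs), t) \<in> realization_incl (vset_sset L) ` C}"
      then have "K (supp (realization_point (vset_sset L) ((n, xs), t)))"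
        using t sub by blast
      then have Ks: "K {xs ! i | i. i \<le> n \<and> t i > 0}"
        by (simp only: supp_point)
      have tn: "t \<in> standard_simplex n"
        using t by simp
      then obtain ys where ys: "ys \<in> reps n xs t" "set ys \<subseteq> set xs"
        using reps_exists[OF xs(1) _ Ks] by blast
      have "rlift retr (realization_point (vset_sset L) ((n, xs), t)) \<in> C"
        using t sub incl by blast
      then have "retr ((n, xs), t) \<in> C"
        by (simp only: rlift_retr_point)
      moreover have "t i = 0" if "i \<le> n" "xs ! i \<noteq> ys ! i" for i
      proof (rule ccontr)
        assume "t i \<noteq> 0"
        then have "t i > 0"
          using standard_simplexD(1)[OF tn, of i] by simp
        then show False
          using that ys(1) by (simp add: reps_def)
      qed
      ultimately have "t \<in> ?T ys"
        using retr_eq[OF xs(1) tn ys(1)] tn by simp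
      then show "t \<in> (\<Union>ys\<in>?V. ?T ys)"
        using ys by (auto simp: reps_def)
    next
      fix t assume "t \<in> (\<Union>ys\<in>?V. ?T ys)"
      then obtain ys where ys: "ys \<in> ?V" "t \<in> ?T ys" by blast
      have "ys ! i = xs ! i" if "i \<le> n" "t i > 0" for i
        using that ys(2) by (cases "xs ! i = ys ! i") auto
      then have "realization_point (vset_sset L) ((n, ys), t) = realization_point (vset_sset L) ((n, xs), t)"
        using xs ys K_imp_L by (intro realization_point_cong hereditary_L) auto
      moreover have "realization_point (vset_sset L) ((n, ys), t) = realization_incl (vset_sset L) (realization_point (vset_sset K) ((n, ys), t))"
        by (simp add: incl_point)
      ultimately show "t \<in> {t \<in> standard_simplex n. realization_point (vset_sset L) ((n, xs), t) \<in> realization_incl (vset_sset L) ` C}"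
        using ys by auto
    qed
    ultimately show ?thesis by simp
  qed
  then show "closedin (realization (vset_sset L)) (realization_incl (vset_sset L) ` C)"
    using sub by (subst closedin_realization) auto
qed

lemma embedding_map_incl:
  "embedding_map (realization (vset_sset K)) (realization (vset_sset L)) (realization_incl (vset_sset L))"
  by (rule injective_closed_imp_embedding_map[OF continuous_map_incl closed_map_incl])
    (metis inj_onI rlift_retr_incl)

text \<open>This justifies replacing the stages of a filtration by subspaces of one ambient
  realization: inclusions become identities on points, and a stage is a condition on
  supports.\<close>

lemma homeomorphic_maps_incl:
  obtains r where "homeomorphic_maps (realization (vset_sset K))
    (subtopology (realization (vset_sset L)) {c. K (supp c)}) (realization_incl (vset_sset L)) r"
proof -
  have "subtopology (realization (vset_sset L)) (realization_incl (vset_sset L) ` topspace (realization (vset_sset K)))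
    = subtopology (realization (vset_sset L)) {c. K (supp c)}"
    using subtopology_restrict[of "realization (vset_sset L)" "{c. K (supp c)}"]
    unfolding incl_image Collect_conj_eq by (simp only: Collect_mem_eq)
  then show thesis
    using that embedding_map_incl unfolding embedding_map_def homeomorphic_map_maps by auto
qed

end

section \<open>Homotopies of cubes\<close>

abbreviation homotopic_rel :: "nat \<Rightarrow> 'a \<Rightarrow> 'a topology \<Rightarrow> ((nat \<Rightarrow> real) \<Rightarrow> 'a) \<Rightarrow> ((nat \<Rightarrow> real) \<Rightarrow> 'a) \<Rightarrow> bool" where
  "homotopic_rel k x \<equiv> homotopic_with (\<lambda>h. h ` cube_boundary k \<subseteq> {x}) (cube k)"

lemma continuous_map_in: "continuous_map X Y f \<Longrightarrow> x \<in> topspace X \<Longrightarrow> f x \<in> topspace Y"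
  by (auto simp: continuous_map_def)

lemma cube_boundary_subset: "cube_boundary k \<subseteq> topspace (cube k)"
  by (auto simp: cube_boundary_def)

lemma homotopic_rel_eq:
  assumes "homotopic_rel k x X f g" "\<And>t. t \<in> topspace (cube k) \<Longrightarrow> f' t = f t" "\<And>t. t \<in> topspace (cube k) \<Longrightarrow> g' t = g t"
  shows "homotopic_rel k x X f' g'"
proof (rule homotopic_with_eq[OF assms])
  fix h h' :: "(nat \<Rightarrow> real) \<Rightarrow> 'a" assume "\<And>t. t \<in> topspace (cube k) \<Longrightarrow> h t = h' t"
  then have "h ` cube_boundary k = h' ` cube_boundary k"
    using cube_boundary_subset by (intro image_cong) auto
  then show "h ` cube_boundary k \<subseteq> {x} \<longleftrightarrow> h' ` cube_boundary k \<subseteq> {x}" by simp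
qed

lemma homotopic_rel_compose_left:
  assumes "homotopic_rel k x X f g" "continuous_map X Y \<phi>" "\<phi> x = y"
  shows "homotopic_rel k y Y (\<phi> \<circ> f) (\<phi> \<circ> g)"
  using assms(1,2) by (rule homotopic_with_compose_continuous_map_left) (use assms(3) in auto)

lemma loops_compose:
  assumes "f \<in> loops k X x" "continuous_map X Y \<phi>" "\<phi> x = y"
  shows "\<phi> \<circ> f \<in> loops k Y y"
  using assms by (auto simp: loops_def intro: continuous_map_compose)

lemma loops_in:
  assumes "f \<in> loops k X x" "t \<in> topspace (cube k)"
  shows "f t \<in> topspace X"
  using assms continuous_map_in[of "cube k" X f t] by (simp add: loops_def)

text \<open>The passage from classes to representatives: the class of \<open>f\<close> contains
  \<open>f\<close>, and homotopic loops have equal classes, so the union that defines the induced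
  map runs over copies of a single class.\<close>

lemma homotopy_group_map_trivial_iff:
  assumes "continuous_map X Y \<phi>" "\<phi> x = y"
  shows "(\<forall>c\<in>homotopy_group k X x. homotopy_group_map k Y y \<phi> c = homotopy_group_one k Y y)
    \<longleftrightarrow> (\<forall>f\<in>loops k X x. homotopic_rel k y Y (\<phi> \<circ> f) (\<lambda>_. y))" (is "?L = ?R")
proof
  assume L: ?L
  show ?R
  proof
    fix f assume f: "f \<in> loops k X x"
    have \<phi>f: "\<phi> \<circ> f \<in> loops k Y y"
      using loops_compose[OF f assms] .
    have "f \<in> homotopy_class k X x f"
      using f by (simp add: homotopy_class_def loops_def)
    moreover have "\<phi> \<circ> f \<in> homotopy_class k Y y (\<phi> \<circ> f)"
      using \<phi>f by (simp add: homotopy_class_def loops_def)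
    ultimately have "\<phi> \<circ> f \<in> homotopy_group_map k Y y \<phi> (homotopy_class k X x f)"
      unfolding homotopy_group_map_def by blast
    also have "\<dots> = homotopy_group_one k Y y"
      using L f by (auto simp: homotopy_group_def)
    finally show "homotopic_rel k y Y (\<phi> \<circ> f) (\<lambda>_. y)"
      unfolding homotopy_group_one_def homotopy_class_def mem_Collect_eq by (blast intro: homotopic_with_symD)
  qed
next
  assume R: ?R
  show ?L
  proof
    fix c assume "c \<in> homotopy_group k X x"
    then obtain f where f: "f \<in> loops k X x" "c = homotopy_class k X x f"
      by (auto simp: homotopy_group_def)
    have "homotopy_class k Y y (\<phi> \<circ> g) = homotopy_group_one k Y y" if "g \<in> c" for g
    proof -
      have "homotopic_rel k y Y (\<phi> \<circ> g) (\<lambda>_. y)"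
        using R that f by (auto simp: homotopy_class_def)
      then show ?thesis
        by (auto simp: homotopy_class_def homotopy_group_one_def
            intro: homotopic_with_trans homotopic_with_symD)
    qed
    moreover have "f \<in> c"
      using f by (simp add: homotopy_class_def loops_def)
    ultimately show "homotopy_group_map k Y y \<phi> c = homotopy_group_one k Y y"
      unfolding homotopy_group_map_def by auto
  qed
qed

section \<open>Essential connectedness inside the ambient realization\<close>

abbreviation vertex :: "('a set \<Rightarrow> bool) \<Rightarrow> 'a \<Rightarrow> 'a list spt set" where
  "vertex L v \<equiv> vertex_point (vset_sset L) [v]"

abbreviation supp_space :: "('a set \<Rightarrow> bool) \<Rightarrow> ('a set \<Rightarrow> bool) \<Rightarrow> 'a list spt set topology" where
  "supp_space L K \<equiv> subtopology (realization (vset_sset L)) {c. K (supp c)}"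

lemma vertex_in: "L {v} \<Longrightarrow> vertex L v \<in> topspace (realization (vset_sset L))"
  unfolding vertex_point_def by (rule realization_point_in) (auto simp: standard_simplex_0)

lemma supp_vertex [simp]: "supp (vertex L v) = {v}"
  unfolding vertex_point_def by auto

lemma rmap_vertex:
  assumes "vertex_map L K \<phi>"
  shows "rmap K \<phi> (vertex L v) = vertex K (\<phi> v)"
  unfolding vertex_point_def using vertex_map.rmap_point[OF assms] by simp

text \<open>Conjugation by the homeomorphisms of both stages with their images in the realization of
  \<open>L\<close>. Going from \<open>K\<close> to \<open>L\<close> directly or through
  \<open>K'\<close> is the same map (\<open>ij\<close>), so the induced map turns into an inclusion
  of subspaces.\<close>

lemma trivial_vset_iff:
  assumes "hereditary L" "hereditary K" "hereditary K'" "\<And>F. K F \<Longrightarrow> K' F" "\<And>F. K' F \<Longrightarrow> L F" "K {v}"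
  shows "(\<forall>c\<in>homotopy_group k (realization (vset_sset K)) (vertex K v).
      homotopy_group_map k (realization (vset_sset K')) (vertex K' v) (realization_incl (vset_sset K')) c
        = homotopy_group_one k (realization (vset_sset K')) (vertex K' v))
    \<longleftrightarrow> (\<forall>f\<in>loops k (supp_space L K) (vertex L v). homotopic_rel k (vertex L v) (supp_space L K') f (\<lambda>_. vertex L v))"
proof -
  interpret KK': subcomplex K K' using assms by unfold_locales auto
  interpret KL: subcomplex K L using assms by unfold_locales auto
  interpret K'L: subcomplex K' L using assms by unfold_locales auto
  let ?j = "realization_incl (vset_sset L)" and ?i = "realization_incl (vset_sset K')"
  obtain r where "homeomorphic_maps (realization (vset_sset K)) (supp_space L K) ?j r"
    by (rule KL.homeomorphic_maps_incl)
  then have r: "continuous_map (realization (vset_sset K)) (supp_space L K) ?j"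
      "continuous_map (supp_space L K) (realization (vset_sset K)) r"
      "\<And>c. c \<in> topspace (realization (vset_sset K)) \<Longrightarrow> r (?j c) = c"
      "\<And>c. c \<in> topspace (supp_space L K) \<Longrightarrow> ?j (r c) = c"
    by (auto simp: homeomorphic_maps_def)
  obtain r' where "homeomorphic_maps (realization (vset_sset K')) (supp_space L K') ?j r'"
    by (rule K'L.homeomorphic_maps_incl)
  then have r': "continuous_map (realization (vset_sset K')) (supp_space L K') ?j"
      "continuous_map (supp_space L K') (realization (vset_sset K')) r'"
      "\<And>c. c \<in> topspace (realization (vset_sset K')) \<Longrightarrow> r' (?j c) = c"
    by (auto simp: homeomorphic_maps_def)
  have v: "?j (vertex K v) = vertex L v" "?j (vertex K' v) = vertex L v" "?i (vertex K v) = vertex K' v"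
    by (simp_all add: vertex_point_def KL.incl_point K'L.incl_point KK'.incl_point)
  have vr: "r (vertex L v) = vertex K v" "r' (vertex L v) = vertex K' v"
    using r(3)[of "vertex K v"] r'(3)[of "vertex K' v"] v vertex_in[of K v] vertex_in[of K' v] assms(4,6) by auto
  have ij: "?j (?i c) = ?j c" if c: "c \<in> topspace (realization (vset_sset K))" for c
  proof -
    obtain z where "c = realization_point (vset_sset K) z"
      using realization_pointE[OF c] by blast
    then show ?thesis
      by (simp add: KL.incl_point K'L.incl_point KK'.incl_point)
  qed
  show ?thesis
    unfolding homotopy_group_map_trivial_iff[where k = k, OF KK'.continuous_map_incl v(3)]
  proof (intro iffI ballI)
    fix f assume H: "\<forall>f\<in>loops k (realization (vset_sset K)) (vertex K v).
        homotopic_rel k (vertex K' v) (realization (vset_sset K')) (?i \<circ> f) (\<lambda>_. vertex K' v)"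
      and f: "f \<in> loops k (supp_space L K) (vertex L v)"
    have "r \<circ> f \<in> loops k (realization (vset_sset K)) (vertex K v)"
      using loops_compose[OF f r(2) vr(1)] .
    then have "homotopic_rel k (vertex K' v) (realization (vset_sset K')) (?i \<circ> (r \<circ> f)) (\<lambda>_. vertex K' v)"
      using H by blast
    from homotopic_rel_compose_left[OF this r'(1) v(2)]
    show "homotopic_rel k (vertex L v) (supp_space L K') f (\<lambda>_. vertex L v)"
    proof (rule homotopic_rel_eq)
      fix t assume "t \<in> topspace (cube k)"
      then have "f t \<in> topspace (supp_space L K)"
        by (rule loops_in[OF f])
      then show "f t = (?j \<circ> (?i \<circ> (r \<circ> f))) t"
        using r(4)[of "f t"] ij[of "r (f t)"] continuous_map_in[OF r(2), of "f t"] by (simp only: comp_apply)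
    qed (simp add: v)
  next
    fix f assume H: "\<forall>f\<in>loops k (supp_space L K) (vertex L v).
        homotopic_rel k (vertex L v) (supp_space L K') f (\<lambda>_. vertex L v)"
      and f: "f \<in> loops k (realization (vset_sset K)) (vertex K v)"
    have "?j \<circ> f \<in> loops k (supp_space L K) (vertex L v)"
      using loops_compose[OF f r(1) v(1)] .
    then have "homotopic_rel k (vertex L v) (supp_space L K') (?j \<circ> f) (\<lambda>_. vertex L v)"
      using H by blast
    from homotopic_rel_compose_left[OF this r'(2) vr(2)]
    show "homotopic_rel k (vertex K' v) (realization (vset_sset K')) (?i \<circ> f) (\<lambda>_. vertex K' v)"
    proof (rule homotopic_rel_eq)
      fix t assume "t \<in> topspace (cube k)"
      then have ft: "f t \<in> topspace (realization (vset_sset K))"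
        by (intro loops_in[OF f])
      moreover have "?i (f t) \<in> topspace (realization (vset_sset K'))"
        by (rule continuous_map_in[OF KK'.continuous_map_incl ft])
      ultimately show "(?i \<circ> f) t = (r' \<circ> (?j \<circ> f)) t"
        using r'(3)[of "?i (f t)"] ij[OF ft] by simp
    qed (simp add: vr)
  qed
qed

lemma essentially_connected_vset_iff:
  assumes "hereditary L" "\<And>\<alpha>. \<alpha> \<in> A \<Longrightarrow> hereditary (K \<alpha>)"
    and "\<And>\<alpha> F. \<alpha> \<in> A \<Longrightarrow> K \<alpha> F \<Longrightarrow> L F"
    and "\<And>\<alpha> \<beta> F. \<alpha> \<in> A \<Longrightarrow> \<beta> \<in> A \<Longrightarrow> \<alpha> \<le> \<beta> \<Longrightarrow> K \<alpha> F \<Longrightarrow> K \<beta> F"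
  shows "essentially_connected n (vset_sset L) A (\<lambda>\<alpha>. vset_sset (K \<alpha>)) \<longleftrightarrow>
    (\<forall>v k \<alpha>. int k \<le> n \<longrightarrow> \<alpha> \<in> A \<longrightarrow> K \<alpha> {v} \<longrightarrow> (\<exists>\<beta>\<in>A. \<alpha> \<le> \<beta> \<and>
      (\<forall>f\<in>loops k (supp_space L (K \<alpha>)) (vertex L v). homotopic_rel k (vertex L v) (supp_space L (K \<beta>)) f (\<lambda>_. vertex L v))))"
    (is "?L \<longleftrightarrow> ?R")
proof -
  have triv: "(\<forall>c\<in>homotopy_group k (realization (vset_sset (K \<alpha>))) (vertex (K \<alpha>) v).
      homotopy_group_map k (realization (vset_sset (K \<beta>))) (vertex (K \<beta>) v) (realization_incl (vset_sset (K \<beta>))) c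
        = homotopy_group_one k (realization (vset_sset (K \<beta>))) (vertex (K \<beta>) v))
    \<longleftrightarrow> (\<forall>f\<in>loops k (supp_space L (K \<alpha>)) (vertex L v). homotopic_rel k (vertex L v) (supp_space L (K \<beta>)) f (\<lambda>_. vertex L v))"
    if "\<alpha> \<in> A" "\<beta> \<in> A" "\<alpha> \<le> \<beta>" "K \<alpha> {v}" for \<alpha> \<beta> v k
    using that assms by (intro trivial_vset_iff) auto
  have "?L \<longleftrightarrow> (\<forall>v k \<alpha>. L {v} \<longrightarrow> int k \<le> n \<longrightarrow> \<alpha> \<in> A \<longrightarrow> K \<alpha> {v} \<longrightarrow> (\<exists>\<beta>\<in>A. \<alpha> \<le> \<beta> \<and>
      (\<forall>c\<in>homotopy_group k (realization (vset_sset (K \<alpha>))) (vertex (K \<alpha>) v).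
        homotopy_group_map k (realization (vset_sset (K \<beta>))) (vertex (K \<beta>) v) (realization_incl (vset_sset (K \<beta>))) c
          = homotopy_group_one k (realization (vset_sset (K \<beta>))) (vertex (K \<beta>) v))))"
    unfolding essentially_connected_def by (auto simp: length_Suc_conv)
  also have "\<dots> \<longleftrightarrow> ?R"
  proof (intro all_cong1)
    fix v k \<alpha>
    show "(L {v} \<longrightarrow> int k \<le> n \<longrightarrow> \<alpha> \<in> A \<longrightarrow> K \<alpha> {v} \<longrightarrow> (\<exists>\<beta>\<in>A. \<alpha> \<le> \<beta> \<and>
      (\<forall>c\<in>homotopy_group k (realization (vset_sset (K \<alpha>))) (vertex (K \<alpha>) v).
        homotopy_group_map k (realization (vset_sset (K \<beta>))) (vertex (K \<beta>) v) (realization_incl (vset_sset (K \<beta>))) c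
          = homotopy_group_one k (realization (vset_sset (K \<beta>))) (vertex (K \<beta>) v))))
      \<longleftrightarrow> (int k \<le> n \<longrightarrow> \<alpha> \<in> A \<longrightarrow> K \<alpha> {v} \<longrightarrow> (\<exists>\<beta>\<in>A. \<alpha> \<le> \<beta> \<and>
      (\<forall>f\<in>loops k (supp_space L (K \<alpha>)) (vertex L v). homotopic_rel k (vertex L v) (supp_space L (K \<beta>)) f (\<lambda>_. vertex L v))))"
      using assms(3)[of \<alpha> "{v}"] triv[of \<alpha> _ v k] by (cases "\<alpha> \<in> A \<and> K \<alpha> {v}") (simp_all cong: bex_cong conj_cong)
  qed
  finally show ?thesis .
qed

section \<open>Radial maps of the cube: cones and homotopy extension\<close>

abbreviation I01 :: "real topology" where "I01 \<equiv> top_of_set {0..1}"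

lemma topspace_cube: "topspace (cube k) = PiE {..<k} (\<lambda>_. {0..1})"
  by (simp add: cube_def)

lemma continuous_map_cube:
  "continuous_map X (cube k) f \<longleftrightarrow>
    (\<forall>x\<in>topspace X. f x \<in> topspace (cube k)) \<and> (\<forall>i<k. continuous_map X euclideanreal (\<lambda>x. f x i))"
  unfolding cube_def continuous_map_componentwise continuous_map_in_subtopology
  by (auto simp: PiE_iff Pi_iff image_subset_iff)

lemma continuous_map_cube_coord: "i < k \<Longrightarrow> continuous_map (cube k) euclideanreal (\<lambda>t. t i)"
  using continuous_map_cube[of "cube k" k "\<lambda>t. t"] by auto

lemma continuous_map_I01: "continuous_map I01 euclideanreal (\<lambda>s. s)"
  by (simp add: continuous_map_from_subtopology)

lemma continuous_map_to_I01:
  "continuous_map X I01 f \<longleftrightarrow> continuous_map X euclideanreal f \<and> (\<forall>x\<in>topspace X. 0 \<le> f x \<and> f x \<le> 1)"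
  by (auto simp: continuous_map_in_subtopology)

lemma continuous_map_prod_fst:
  "continuous_map X Z f \<Longrightarrow> continuous_map (prod_topology X Y) Z (\<lambda>x. f (fst x))"
  using continuous_map_compose[OF continuous_map_fst, of X Z f Y] by (simp add: o_def)

lemma continuous_map_prod_snd:
  "continuous_map Y Z f \<Longrightarrow> continuous_map (prod_topology X Y) Z (\<lambda>x. f (snd x))"
  using continuous_map_compose[OF continuous_map_snd, of Y Z f X] by (simp add: o_def)

lemma continuous_map_paste:
  assumes "closedin X S" "closedin X T" "topspace X \<subseteq> S \<union> T"
    and "continuous_map (subtopology X S) Y f" "continuous_map (subtopology X T) Y g"
    and "\<And>x. x \<in> S \<Longrightarrow> x \<in> T \<Longrightarrow> f x = g x"
  shows "continuous_map X Y (\<lambda>x. if x \<in> S then f x else g x)"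
  by (rule pasting_lemma_closed[where I = UNIV and T = "\<lambda>b. if b then S else T" and f = "\<lambda>b. if b then f else g"])
    (use assms in \<open>auto split: if_splits\<close>)

text \<open>The sup-norm distance from the centre of the cube, scaled so that it is \<open>1\<close> on the boundary.\<close>

primrec cnorm :: "nat \<Rightarrow> (nat \<Rightarrow> real) \<Rightarrow> real" where
  "cnorm 0 t = 0"
| "cnorm (Suc k) t = max (cnorm k t) \<bar>2 * t k - 1\<bar>"

lemma cnorm_nonneg: "0 \<le> cnorm k t"
  by (induction k) auto

lemma cnorm_ge: "i < k \<Longrightarrow> \<bar>2 * t i - 1\<bar> \<le> cnorm k t"
  by (induction k) (auto simp: less_Suc_eq le_max_iff_disj)

lemma cnorm_attained: "cnorm k t = 0 \<or> (\<exists>i<k. cnorm k t = \<bar>2 * t i - 1\<bar>)"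
  by (induction k) (auto simp: less_Suc_eq max_def)

lemma cnorm_le_1: "t \<in> topspace (cube k) \<Longrightarrow> cnorm k t \<le> 1"
  using cnorm_attained[of k t] by (auto simp: topspace_cube PiE_iff abs_le_iff)

lemma cnorm_eq_1:
  assumes "t \<in> topspace (cube k)"
  shows "cnorm k t = 1 \<longleftrightarrow> t \<in> cube_boundary k"
proof
  assume "cnorm k t = 1"
  then obtain i where "i < k" "\<bar>2 * t i - 1\<bar> = 1"
    using cnorm_attained[of k t] by auto
  then show "t \<in> cube_boundary k"
    using assms by (auto simp: cube_boundary_def abs_if split: if_splits)
next
  assume "t \<in> cube_boundary k"
  then obtain i where "i < k" "\<bar>2 * t i - 1\<bar> = 1"
    by (auto simp: cube_boundary_def)
  then show "cnorm k t = 1"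
    using cnorm_ge[of i k t] cnorm_le_1[OF assms] by simp
qed

lemma continuous_map_cnorm: "continuous_map (cube k) euclideanreal (cnorm k)"
proof -
  have "continuous_map (cube m) euclideanreal (cnorm k)" if "k \<le> m" for k m
    using that
  proof (induction k)
    case 0
    have "cnorm 0 = (\<lambda>_. 0)"
      by (simp add: fun_eq_iff)
    then show ?case by simp
  next
    case (Suc k)
    have "continuous_map (cube m) euclideanreal (\<lambda>t. \<bar>2 * t k - 1\<bar>)"
      using Suc.prems by (intro continuous_map_real_abs continuous_map_diff continuous_map_real_mult
          continuous_map_cube_coord) auto
    then show ?case
      using Suc by (auto intro!: continuous_map_real_max)
  qed
  then show ?thesis by simp
qed

text \<open>Scaling about the centre of the cube. With \<open>\<mu>\<close> the reciprocal of
  \<open>cnorm\<close> it is the radial projection to the boundary, with \<open>\<mu>\<close> = 0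
  the constant map to the centre.\<close>

definition cscale :: "nat \<Rightarrow> real \<Rightarrow> (nat \<Rightarrow> real) \<Rightarrow> nat \<Rightarrow> real" where
  "cscale k \<mu> t = restrict (\<lambda>i. 1 / 2 + \<mu> * (t i - 1 / 2)) {..<k}"

lemma cnorm_cscale: "cnorm k (cscale k \<mu> t) = \<bar>\<mu>\<bar> * cnorm k t"
proof -
  have "cnorm k (cscale m \<mu> t) = \<bar>\<mu>\<bar> * cnorm k t" if "k \<le> m" for k m
    using that
  proof (induction k)
    case (Suc k)
    have "2 * (1 / 2 + \<mu> * (t k - 1 / 2)) - 1 = \<mu> * (2 * t k - 1)"
      by (simp add: algebra_simps)
    then have "\<bar>2 * cscale m \<mu> t k - 1\<bar> = \<bar>\<mu>\<bar> * \<bar>2 * t k - 1\<bar>"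
      using Suc.prems by (simp add: cscale_def abs_mult del: distrib_left_numeral)
    then show ?case
      using Suc by (simp add: max_mult_distrib_left)
  qed simp
  then show ?thesis by simp
qed

lemma cscale_in_cube:
  assumes "\<bar>\<mu>\<bar> * cnorm k t \<le> 1"
  shows "cscale k \<mu> t \<in> topspace (cube k)"
proof -
  have "cscale k \<mu> t i \<in> {0..1}" if "i < k" for i
    using cnorm_ge[OF that, of "cscale k \<mu> t"] assms by (auto simp: cnorm_cscale abs_le_iff)
  then show ?thesis
    by (auto simp: topspace_cube cscale_def)
qed

lemma cscale_1: "t \<in> topspace (cube k) \<Longrightarrow> cscale k 1 t = t"
  by (auto simp: topspace_cube cscale_def PiE_iff extensional_def)

lemma continuous_map_cscale:
  assumes "continuous_map X euclideanreal \<mu>" "continuous_map X (cube k) f"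
    and "\<And>x. x \<in> topspace X \<Longrightarrow> \<bar>\<mu> x\<bar> * cnorm k (f x) \<le> 1"
  shows "continuous_map X (cube k) (\<lambda>x. cscale k (\<mu> x) (f x))"
  unfolding continuous_map_cube
proof (intro conjI allI impI ballI)
  fix i assume i: "i < k"
  then have "continuous_map X euclideanreal (\<lambda>x. f x i)"
    using assms(2) by (simp add: continuous_map_cube)
  then show "continuous_map X euclideanreal (\<lambda>x. cscale k (\<mu> x) (f x) i)"
    using i assms(1) by (auto simp: cscale_def intro!: continuous_map_add continuous_map_real_mult continuous_map_diff)
qed (use assms(3) cscale_in_cube in auto)

text \<open>The inner cube of half the size goes to the constant \<open>c\<close>, and the null
  homotopy is spread radially over the collar around it.\<close>

lemma nullhomotopic_extends_cube:
  assumes "homotopic_with (\<lambda>_. True) (subtopology (cube k) (cube_boundary k)) X f (\<lambda>_. c)" "c \<in> topspace X"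
  obtains g where "continuous_map (cube k) X g" "\<And>t. t \<in> cube_boundary k \<Longrightarrow> g t = f t"
proof -
  obtain h where h: "continuous_map (prod_topology I01 (subtopology (cube k) (cube_boundary k))) X h"
    "\<And>t. h (0, t) = f t" "\<And>t. h (1, t) = c"
    using assms(1) unfolding homotopic_with_def by auto
  let ?S = "subtopology (cube k) {t \<in> topspace (cube k). 1 / 2 \<le> cnorm k t}"
  \<comment> \<open>The time is 1 at half radius, where \<open>h\<close> is constant, and 0 on the
    boundary, where \<open>h\<close> is \<open>f\<close>.\<close>
  let ?g = "\<lambda>t. h (2 - 2 * cnorm k t, cscale k (1 / cnorm k t) t)"
  have "continuous_map ?S (subtopology (cube k) (cube_boundary k)) (\<lambda>t. cscale k (1 / cnorm k t) t)"
    unfolding continuous_map_in_subtopology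
  proof (intro conjI continuous_map_cscale)
    show "continuous_map ?S euclideanreal (\<lambda>t. 1 / cnorm k t)"
      by (intro continuous_map_real_divide continuous_map_from_subtopology continuous_map_cnorm) auto
    show "(\<lambda>t. cscale k (1 / cnorm k t) t) \<in> topspace ?S \<rightarrow> cube_boundary k"
    proof
      fix t assume "t \<in> topspace ?S"
      then have "cnorm k (cscale k (1 / cnorm k t) t) = 1"
        using cnorm_nonneg[of k t] by (auto simp: cnorm_cscale)
      then show "cscale k (1 / cnorm k t) t \<in> cube_boundary k"
        by (subst cnorm_eq_1[symmetric]) (auto simp: cnorm_cscale intro: cscale_in_cube)
    qed
  qed (auto intro: continuous_map_from_subtopology)
  moreover have "continuous_map ?S I01 (\<lambda>t. 2 - 2 * cnorm k t)"
    unfolding continuous_map_to_I01 using cnorm_le_1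
    by (auto intro!: continuous_map_diff continuous_map_real_mult continuous_map_from_subtopology continuous_map_cnorm)
  ultimately have "continuous_map ?S X ?g"
    by (intro continuous_map_compose[OF _ h(1), unfolded o_def] continuous_map_pairedI)
  then have "continuous_map (cube k) X (\<lambda>t. if cnorm k t \<le> 1 / 2 then c else ?g t)"
  proof (intro continuous_map_cases_le continuous_map_cnorm)
    show "c = ?g t" if "cnorm k t = 1 / 2" for t
      by (simp add: that h(3))
  qed (use assms(2) in auto)
  moreover have "(if cnorm k t \<le> 1 / 2 then c else ?g t) = f t" if "t \<in> cube_boundary k" for t
  proof -
    have "t \<in> topspace (cube k)" "cnorm k t = 1"
      using that cnorm_eq_1[of t k] cube_boundary_subset by auto
    then show ?thesis
      by (simp add: cscale_1 h)
  qed
  ultimately show thesis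
    by (rule that)
qed

text \<open>The cube shrinks to its centre, which is written \<open>cscale k 0 undefined\<close>
  because scaling by 0 forgets the argument.\<close>

lemma homotopic_cube_const:
  assumes "continuous_map (cube k) X g"
  shows "homotopic_with (\<lambda>_. True) (cube k) X g (\<lambda>_. g (cscale k 0 undefined))"
proof -
  have "continuous_map (prod_topology I01 (cube k)) (cube k) (\<lambda>x. cscale k (1 - fst x) (snd x))"
  proof (rule continuous_map_cscale)
    show "\<bar>1 - fst x\<bar> * cnorm k (snd x) \<le> 1" if "x \<in> topspace (prod_topology I01 (cube k))" for x
      using that cnorm_le_1[of "snd x" k] cnorm_nonneg[of k "snd x"] by (auto intro!: mult_le_one)
  qed (auto intro!: continuous_map_diff continuous_map_prod_fst continuous_map_I01 continuous_map_snd)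
  then have 1: "continuous_map (prod_topology I01 (cube k)) X (g \<circ> (\<lambda>x. cscale k (1 - fst x) (snd x)))"
    using assms by (rule continuous_map_compose)
  have c0: "cscale k 0 t = cscale k 0 undefined" for t
    by (simp add: cscale_def)
  have "\<forall>t. (g \<circ> (\<lambda>x. cscale k (1 - fst x) (snd x))) (1, t) = g (cscale k 0 undefined)"
    using c0 by (auto intro: arg_cong[where f = g])
  moreover have "\<forall>t\<in>topspace (cube k). (g \<circ> (\<lambda>x. cscale k (1 - fst x) (snd x))) (0, t) = g t"
    by (simp add: cscale_1)
  ultimately show ?thesis
    using 1 by (subst homotopic_with) (auto intro!: exI[of _ "g \<circ> (\<lambda>x. cscale k (1 - fst x) (snd x))"])
qed

text \<open>The solid cylinder over the cube is retracted to its bottom together with its wall;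
  composing \<open>a\<close> and \<open>b\<close> with the retraction gives the extension.\<close>

lemma cube_homotopy_extension:
  assumes "continuous_map (cube k) X a"
    and "continuous_map (prod_topology I01 (subtopology (cube k) (cube_boundary k))) X b"
    and "\<And>t. t \<in> cube_boundary k \<Longrightarrow> b (0, t) = a t"
  obtains H where "continuous_map (prod_topology I01 (cube k)) X H"
    "\<And>t. t \<in> topspace (cube k) \<Longrightarrow> H (0, t) = a t"
    "\<And>s t. s \<in> {0..1} \<Longrightarrow> t \<in> cube_boundary k \<Longrightarrow> H (s, t) = b (s, t)"
proof -
  let ?P = "prod_topology I01 (cube k)"
  \<comment> \<open>Projection from the point at height 2 above the centre: a ray is stretched by
    \<open>\<mu>\<close> until it meets the wall, at 1 / \<open>cnorm\<close>, or the bottom, at 1 /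
    (1 - s / 2), whichever comes first. \<open>?u\<close> and \<open>?v\<close> are the position and
    the height of the point reached.\<close>
  let ?\<mu> = "\<lambda>x. 1 / max (cnorm k (snd x)) (1 - fst x / 2)"
  let ?u = "\<lambda>x. cscale k (?\<mu> x) (snd x)"
  let ?v = "\<lambda>x. 2 - (2 - fst x) * ?\<mu> x"
  have pos: "max (cnorm k (snd x)) (1 - fst x / 2) > 0" if "x \<in> topspace ?P" for x
    using that by (auto simp: less_max_iff_disj)
  have c: "continuous_map ?P euclideanreal (\<lambda>x. cnorm k (snd x))" "continuous_map ?P euclideanreal (\<lambda>x. 1 - fst x / 2)"
    "continuous_map ?P euclideanreal (\<lambda>x. 2 - fst x)"
    by (auto intro!: continuous_map_prod_snd continuous_map_cnorm continuous_map_diff continuous_map_real_divide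
        continuous_map_prod_fst continuous_map_I01)
  have mu: "continuous_map ?P euclideanreal ?\<mu>"
  proof (intro continuous_map_real_divide continuous_map_real_max c)
    show "max (cnorm k (snd x)) (1 - fst x / 2) \<noteq> 0" if "x \<in> topspace ?P" for x
      using pos[OF that] by linarith
  qed simp
  have mu1: "\<bar>?\<mu> x\<bar> * cnorm k (snd x) \<le> 1" if "x \<in> topspace ?P" for x
    using pos[OF that] cnorm_nonneg[of k "snd x"] by (auto simp: divide_simps)
  have u: "continuous_map ?P (cube k) ?u"
    using mu mu1 by (intro continuous_map_cscale continuous_map_snd) auto
  let ?T = "subtopology ?P {x \<in> topspace ?P. 1 - fst x / 2 \<le> cnorm k (snd x)}"
  have nz: "cnorm k (snd x) > 0" "?\<mu> x = 1 / cnorm k (snd x)" if "x \<in> topspace ?T" for x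
    using that by auto
  have "continuous_map ?T (subtopology (cube k) (cube_boundary k)) ?u"
    unfolding continuous_map_in_subtopology
  proof (intro conjI continuous_map_from_subtopology u)
    show "?u \<in> topspace ?T \<rightarrow> cube_boundary k"
    proof
      fix x assume x: "x \<in> topspace ?T"
      then have "cnorm k (?u x) = 1"
        using nz[OF x] by (simp add: cnorm_cscale)
      moreover have "?u x \<in> topspace (cube k)"
        by (rule continuous_map_in[OF u]) (use x in simp)
      ultimately show "?u x \<in> cube_boundary k"
        by (simp add: cnorm_eq_1)
    qed
  qed
  moreover have "continuous_map ?T I01 ?v"
    unfolding continuous_map_to_I01
  proof (intro conjI ballI)
    show "continuous_map ?T euclideanreal ?v"
      by (intro continuous_map_from_subtopology continuous_map_diff[OF _ continuous_map_real_mult[OF c(3) mu]]) simp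
    fix x assume x: "x \<in> topspace ?T"
    then have "cnorm k (snd x) \<le> 1" "1 - fst x / 2 \<le> cnorm k (snd x)" "fst x \<le> 1"
      using cnorm_le_1 by auto
    then show "0 \<le> ?v x" "?v x \<le> 1"
      unfolding nz(2)[OF x] using nz(1)[OF x] by (auto simp: field_simps)
  qed
  ultimately have bT: "continuous_map ?T X (\<lambda>x. b (?v x, ?u x))"
    by (intro continuous_map_compose[OF _ assms(2), unfolded o_def] continuous_map_pairedI)
  have "continuous_map ?P X (\<lambda>x. if cnorm k (snd x) \<le> 1 - fst x / 2 then a (?u x) else b (?v x, ?u x))"
  proof (rule continuous_map_cases_le[OF c(1,2) _ bT])
    show "continuous_map (subtopology ?P {x \<in> topspace ?P. cnorm k (snd x) \<le> 1 - fst x / 2}) X (\<lambda>x. a (?u x))"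
      using continuous_map_compose[OF u assms(1)] by (intro continuous_map_from_subtopology) (simp add: o_def)
    fix x assume x: "x \<in> topspace ?P" "cnorm k (snd x) = 1 - fst x / 2"
    then have xT: "x \<in> topspace ?T" by simp
    have "?u x \<in> cube_boundary k"
      using nz[OF xT] by (subst cnorm_eq_1[OF continuous_map_in[OF u x(1)], symmetric]) (simp add: cnorm_cscale)
    moreover have "?v x = 0"
      unfolding nz(2)[OF xT] using nz(1)[OF xT] x(2) by (simp add: field_simps)
    ultimately show "a (?u x) = b (?v x, ?u x)"
      using assms(3) by simp
  qed
  moreover have "(if cnorm k (snd (0, t)) \<le> 1 - fst (0, t) / 2 then a (?u (0, t)) else b (?v (0, t), ?u (0, t))) = a t"
    if "t \<in> topspace (cube k)" for t
    using cnorm_le_1[OF that] that by (simp add: max_absorb2 cscale_1)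
  moreover have "(if cnorm k (snd (s, t)) \<le> 1 - fst (s, t) / 2 then a (?u (s, t)) else b (?v (s, t), ?u (s, t))) = b (s, t)"
    if "s \<in> {0..1}" "t \<in> cube_boundary k" for s t
  proof -
    have "t \<in> topspace (cube k)" "cnorm k t = 1"
      using that cnorm_eq_1[of t k] cube_boundary_subset by auto
    then show ?thesis
      using that assms(3) by (auto simp: max_absorb1 cscale_1)
  qed
  ultimately show thesis
    by (rule that)
qed

section \<open>Homotopies as cubes whose last coordinate is time\<close>

lemma cube_upd: "u \<in> topspace (cube k) \<Longrightarrow> s \<in> {0..1} \<Longrightarrow> u(k := s) \<in> topspace (cube (Suc k))"
  by (auto simp: topspace_cube PiE_iff extensional_def less_Suc_eq)

lemma cube_restrict: "t \<in> topspace (cube (Suc k)) \<Longrightarrow> restrict t {..<k} \<in> topspace (cube k)"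
  by (auto simp: topspace_cube PiE_iff)

lemma cube_last: "t \<in> topspace (cube (Suc k)) \<Longrightarrow> t k \<in> {0..1}"
  by (auto simp: topspace_cube PiE_iff)

lemma cube_restrict_upd: "t \<in> topspace (cube (Suc k)) \<Longrightarrow> (restrict t {..<k})(k := t k) = t"
  by (auto simp: topspace_cube PiE_iff extensional_def fun_eq_iff)

lemma restrict_upd_cube: "u \<in> topspace (cube k) \<Longrightarrow> restrict (u(k := s)) {..<k} = u"
  by (auto simp: topspace_cube PiE_iff extensional_def fun_eq_iff)

lemma continuous_map_cube_restrict: "continuous_map (cube (Suc k)) (cube k) (\<lambda>t. restrict t {..<k})"
  by (auto simp: continuous_map_cube cube_restrict continuous_map_cube_coord)

lemma continuous_map_I01_fst: "continuous_map (prod_topology I01 Y) euclideanreal fst"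
  using continuous_map_prod_fst[OF continuous_map_I01] .

lemma continuous_map_cube_upd:
  "continuous_map (prod_topology I01 (cube k)) (cube (Suc k)) (\<lambda>x. (snd x)(k := fst x))"
  by (auto simp: continuous_map_cube cube_upd less_Suc_eq continuous_map_I01_fst
      intro!: continuous_map_prod_snd[of "cube k" euclideanreal "\<lambda>t. t _"] continuous_map_cube_coord)

lemma cube_boundary_Suc:
  assumes "t \<in> topspace (cube (Suc k))"
  shows "t \<in> cube_boundary (Suc k) \<longleftrightarrow> t k = 0 \<or> t k = 1 \<or> restrict t {..<k} \<in> cube_boundary k"
  using assms cube_restrict[OF assms] by (auto simp: cube_boundary_def less_Suc_eq)

lemma continuous_map_cube_of_homotopy:
  assumes "continuous_map (prod_topology I01 (cube k)) X h"
  shows "continuous_map (cube (Suc k)) X (\<lambda>t. h (t k, restrict t {..<k}))"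
proof -
  have "continuous_map (cube (Suc k)) (prod_topology I01 (cube k)) (\<lambda>t. (t k, restrict t {..<k}))"
    using cube_last by (intro continuous_map_pairedI continuous_map_cube_restrict)
      (auto simp: continuous_map_to_I01 continuous_map_cube_coord)
  from continuous_map_compose[OF this assms] show ?thesis
    by (simp add: o_def)
qed

lemma homotopic_rel_of_cube:
  assumes "continuous_map (cube (Suc k)) X F"
    and "\<And>u. u \<in> topspace (cube k) \<Longrightarrow> F (u(k := 0)) = f u"
    and "\<And>u. u \<in> topspace (cube k) \<Longrightarrow> F (u(k := 1)) = g u"
    and "\<And>u s. u \<in> cube_boundary k \<Longrightarrow> s \<in> {0..1} \<Longrightarrow> F (u(k := s)) = x"
  shows "homotopic_rel k x X f g"
proof -
  have c: "continuous_map (prod_topology I01 (cube k)) X (F \<circ> (\<lambda>x. (snd x)(k := fst x)))"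
    by (rule continuous_map_compose[OF continuous_map_cube_upd assms(1)])
  have "homotopic_rel k x X (\<lambda>u. F (u(k := 0))) (\<lambda>u. F (u(k := 1)))"
    unfolding homotopic_with_def using c assms(4)
    by (intro exI[of _ "F \<circ> (\<lambda>x. (snd x)(k := fst x))"]) auto
  then show ?thesis
    by (rule homotopic_rel_eq) (use assms in auto)
qed

lemma cube_of_homotopic_rel:
  assumes "homotopic_rel k x X f g"
  obtains F where "continuous_map (cube (Suc k)) X F"
    "\<And>t. t \<in> topspace (cube (Suc k)) \<Longrightarrow> t k = 0 \<Longrightarrow> F t = f (restrict t {..<k})"
    "\<And>t. t \<in> topspace (cube (Suc k)) \<Longrightarrow> t k = 1 \<Longrightarrow> F t = g (restrict t {..<k})"
    "\<And>t. t \<in> topspace (cube (Suc k)) \<Longrightarrow> restrict t {..<k} \<in> cube_boundary k \<Longrightarrow> F t = x"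
proof -
  obtain h where h: "continuous_map (prod_topology I01 (cube k)) X h"
    "\<And>u. h (0, u) = f u" "\<And>u. h (1, u) = g u"
    "\<And>s. s \<in> {0..1} \<Longrightarrow> (\<lambda>u. h (s, u)) ` cube_boundary k \<subseteq> {x}"
    using assms unfolding homotopic_with_def by auto
  show thesis
  proof (rule that[OF continuous_map_cube_of_homotopy[OF h(1)]])
    show "h (t k, restrict t {..<k}) = x" if "t \<in> topspace (cube (Suc k))" "restrict t {..<k} \<in> cube_boundary k" for t
      using h(4)[OF cube_last[OF that(1)]] that(2) by auto
  qed (simp_all add: h)
qed

text \<open>Spheres are free, without base point, as they occur on the boundary of a cell. The index
  is the dimension of the filled cube, one more than that of the sphere; for \<open>k\<close> = 0
  the boundary is empty and only a point of \<open>Y\<close> is required.\<close>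

definition fills :: "nat \<Rightarrow> 'a topology \<Rightarrow> 'a topology \<Rightarrow> bool" where
  "fills k X Y \<longleftrightarrow> (\<forall>f. continuous_map (subtopology (cube k) (cube_boundary k)) X f \<longrightarrow>
     (\<exists>g. continuous_map (cube k) Y g \<and> (\<forall>t\<in>cube_boundary k. g t = f t)))"

lemma closedin_cube_face: "i < k \<Longrightarrow> closedin (cube k) {t \<in> topspace (cube k). t i = a}"
  using closedin_continuous_map_preimage[OF continuous_map_cube_coord, of i k "{a}"] by simp

definition box_wall :: "nat \<Rightarrow> (nat \<Rightarrow> real) set" where
  "box_wall k = {t \<in> topspace (cube (Suc k)). t k = 0 \<or> restrict t {..<k} \<in> cube_boundary k}"

lemma closedin_cube_boundary: "closedin (cube k) (cube_boundary k)"
proof -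
  have "cube_boundary k = (\<Union>i\<in>{..<k}. {t \<in> topspace (cube k). t i = 0} \<union> {t \<in> topspace (cube k). t i = 1})"
    by (auto simp: cube_boundary_def)
  moreover have "closedin (cube k) \<dots>"
    by (intro closedin_Union) (auto intro!: closedin_Un closedin_cube_face)
  ultimately show ?thesis by simp
qed

lemma closedin_box_wall: "closedin (cube (Suc k)) (box_wall k)"
proof -
  have "box_wall k = {t \<in> topspace (cube (Suc k)). t k = 0}
      \<union> {t \<in> topspace (cube (Suc k)). restrict t {..<k} \<in> cube_boundary k}"
    by (auto simp: box_wall_def)
  then show ?thesis
    using closedin_continuous_map_preimage[OF continuous_map_cube_restrict closedin_cube_boundary]
    by (auto intro!: closedin_Un closedin_cube_face)
qed

text \<open>Two homotopies in succession: the last coordinate is pushed down to the bottom facet,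
  and the bottom is then shrunk to the corner 0. Neither leaves the wall.\<close>

lemma contractible_box_wall: "contractible_space (subtopology (cube (Suc k)) (box_wall k))"
proof -
  let ?J = "subtopology (cube (Suc k)) (box_wall k)"
  let ?P = "prod_topology I01 ?J"
  let ?push = "\<lambda>x. (restrict (snd x) {..<k})(k := max (snd x k - fst x) 0)"
  let ?shrink = "\<lambda>x. restrict (\<lambda>i. if i < k then (1 - fst x) * snd x i else 0) {..<Suc k}"
  have snd: "continuous_map ?P euclideanreal (\<lambda>x. snd x i)" if "i < Suc k" for i
    using that by (intro continuous_map_prod_snd[of ?J euclideanreal "\<lambda>t. t i"] continuous_map_from_subtopology continuous_map_cube_coord)
  have fst: "continuous_map ?P euclideanreal fst"
    by (rule continuous_map_I01_fst)
  have J: "x \<in> topspace ?P \<Longrightarrow> fst x \<in> {0..1} \<and> snd x \<in> topspace (cube (Suc k)) \<and> snd x \<in> box_wall k" for x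
    by auto
  have "continuous_map ?P ?J ?push"
    unfolding continuous_map_in_subtopology continuous_map_cube
  proof (intro conjI ballI allI impI funcsetI)
    show "?push x \<in> topspace (cube (Suc k))" if "x \<in> topspace ?P" for x
      using J[OF that] cube_last[of "snd x" k] by (intro cube_upd cube_restrict) auto
    then show "?push x \<in> box_wall k" if "x \<in> topspace ?P" for x
      using J[OF that] that restrict_upd_cube[OF cube_restrict, of "snd x" k] by (auto simp: box_wall_def)
    show "continuous_map ?P euclideanreal (\<lambda>x. ?push x i)" if "i < Suc k" for i
      using snd[OF that] fst by (cases "i = k") (auto intro!: continuous_map_real_max continuous_map_diff)
  qed
  moreover have "?push (0, t) = t" if "t \<in> topspace ?J" for t
    using that cube_last[of t k] cube_restrict_upd[of t k] by (auto simp: max_absorb1)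
  moreover have "?push (1, t) = (restrict t {..<k})(k := 0)" if "t \<in> topspace ?J" for t
    using that cube_last[of t k] by auto
  ultimately have 1: "homotopic_with (\<lambda>_. True) ?J ?J id (\<lambda>t. (restrict t {..<k})(k := 0))"
    by (subst homotopic_with) (auto intro!: exI[of _ ?push])
  have "continuous_map ?P ?J ?shrink"
    unfolding continuous_map_in_subtopology continuous_map_cube
  proof (intro conjI ballI allI impI funcsetI)
    show *: "?shrink x \<in> topspace (cube (Suc k))" if "x \<in> topspace ?P" for x
      using J[OF that] by (auto simp: topspace_cube PiE_iff intro!: mult_le_one)
    then show "?shrink x \<in> box_wall k" if "x \<in> topspace ?P" for x
      using *[OF that] by (simp add: box_wall_def)
    show "continuous_map ?P euclideanreal (\<lambda>x. ?shrink x i)" if "i < Suc k" for i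
      using snd[OF that] fst that by (cases "i = k") (auto intro!: continuous_map_real_mult continuous_map_diff)
  qed
  moreover have "?shrink (0, t) = (restrict t {..<k})(k := 0)" if "t \<in> topspace ?J" for t
    using that by (auto simp: fun_eq_iff)
  ultimately have 2: "homotopic_with (\<lambda>_. True) ?J ?J (\<lambda>t. (restrict t {..<k})(k := 0)) (\<lambda>_. restrict (\<lambda>_. 0) {..<Suc k})"
    by (subst homotopic_with) (auto intro!: exI[of _ ?shrink])
  show ?thesis
    unfolding contractible_space_def using homotopic_with_trans[OF 1 2] by blast
qed

lemma cube_boundary_Suc_eq: "cube_boundary (Suc k) = box_wall k \<union> {t \<in> topspace (cube (Suc k)). t k = 1}"
  using cube_boundary_subset[of "Suc k"] by (auto simp: box_wall_def cube_boundary_Suc)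

text \<open>A free sphere becomes a pointed one after the wall \<open>box_wall k\<close> (all facets but the top) has been
  contracted to the base point; the contraction extends to the top facet by homotopy extension.\<close>

lemma extends_cube_if_pointed:
  assumes XY: "continuous_map X Y id"
    and f: "continuous_map (subtopology (cube (Suc k)) (cube_boundary (Suc k))) X f"
    and t0: "t0 \<in> box_wall k" "path_component_of X (f t0) x"
    and null: "\<And>f. f \<in> loops k X x \<Longrightarrow> homotopic_rel k x Y f (\<lambda>_. x)"
  obtains g where "continuous_map (cube (Suc k)) Y g" "\<And>t. t \<in> cube_boundary (Suc k) \<Longrightarrow> g t = f t"
proof -
  let ?B = "subtopology (cube (Suc k)) (cube_boundary (Suc k))"
  let ?J = "subtopology (cube (Suc k)) (box_wall k)"
  let ?top = "{t \<in> topspace (cube (Suc k)). t k = 1}"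
  let ?r = "\<lambda>t. restrict t {..<k}"
  have JB: "box_wall k \<subseteq> cube_boundary (Suc k)" "box_wall k \<subseteq> topspace (cube (Suc k))"
    by (auto simp: cube_boundary_Suc_eq box_wall_def)
  have top_cont: "continuous_map (cube k) ?B (\<lambda>u. u(k := 1))"
  proof -
    have "continuous_map (cube k) (prod_topology I01 (cube k)) (\<lambda>u. (1, u))"
      by (simp add: continuous_map_pairedI)
    from continuous_map_compose[OF this continuous_map_cube_upd]
    show ?thesis
      using cube_upd[of _ k 1] by (auto simp: continuous_map_in_subtopology o_def cube_boundary_Suc_eq)
  qed
  have fJ: "continuous_map ?J X f"
    using continuous_map_from_subtopology_mono[OF f JB(1)] .
  have "homotopic_with (\<lambda>_. True) ?J X f (\<lambda>_. f t0)"
  proof -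
    have "homotopic_with (\<lambda>_. True) ?J ?J id (\<lambda>_. t0)"
      using contractible_box_wall[of k] t0(1) JB(2) unfolding contractible_space_alt by auto
    from homotopic_with_compose_continuous_map_left[OF this fJ, where q = "\<lambda>_. True"] show ?thesis
      by (simp add: o_def)
  qed
  moreover have "homotopic_with (\<lambda>_. True) ?J X (\<lambda>_. f t0) (\<lambda>_. x)"
    using t0(2) by (simp add: homotopic_constant_maps)
  ultimately have "homotopic_with (\<lambda>_. True) ?J X f (\<lambda>_. x)"
    by (rule homotopic_with_trans)
  then obtain b where b: "continuous_map (prod_topology I01 ?J) X b" "\<And>t. b (0, t) = f t" "\<And>t. b (1, t) = x"
    unfolding homotopic_with_def by auto
  \<comment> \<open>The contraction of the wall, restricted to the rim of the top facet, where it
    meets the data on that facet.\<close>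
  let ?bt = "\<lambda>y. b (fst y, (snd y)(k := 1))"
  have "continuous_map (prod_topology I01 (subtopology (cube k) (cube_boundary k))) (prod_topology I01 ?J)
     (\<lambda>y. (fst y, (snd y)(k := 1)))"
  proof (intro continuous_map_pairedI continuous_map_fst)
    have "continuous_map (subtopology (cube k) (cube_boundary k)) ?J (\<lambda>u. u(k := 1))"
      using continuous_map_from_subtopology[OF top_cont, of "cube_boundary k"] restrict_upd_cube[of _ k 1] cube_upd[of _ k 1]
      by (auto simp: continuous_map_in_subtopology box_wall_def)
    then show "continuous_map (prod_topology I01 (subtopology (cube k) (cube_boundary k))) ?J (\<lambda>y. (snd y)(k := 1))"
      by (rule continuous_map_prod_snd)
  qed
  from continuous_map_compose[OF this b(1)]
  have bt: "continuous_map (prod_topology I01 (subtopology (cube k) (cube_boundary k))) X ?bt"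
    by (simp add: o_def)
  have a: "continuous_map (cube k) X (\<lambda>u. f (u(k := 1)))"
    using continuous_map_compose[OF top_cont f] by (simp add: o_def)
  obtain H where H: "continuous_map (prod_topology I01 (cube k)) X H"
    "\<And>u. u \<in> topspace (cube k) \<Longrightarrow> H (0, u) = f (u(k := 1))"
    "\<And>s u. s \<in> {0..1} \<Longrightarrow> u \<in> cube_boundary k \<Longrightarrow> H (s, u) = ?bt (s, u)"
    using cube_homotopy_extension[OF a bt] b(2) by auto
  \<comment> \<open>Homotopies of the wall and of the top facet that agree on the rim paste to one
    of the whole boundary. This is used twice: to make the sphere pointed, and then to contract the
    pointed sphere.\<close>
  have glue: "homotopic_with (\<lambda>_. True) ?B Z (\<lambda>t. if t \<in> box_wall k then c (0, t) else e (0, ?r t))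
      (\<lambda>t. if t \<in> box_wall k then c (1, t) else e (1, ?r t))"
    if c: "continuous_map (prod_topology I01 ?J) Z c" and e: "continuous_map (prod_topology I01 (cube k)) Z e"
      and ce: "\<And>s u. s \<in> {0..1} \<Longrightarrow> u \<in> cube_boundary k \<Longrightarrow> c (s, u(k := 1)) = e (s, u)" for Z c e
  proof -
    let ?P = "prod_topology I01 ?B"
    let ?SJ = "topspace I01 \<times> box_wall k" and ?ST = "topspace I01 \<times> ?top"
    have tops: "topspace ?B = cube_boundary (Suc k)"
      using cube_boundary_subset by auto
    have cl: "closedin ?B (box_wall k)" "closedin ?B ?top"
      unfolding closedin_closed_subtopology[OF closedin_cube_boundary]
      using closedin_box_wall[of k] closedin_cube_face[of k "Suc k" 1] by (auto simp: cube_boundary_Suc_eq)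
    have SJ: "subtopology ?P ?SJ = prod_topology I01 ?J"
      unfolding subtopology_Times subtopology_topspace subtopology_subtopology Int_absorb1[OF JB(1)] by (rule refl)
    have "continuous_map (subtopology ?P ?ST) (prod_topology I01 (cube k)) (\<lambda>y. (fst y, ?r (snd y)))"
      by (intro continuous_map_from_subtopology continuous_map_pairedI continuous_map_fst
          continuous_map_prod_snd[OF continuous_map_from_subtopology[OF continuous_map_cube_restrict]])
    from continuous_map_compose[OF this e]
    have eT: "continuous_map (subtopology ?P ?ST) Z (\<lambda>y. e (fst y, ?r (snd y)))"
      by (simp add: o_def)
    have "continuous_map ?P Z (\<lambda>y. if y \<in> ?SJ then c y else e (fst y, ?r (snd y)))"
    proof (rule continuous_map_paste[where T = ?ST])
      show "closedin ?P ?SJ" "closedin ?P ?ST"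
        using cl by (simp_all add: closedin_prod_Times_iff del: topspace_euclidean_subtopology)
      show "topspace ?P \<subseteq> ?SJ \<union> ?ST"
        using tops by (auto simp: cube_boundary_Suc_eq)
      show "continuous_map (subtopology ?P ?SJ) Z c"
        using c by (simp only: SJ)
      fix y assume "y \<in> ?SJ" "y \<in> ?ST"
      then have y: "fst y \<in> {0..1}" "snd y \<in> topspace (cube (Suc k))" "snd y k = 1" "?r (snd y) \<in> cube_boundary k"
        by (auto simp: box_wall_def)
      have "(?r (snd y))(k := 1) = snd y"
        using cube_restrict_upd[OF y(2)] y(3) by simp
      then show "c y = e (fst y, ?r (snd y))"
        using ce[OF y(1,4)] by simp
    qed (rule eT)
    then show ?thesis
      by (subst homotopic_with) (auto intro!: exI[of _ "\<lambda>y. if y \<in> ?SJ then c y else e (fst y, ?r (snd y))"])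
  qed
  have eq1: "f t = (if t \<in> box_wall k then b (0, t) else H (0, ?r t))" if "t \<in> topspace ?B" for t
  proof (cases "t \<in> box_wall k")
    case False
    then have "t \<in> topspace (cube (Suc k))" "t k = 1"
      using that by (auto simp: cube_boundary_Suc_eq)
    then show ?thesis
      using False H(2)[OF cube_restrict] cube_restrict_upd[of t k] by simp
  qed (simp add: b)
  have 1: "homotopic_with (\<lambda>_. True) ?B X f (\<lambda>t. if t \<in> box_wall k then x else H (1, ?r t))"
    by (rule homotopic_with_eq[OF glue[OF b(1) H(1)]]) (use H(3) eq1 b(3) in auto)
  \<comment> \<open>With the wall now at \<open>x\<close>, the top facet alone is a loop, to which
    the hypothesis \<open>null\<close> applies.\<close>
  define F where "F u = H (1, u)" for u
  have "F \<in> loops k X x"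
  proof -
    have "continuous_map (cube k) (prod_topology I01 (cube k)) (\<lambda>u. (1, u))"
      by (simp add: continuous_map_pairedI)
    from continuous_map_compose[OF this H(1)] show ?thesis
      using H(3)[of 1] b(3) by (auto simp: loops_def F_def[abs_def] o_def)
  qed
  from null[OF this] obtain M where M: "continuous_map (prod_topology I01 (cube k)) Y M"
    "\<And>u. M (0, u) = F u" "\<And>u. M (1, u) = x" "\<And>s. s \<in> {0..1} \<Longrightarrow> (\<lambda>u. M (s, u)) ` cube_boundary k \<subseteq> {x}"
    unfolding homotopic_with_def by auto
  have "continuous_map (prod_topology I01 ?J) Y (\<lambda>_. x)"
    using continuous_map_in[OF XY path_component_in_topspace[OF t0(2), THEN conjunct2]] by simp
  from glue[OF this M(1)] have 2: "homotopic_with (\<lambda>_. True) ?B Y (\<lambda>t. if t \<in> box_wall k then x else H (1, ?r t)) (\<lambda>_. x)"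
    using M(2-4) by (simp add: F_def image_subset_iff cong: if_cong)
  have "homotopic_with (\<lambda>_. True) ?B Y f (\<lambda>t. if t \<in> box_wall k then x else H (1, ?r t))"
    using homotopic_with_compose_continuous_map_left[OF 1 XY, where q = "\<lambda>_. True"] by simp
  then have "homotopic_with (\<lambda>_. True) ?B Y f (\<lambda>_. x)"
    using 2 by (rule homotopic_with_trans)
  then show thesis
    using nullhomotopic_extends_cube[of "Suc k" Y f x] continuous_map_in[OF XY path_component_in_topspace[OF t0(2), THEN conjunct2]]
      that by auto
qed

section \<open>Grids\<close>

text \<open>The cube \<open>[0,1]\<^sup>d\<close> is divided into \<open>m\<^sup>d\<close> small cubes.  A cell \<open>c\<close> of this grid has coordinates
  \<open>c\<^sub>i \<in> {0..2m}\<close>: an even \<open>c\<^sub>i\<close> stands for the point \<open>c\<^sub>i / 2m\<close>, an odd one for the interval of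
  length \<open>1 / m\<close> around it.\<close>

definition grid :: "nat \<Rightarrow> nat \<Rightarrow> (nat \<Rightarrow> nat) set" where
  "grid d m = PiE {..<d} (\<lambda>_. {..2 * m})"

definition gcell :: "nat \<Rightarrow> nat \<Rightarrow> (nat \<Rightarrow> nat) \<Rightarrow> (nat \<Rightarrow> real) set" where
  "gcell d m c = {t \<in> topspace (cube d). \<forall>i<d. \<bar>2 * real m * t i - c i\<bar> \<le> (if even (c i) then 0 else 1)}"

text \<open>The boundary relative to the cell's own dimension; a grid point has an empty
  one.\<close>

definition gcell_boundary :: "nat \<Rightarrow> nat \<Rightarrow> (nat \<Rightarrow> nat) \<Rightarrow> (nat \<Rightarrow> real) set" where
  "gcell_boundary d m c = {t \<in> gcell d m c. \<exists>i<d. odd (c i) \<and> \<bar>2 * real m * t i - c i\<bar> = 1}"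

definition odd_coords :: "nat \<Rightarrow> (nat \<Rightarrow> nat) \<Rightarrow> nat set" where
  "odd_coords d c = {i. i < d \<and> odd (c i)}"

abbreviation gdim :: "nat \<Rightarrow> (nat \<Rightarrow> nat) \<Rightarrow> nat" where
  "gdim d c \<equiv> card (odd_coords d c)"

text \<open>An odd coordinate may be kept or moved to an end of its interval; every cell is thus a
  face of itself.\<close>

definition gface :: "nat \<Rightarrow> (nat \<Rightarrow> nat) \<Rightarrow> (nat \<Rightarrow> nat) \<Rightarrow> bool" where
  "gface d c' c \<longleftrightarrow> (\<forall>i<d. c' i = c i \<or> (odd (c i) \<and> (c' i = c i + 1 \<or> c' i + 1 = c i)))"

lemma finite_grid: "finite (grid d m)"
  unfolding grid_def by (intro finite_PiE) auto

lemma finite_odd_coords [simp]: "finite (odd_coords d c)"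
  unfolding odd_coords_def by simp

lemma gdim_le: "gdim d c \<le> d"
proof -
  have "odd_coords d c \<subseteq> {..<d}"
    by (auto simp: odd_coords_def)
  then show ?thesis
    using card_mono[of "{..<d}" "odd_coords d c"] by simp
qed

lemma gface_trans: "gface d a b \<Longrightarrow> gface d b c \<Longrightarrow> gface d a c"
  unfolding gface_def by (metis even_add odd_one)

lemma gface_dim_less:
  assumes "gface d c' c" "c' \<noteq> c" "c \<in> grid d m" "c' \<in> grid d m"
  shows "gdim d c' < gdim d c"
proof (rule psubset_card_mono)
  obtain i where i: "c' i \<noteq> c i"
    using assms(2) by auto
  then have "i < d"
    using assms(3,4) by (cases "i < d") (auto simp: grid_def PiE_iff extensional_def)
  then have ci: "odd (c i)" "c' i = c i + 1 \<or> c' i + 1 = c i"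
    using assms(1) i unfolding gface_def by blast+
  then have "even (c' i)"
    by (metis even_add odd_one)
  then have "i \<in> odd_coords d c" "i \<notin> odd_coords d c'"
    using ci \<open>i < d\<close> by (simp_all add: odd_coords_def)
  moreover have "odd_coords d c' \<subseteq> odd_coords d c"
  proof
    fix j assume j: "j \<in> odd_coords d c'"
    then have "c' j = c j \<or> odd (c j)"
      using assms(1) unfolding gface_def odd_coords_def by blast
    then show "j \<in> odd_coords d c"
      using j by (auto simp: odd_coords_def)
  qed
  ultimately show "odd_coords d c' \<subset> odd_coords d c"
    by blast
qed simp

lemma gface_gcell:
  assumes "gface d c' c"
  shows "gcell d m c' \<subseteq> gcell d m c"
proof
  fix t assume t: "t \<in> gcell d m c'"
  have "\<bar>2 * real m * t i - c i\<bar> \<le> (if even (c i) then 0 else 1)" if i: "i < d" for i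
  proof -
    have b: "\<bar>2 * real m * t i - c' i\<bar> \<le> (if even (c' i) then 0 else 1)"
      using t i by (auto simp: gcell_def)
    consider "c' i = c i" | "odd (c i)" "c' i = c i + 1" | "odd (c i)" "c' i + 1 = c i"
      using assms i unfolding gface_def by blast
    then show ?thesis
    proof cases
      case 2
      then have "2 * real m * t i = real (c i + 1)" using b by auto
      then show ?thesis using 2(1) by simp
    next
      case 3
      then have "even (c' i)" by (metis even_add odd_one)
      then have "2 * real m * t i = real (c' i)" using b by auto
      moreover have "real (c i) = real (c' i) + 1" using 3(2) by linarith
      ultimately show ?thesis using 3(1) by simp
    next
      case 1
      then show ?thesis using b by (simp only:)
    qed
  qed
  then show "t \<in> gcell d m c"
    using t by (simp add: gcell_def)
qed

lemma gcell_boundary_face: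
  assumes "t \<in> gcell_boundary d m c" "c \<in> grid d m"
  obtains c' where "c' \<in> grid d m" "gface d c' c" "c' \<noteq> c" "t \<in> gcell d m c'"
proof -
  obtain i where i: "i < d" "odd (c i)" "\<bar>2 * real m * t i - c i\<bar> = 1" and t: "t \<in> gcell d m c"
    using assms(1) by (auto simp: gcell_boundary_def)
  have ci: "c i \<le> 2 * m" "c i \<noteq> 2 * m" "c i > 0"
    using assms(2) i by (auto simp: grid_def PiE_iff intro: Nat.gr0I)
  obtain a where a: "a = c i + 1 \<or> a + 1 = c i" "2 * real m * t i = real a"
  proof (cases "2 * real m * t i - c i > 0")
    case True
    then show thesis
      using that[of "c i + 1"] i(3) by auto
  next
    case False
    then show thesis
      using that[of "c i - 1"] i(3) ci by (auto simp: of_nat_diff)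
  qed
  have "even a"
    using a(1) i(2) by (metis even_add odd_one)
  then have "t \<in> gcell d m (c(i := a))"
    using t a(2) by (auto simp: gcell_def)
  moreover have "a \<le> 2 * m"
    using a(1) ci by linarith
  then have "c(i := a) \<in> grid d m"
    using assms(2) i(1) unfolding grid_def by (auto simp: PiE_iff extensional_def)
  moreover have "gface d (c(i := a)) c" "c(i := a) \<noteq> c"
    using a(1) i by (auto simp: gface_def fun_eq_iff)
  ultimately show thesis
    using that by blast
qed

lemma even_dist_lt_1: "even (a::nat) \<Longrightarrow> odd (b::nat) \<Longrightarrow> \<not> \<bar>real a - real b\<bar> < 1"
proof
  assume "even a" "odd b" "\<bar>real a - real b\<bar> < 1"
  then have "a = b" by linarith
  then show False using \<open>even a\<close> \<open>odd b\<close> by simp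
qed

text \<open>In scaled coordinates an interior point has distance less than 1 from each odd
  \<open>c i\<close>, and two integers of different parity cannot be that close. So any cell through
  the point has the same coordinate wherever \<open>c i\<close> is odd, and may differ only by one
  at even ones. In the extension argument this keeps the interior of a new cell away from the domain
  reached so far.\<close>

lemma gcell_interior_face:
  assumes "t \<in> gcell d m c" "t \<notin> gcell_boundary d m c" "t \<in> gcell d m c'"
  shows "gface d c c'"
  unfolding gface_def
proof (intro allI impI)
  fix i assume i: "i < d"
  let ?x = "2 * real m * t i"
  have c: "\<bar>?x - c i\<bar> \<le> (if even (c i) then 0 else 1)" "odd (c i) \<Longrightarrow> \<bar>?x - c i\<bar> \<noteq> 1"
    and c': "\<bar>?x - c' i\<bar> \<le> (if even (c' i) then 0 else 1)"
    using assms i by (auto simp: gcell_def gcell_boundary_def)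
  show "c i = c' i \<or> (odd (c' i) \<and> (c i = c' i + 1 \<or> c i + 1 = c' i))"
  proof (cases "even (c i)")
    case True
    then have x: "?x = c i" using c by simp
    show ?thesis
    proof (cases "even (c' i)")
      case True
      then show ?thesis using x c' by simp
    next
      case False
      then have "\<bar>real (c i) - real (c' i)\<bar> \<le> 1"
        using c' x by simp
      then show ?thesis
        using False by linarith
    qed
  next
    case False
    then have x: "\<bar>?x - c i\<bar> < 1" using c by auto
    show ?thesis
    proof (cases "even (c' i)")
      case True
      then have "?x = c' i" using c' by simp
      then show ?thesis
        using x even_dist_lt_1[OF True False] by simp
    next
      case odd: False
      then have "\<bar>?x - c' i\<bar> \<le> 1" using c' by simp
      then have "\<bar>real (c i) - real (c' i)\<bar> < 2" using x by linarith
      then have "c i = c' i \<or> c i = c' i + 1 \<or> c i + 1 = c' i" by linarith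
      then show ?thesis
        using odd by blast
    qed
  qed
qed

lemma gcell_cover:
  assumes "t \<in> topspace (cube d)" "m > 0"
  obtains c where "c \<in> grid d m" "t \<in> gcell d m c"
proof -
  have "\<exists>a. a \<le> 2 * m \<and> \<bar>2 * real m * t i - real a\<bar> \<le> (if even a then 0 else 1)" if "i < d" for i
  \<comment> \<open>The half-open intervals of length 1 / m miss the right end, which is covered by
    the point coordinate 2m.\<close>
  proof (cases "t i = 1")
    case True
    then show ?thesis by (intro exI[of _ "2 * m"]) simp
  next
    case False
    then have t: "0 \<le> t i" "t i < 1"
      using assms(1) that by (auto simp: topspace_cube PiE_iff order.strict_iff_order)
    define j where "j = nat \<lfloor>m * t i\<rfloor>"
    have j: "real j \<le> m * t i" "m * t i < real j + 1"
      using t(1) by (auto simp: j_def)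
    moreover have "m * t i < m"
      using t(2) assms(2) by simp
    ultimately have "j < m" by linarith
    then show ?thesis
      using j by (intro exI[of _ "2 * j + 1"]) (auto simp: abs_le_iff)
  qed
  then obtain a where a: "\<And>i. i < d \<Longrightarrow> a i \<le> 2 * m \<and> \<bar>2 * real m * t i - real (a i)\<bar> \<le> (if even (a i) then 0 else 1)"
    by metis
  show thesis
    by (rule that[of "restrict a {..<d}"]) (use a assms(1) in \<open>auto simp: grid_def gcell_def\<close>)
qed

lemma gcell_nonempty:
  assumes "c \<in> grid d m" "m > 0"
  shows "gcell d m c \<noteq> {}"
proof -
  have "real (c i) \<le> 2 * real m" if "i < d" for i
    using assms(1) that unfolding grid_def by (metis PiE_mem atMost_iff lessThan_iff of_nat_le_iff of_nat_mult of_nat_numeral)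
  then have "restrict (\<lambda>i. real (c i) / (2 * m)) {..<d} \<in> gcell d m c"
    using assms(2) by (auto simp: gcell_def topspace_cube divide_simps)
  then show ?thesis by blast
qed

lemma closedin_gcell: "closedin (cube d) (gcell d m c)"
proof -
  have 1: "closedin (cube d) {t \<in> topspace (cube d). \<bar>2 * real m * t i - c i\<bar> \<in> {..(if even (c i) then 0 else 1)}}" if "i < d" for i
    using that by (intro closedin_continuous_map_preimage[of _ euclideanreal] continuous_map_real_abs continuous_map_diff
        continuous_map_real_mult continuous_map_cube_coord) auto
  have "{t \<in> T. \<forall>i<d. P t i} = T \<inter> (\<Inter>i\<in>{..<d}. {t \<in> T. P t i})" for T and P :: "(nat \<Rightarrow> real) \<Rightarrow> nat \<Rightarrow> bool"
    by auto
  then have "gcell d m c = topspace (cube d) \<inter> (\<Inter>i\<in>{..<d}. {t \<in> topspace (cube d). \<bar>2 * real m * t i - c i\<bar> \<in> {..(if even (c i) then 0 else 1)}})"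
    unfolding gcell_def atMost_iff .
  also have "closedin (cube d) \<dots>"
    by (cases "d = 0") (use 1 in \<open>auto intro!: closedin_Inter closedin_Int simp del: atMost_iff\<close>)
  finally show ?thesis .
qed

text \<open>A cell is affinely the cube of its dimension, boundary to boundary, so the filling is
  transported from that cube. In dimension 0 the cell is a point, for which \<open>fills\<close>
  provides a value.\<close>

lemma fill_gcell:
  assumes "fills (gdim d c) X Y" "m > 0" "c \<in> grid d m"
    and f: "continuous_map (subtopology (cube d) (gcell_boundary d m c)) X f"
  obtains g where "continuous_map (subtopology (cube d) (gcell d m c)) Y g"
    "\<And>t. t \<in> gcell_boundary d m c \<Longrightarrow> g t = f t"
proof -
  let ?k = "gdim d c" and ?S = "odd_coords d c"
  obtain \<beta> where \<beta>: "bij_betw \<beta> {..<?k} ?S"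
    using ex_bij_betw_nat_finite[of ?S] by (auto simp: atLeast0LessThan)
  define \<gamma> where "\<gamma> = inv_into {..<?k} \<beta>"
  have \<gamma>: "\<gamma> i < ?k" "\<beta> (\<gamma> i) = i" if "i \<in> ?S" for i
    using that \<beta> bij_betw_inv_into_right[OF \<beta>] bij_betw_inv_into[OF \<beta>] unfolding \<gamma>_def by (auto dest: bij_betwE)
  have \<gamma>\<beta>: "\<gamma> (\<beta> l) = l" "\<beta> l \<in> ?S" if "l < ?k" for l
    using that \<beta> bij_betw_inv_into_left[OF \<beta>] unfolding \<gamma>_def by (auto dest: bij_betwE)
  have S: "i \<in> ?S \<longleftrightarrow> i < d \<and> odd (c i)" for i
    by (auto simp: odd_coords_def)
  \<comment> \<open>\<open>\<beta>\<close> numbers the odd coordinates. \<open>\<eta>\<close> runs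
    through the interval of each of them, from (c - 1) / 2m to (c + 1) / 2m, and
    \<open>\<theta>\<close> is its inverse on the cell.\<close>
  define \<eta> where "\<eta> u = restrict (\<lambda>i. if i \<in> ?S then (real (c i) - 1 + 2 * u (\<gamma> i)) / (2 * real m) else real (c i) / (2 * real m)) {..<d}" for u :: "nat \<Rightarrow> real"
  define \<theta> where "\<theta> t = restrict (\<lambda>l. (2 * real m * t (\<beta> l) - real (c (\<beta> l)) + 1) / 2) {..<?k}" for t :: "nat \<Rightarrow> real"
  have c2m: "real (c i) \<le> 2 * real m" "odd (c i) \<Longrightarrow> real (c i) + 1 \<le> 2 * real m \<and> real (c i) \<ge> 1" if "i < d" for i
  proof -
    have "c i \<le> 2 * m"
      using assms(3) that by (auto simp: grid_def PiE_iff)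
    then show "real (c i) \<le> 2 * real m" by linarith
    assume "odd (c i)"
    then have "c i \<noteq> 2 * m" "c i \<ge> 1" by (auto simp: Suc_le_eq intro: Nat.gr0I)
    then show "real (c i) + 1 \<le> 2 * real m \<and> real (c i) \<ge> 1"
      using \<open>c i \<le> 2 * m\<close> by linarith
  qed
  have x\<eta>: "2 * real m * \<eta> u i = (if i \<in> ?S then real (c i) - 1 + 2 * u (\<gamma> i) else real (c i))" if "i < d" for u i
    using that assms(2) by (simp add: \<eta>_def)
  have \<eta>_cell: "\<eta> u \<in> gcell d m c" if u: "u \<in> topspace (cube ?k)" for u
  proof -
    have u01: "0 \<le> u (\<gamma> i)" "u (\<gamma> i) \<le> 1" if "i \<in> ?S" for i
      using u \<gamma>(1)[OF that] by (auto simp: topspace_cube PiE_iff)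
    have "0 \<le> 2 * real m * \<eta> u i \<and> 2 * real m * \<eta> u i \<le> 2 * real m" if "i < d" for i
      using x\<eta>[OF that, of u] c2m[OF that] u01[of i] S[of i] by auto
    then have "\<eta> u \<in> topspace (cube d)"
      using assms(2) by (auto simp: topspace_cube \<eta>_def[of u] zero_le_mult_iff)
    moreover have "\<bar>2 * real m * \<eta> u i - c i\<bar> \<le> (if even (c i) then 0 else 1)" if "i < d" for i
      using x\<eta>[OF that, of u] u01[of i] S[of i] that by (auto simp: abs_le_iff)
    ultimately show ?thesis
      by (simp add: gcell_def)
  qed
  have \<theta>_cube: "\<theta> t \<in> topspace (cube ?k)" if "t \<in> gcell d m c" for t
  proof -
    have "\<bar>2 * real m * t (\<beta> l) - c (\<beta> l)\<bar> \<le> 1" if "l < ?k" for l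
      using \<gamma>\<beta>[OF that] \<open>t \<in> gcell d m c\<close> S[of "\<beta> l"] by (auto simp: gcell_def split: if_splits)
    then have "0 \<le> \<theta> t l \<and> \<theta> t l \<le> 1" if "l < ?k" for l
      using that by (fastforce simp: \<theta>_def abs_le_iff)
    then show ?thesis
      by (auto simp: topspace_cube \<theta>_def[of t])
  qed
  have \<eta>\<theta>: "\<eta> (\<theta> t) = t" if t: "t \<in> gcell d m c" for t
  proof
    fix i
    show "\<eta> (\<theta> t) i = t i"
    proof (cases "i < d")
      case True
      have "2 * real m * \<eta> (\<theta> t) i = 2 * real m * t i"
      proof (cases "i \<in> ?S")
        case iS: True
        have "\<theta> t (\<gamma> i) = (2 * real m * t i - real (c i) + 1) / 2"
          using \<gamma>[OF iS] by (simp add: \<theta>_def)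
        then show ?thesis
          using x\<eta>[OF True, of "\<theta> t"] iS by (simp add: field_simps)
      next
        case False
        then have "even (c i)"
          using S[of i] True by blast
        moreover have "\<bar>2 * real m * t i - real (c i)\<bar> \<le> (if even (c i) then 0 else 1)"
          using t True unfolding gcell_def by blast
        ultimately show ?thesis
          using x\<eta>[OF True, of "\<theta> t"] False by simp
      qed
      then show ?thesis
        using assms(2) by simp
    next
      case False
      then show ?thesis
        using t by (auto simp: \<eta>_def gcell_def topspace_cube PiE_iff extensional_def)
    qed
  qed
  have \<eta>_boundary: "\<eta> u \<in> gcell_boundary d m c" if u: "u \<in> cube_boundary ?k" for u
  proof -
    obtain l where l: "l < ?k" "u l = 0 \<or> u l = 1"
      using u by (auto simp: cube_boundary_def)
    have bl: "\<beta> l < d" "odd (c (\<beta> l))"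
      using \<gamma>\<beta>(2)[OF l(1)] S by auto
    have "2 * real m * \<eta> u (\<beta> l) = real (c (\<beta> l)) - 1 + 2 * u l"
      using x\<eta>[OF bl(1), of u] \<gamma>\<beta>[OF l(1)] by simp
    then have "\<bar>2 * real m * \<eta> u (\<beta> l) - c (\<beta> l)\<bar> = 1"
      using l(2) by (elim disjE) simp_all
    moreover have "\<eta> u \<in> gcell d m c"
      by (rule \<eta>_cell[OF subsetD[OF cube_boundary_subset u]])
    ultimately show ?thesis
      unfolding gcell_boundary_def by (intro CollectI conjI exI[of _ "\<beta> l"] bl)
  qed
  have \<theta>_boundary: "\<theta> t \<in> cube_boundary ?k" if t: "t \<in> gcell_boundary d m c" for t
  proof -
    obtain i where i: "i \<in> ?S" "\<bar>2 * real m * t i - c i\<bar> = 1" and tc: "t \<in> gcell d m c"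
      using t S by (auto simp: gcell_boundary_def)
    have "\<theta> t (\<gamma> i) = (2 * m * t i - c i + 1) / 2"
      using \<gamma>[OF i(1)] by (simp add: \<theta>_def)
    moreover have "2 * m * t i - c i = 1 \<or> 2 * m * t i - c i = - 1"
      using i(2) by linarith
    ultimately have "\<theta> t (\<gamma> i) = 0 \<or> \<theta> t (\<gamma> i) = 1"
      by auto
    then show ?thesis
      using \<theta>_cube[OF tc] \<gamma>(1)[OF i(1)] by (auto simp: cube_boundary_def)
  qed
  have "continuous_map (cube ?k) (cube d) \<eta>"
    unfolding continuous_map_cube
  proof (intro conjI ballI allI impI)
    show "\<eta> u \<in> topspace (cube d)" if "u \<in> topspace (cube ?k)" for u
      using \<eta>_cell[OF that] by (simp add: gcell_def)
    show "continuous_map (cube ?k) euclideanreal (\<lambda>u. \<eta> u i)" if "i < d" for i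
    proof (cases "i \<in> ?S")
      case True
      then show ?thesis
        using that assms(2) \<gamma>(1)[OF True] unfolding \<eta>_def
        by (auto intro!: continuous_map_real_divide continuous_map_add continuous_map_real_mult continuous_map_cube_coord)
    qed (use that in \<open>simp add: \<eta>_def\<close>)
  qed
  then have "continuous_map (subtopology (cube ?k) (cube_boundary ?k)) (subtopology (cube d) (gcell_boundary d m c)) \<eta>"
    using \<eta>_boundary by (auto simp: continuous_map_in_subtopology intro: continuous_map_from_subtopology)
  from continuous_map_compose[OF this f]
  obtain h where h: "continuous_map (cube ?k) Y h" "\<And>u. u \<in> cube_boundary ?k \<Longrightarrow> h u = f (\<eta> u)"
    using assms(1) unfolding fills_def by (metis comp_apply)
  have "continuous_map (subtopology (cube d) (gcell d m c)) (cube ?k) \<theta>"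
    unfolding continuous_map_cube
  proof (intro conjI ballI allI impI)
    show "\<theta> t \<in> topspace (cube ?k)" if "t \<in> topspace (subtopology (cube d) (gcell d m c))" for t
      using \<theta>_cube that by simp
    show "continuous_map (subtopology (cube d) (gcell d m c)) euclideanreal (\<lambda>t. \<theta> t l)" if "l < ?k" for l
      using that \<gamma>\<beta>(2)[OF that] S[of "\<beta> l"] unfolding \<theta>_def
      by (auto intro!: continuous_map_real_divide continuous_map_add continuous_map_diff continuous_map_real_mult
          continuous_map_from_subtopology continuous_map_cube_coord)
  qed
  from continuous_map_compose[OF this h(1)]
  have "continuous_map (subtopology (cube d) (gcell d m c)) Y (h \<circ> \<theta>)" .
  moreover have "(h \<circ> \<theta>) t = f t" if "t \<in> gcell_boundary d m c" for t
    using h(2)[OF \<theta>_boundary[OF that]] \<eta>\<theta>[of t] that by (simp add: gcell_boundary_def)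
  ultimately show thesis
    by (rule that)
qed

text \<open>A coordinate 0 or 1 becomes 0 or 2m after scaling. Both are even, so at an interior
  point the coordinate of the cell cannot be odd there; it is even, and the corresponding coordinate
  is constant on the cell.\<close>

lemma gcell_subset_boundary:
  assumes "t \<in> gcell d m c" "t \<notin> gcell_boundary d m c" "t \<in> cube_boundary d" "m > 0"
  shows "gcell d m c \<subseteq> cube_boundary d"
proof -
  obtain i where i: "i < d" "t i = 0 \<or> t i = 1"
    using assms(3) by (auto simp: cube_boundary_def)
  have ci: "\<bar>2 * real m * t i - c i\<bar> \<le> (if even (c i) then 0 else 1)" "odd (c i) \<Longrightarrow> \<bar>2 * real m * t i - c i\<bar> \<noteq> 1"
    using assms(1,2) i(1) unfolding gcell_def gcell_boundary_def by blast+
  have "even (c i)"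
  proof (rule ccontr)
    assume odd: "odd (c i)"
    then have "\<bar>2 * real m * t i - c i\<bar> < 1" using ci by simp
    moreover have "2 * real m * t i = real 0 \<or> 2 * real m * t i = real (2 * m)" using i(2) by auto
    ultimately show False
      using even_dist_lt_1[of 0 "c i"] even_dist_lt_1[of "2 * m" "c i"] odd by auto
  qed
  then have c: "2 * real m * t i = real (c i)" using ci by simp
  show ?thesis
  proof
    fix s assume s: "s \<in> gcell d m c"
    then have "2 * real m * s i = 2 * real m * t i"
      using c i(1) \<open>even (c i)\<close> by (auto simp: gcell_def)
    moreover have "s \<in> topspace (cube d)"
      using s by (simp add: gcell_def)
    ultimately show "s \<in> cube_boundary d"
      using i assms(4) by (auto simp: cube_boundary_def)
  qed
qed

text \<open>Cellular extension with control: \<open>A c\<close> is where the cell \<open>c\<close>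
  has to go, \<open>B c\<close> is a region known to contain the images of its proper faces, and
  spheres in \<open>B c\<close> fill in \<open>A c\<close>. Cells inside the boundary of the cube
  keep the prescribed values.\<close>

lemma grid_extension:
  assumes m: "m > 0"
    and fill: "\<And>c. c \<in> grid d m \<Longrightarrow> fills (gdim d c) (subtopology W (B c)) (subtopology W (A c))"
    and mono: "\<And>c c'. c \<in> grid d m \<Longrightarrow> c' \<in> grid d m \<Longrightarrow> gface d c' c \<Longrightarrow> c' \<noteq> c \<Longrightarrow> A c' \<subseteq> B c"
    and f0: "continuous_map (subtopology (cube d) (cube_boundary d)) W f0"
    and bd: "\<And>c t. c \<in> grid d m \<Longrightarrow> gcell d m c \<subseteq> cube_boundary d \<Longrightarrow> t \<in> gcell d m c \<Longrightarrow> f0 t \<in> A c"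
  obtains f where "continuous_map (cube d) W f" "\<And>t. t \<in> cube_boundary d \<Longrightarrow> f t = f0 t"
    "\<And>c t. c \<in> grid d m \<Longrightarrow> t \<in> gcell d m c \<Longrightarrow> f t \<in> A c"
proof -
  let ?U = "\<lambda>L. cube_boundary d \<union> (\<Union>c\<in>L. gcell d m c)"
  have sub: "gcell d m c \<subseteq> topspace (cube d)" for c
    by (auto simp: gcell_def)
  \<comment> \<open>The induction runs over sets of cells that are closed under faces, by their
    number.\<close>
  have "\<exists>f. continuous_map (subtopology (cube d) (?U L)) W f \<and> (\<forall>t\<in>cube_boundary d. f t = f0 t) \<and>
      (\<forall>c\<in>L. \<forall>t\<in>gcell d m c. f t \<in> A c)"
    if "L \<subseteq> grid d m" "\<And>c c'. c \<in> L \<Longrightarrow> c' \<in> grid d m \<Longrightarrow> gface d c' c \<Longrightarrow> c' \<in> L" for L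
    using that
  proof (induction "card L" arbitrary: L)
    case 0
    then have "L = {}"
      using finite_subset[OF _ finite_grid] by auto
    then show ?case
      using f0 by auto
  next
    case (Suc n)
    have fin: "finite L"
      using Suc.prems(1) finite_grid by (rule finite_subset)
    have "L \<noteq> {}"
      using Suc.hyps(2) by auto
    \<comment> \<open>A cell of maximal dimension is not a face of another cell of \<open>L\<close>,
      so removing it leaves a set closed under faces.\<close>
    then have "Max (gdim d ` L) \<in> gdim d ` L"
      using fin by (intro Max_in) auto
    then obtain c where c: "c \<in> L" "gdim d c = Max (gdim d ` L)"
      by force
    have c_max: "gdim d c' \<le> gdim d c" if "c' \<in> L" for c'
      unfolding c(2) using fin that by (intro Max_ge) auto
    have cg: "c \<in> grid d m"
      using c(1) Suc.prems(1) by blast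
    let ?L = "L - {c}" and ?D = "?U (L - {c})"
    have not_face: "\<not> gface d c c'" if "c' \<in> ?L" for c'
    proof
      assume "gface d c c'"
      then have "gdim d c < gdim d c'"
        using that Suc.prems(1) cg by (intro gface_dim_less[of d c c' m]) auto
      then show False
        using c_max[of c'] that by simp
    qed
    have "n = card ?L"
      using Suc.hyps(2) c(1) fin by simp
    moreover have "?L \<subseteq> grid d m"
      using Suc.prems(1) by blast
    moreover have "c'' \<in> ?L" if "c' \<in> ?L" "c'' \<in> grid d m" "gface d c'' c'" for c' c''
      using Suc.prems(2)[of c' c''] not_face[OF that(1)] that by blast
    ultimately obtain f where f: "continuous_map (subtopology (cube d) ?D) W f" "\<And>t. t \<in> cube_boundary d \<Longrightarrow> f t = f0 t"
      "\<And>c' t. c' \<in> ?L \<Longrightarrow> t \<in> gcell d m c' \<Longrightarrow> f t \<in> A c'"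
      using Suc.hyps(1)[of ?L] by blast
    have UL: "?U L = ?D \<union> gcell d m c"
      using c(1) by blast
    show ?case
    proof (cases "gcell d m c \<subseteq> cube_boundary d")
      case True
      then have "?U L = ?D"
        using UL by blast
      moreover have "f t \<in> A c'" if "c' \<in> L" "t \<in> gcell d m c'" for c' t
        using f(2)[of t] f(3)[of c' t] bd[OF cg True] True that by (cases "c' = c") auto
      ultimately show ?thesis
        using f by auto
    next
      case False
      have faces: "\<exists>c'\<in>?L. t \<in> gcell d m c' \<and> A c' \<subseteq> B c" if t: "t \<in> gcell_boundary d m c" for t
      proof -
        obtain c' where c': "c' \<in> grid d m" "gface d c' c" "c' \<noteq> c" "t \<in> gcell d m c'"
          by (rule gcell_boundary_face[OF t cg])
        then show ?thesis
          using Suc.prems(2)[OF c(1) c'(1,2)] mono[OF cg c'(1-3)] by blast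
      qed
      have bD: "gcell_boundary d m c \<subseteq> ?D"
        using faces by blast
      have fB: "f t \<in> B c" if "t \<in> gcell_boundary d m c" for t
        using faces[OF that] f(3) by blast
      \<comment> \<open>The new cell meets the domain of \<open>f\<close> only in its boundary, so
        \<open>f\<close> and the filling can be pasted.\<close>
      have Db: "t \<in> gcell_boundary d m c" if tD: "t \<in> ?D" and tc: "t \<in> gcell d m c" for t
      proof (rule ccontr)
        assume nb: "t \<notin> gcell_boundary d m c"
        then have "t \<notin> cube_boundary d"
          using gcell_subset_boundary[OF tc nb _ m] False by blast
        then obtain c' where "c' \<in> ?L" "t \<in> gcell d m c'"
          using tD by blast
        then show False
          using gcell_interior_face[OF tc nb] not_face by blast
      qed
      have "continuous_map (subtopology (cube d) (gcell_boundary d m c)) (subtopology W (B c)) f"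
        using continuous_map_from_subtopology_mono[OF f(1) bD] fB by (auto simp: continuous_map_in_subtopology)
      then obtain g where g: "continuous_map (subtopology (cube d) (gcell d m c)) (subtopology W (A c)) g"
        "\<And>t. t \<in> gcell_boundary d m c \<Longrightarrow> g t = f t"
        using fill_gcell[OF fill[OF cg] m cg] by metis
      have gA: "g t \<in> A c" if "t \<in> gcell d m c" for t
        using continuous_map_in[OF g(1), of t] that sub by auto
      let ?f = "\<lambda>t. if t \<in> ?D then f t else g t"
      have "continuous_map (subtopology (cube d) (?U L)) W ?f"
        unfolding UL
      proof (rule continuous_map_paste[where T = "gcell d m c"])
        have clD: "closedin (cube d) ?D"
          using finite_subset[OF \<open>?L \<subseteq> grid d m\<close> finite_grid]
          by (intro closedin_Un closedin_cube_boundary closedin_Union) (auto intro: closedin_gcell)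
        show "closedin (subtopology (cube d) (?D \<union> gcell d m c)) ?D"
          "closedin (subtopology (cube d) (?D \<union> gcell d m c)) (gcell d m c)"
          using clD closedin_gcell[of d m c]
          by (simp_all add: closedin_closed_subtopology[OF closedin_Un])
        have "?D \<union> gcell d m c \<inter> ?D = ?D" "(?D \<union> gcell d m c) \<inter> gcell d m c = gcell d m c"
          by blast+
        then show "continuous_map (subtopology (subtopology (cube d) (?D \<union> gcell d m c)) ?D) W f"
          "continuous_map (subtopology (subtopology (cube d) (?D \<union> gcell d m c)) (gcell d m c)) W g"
          using f(1) g(1) by (simp_all add: subtopology_subtopology continuous_map_in_subtopology Int_absorb1)
      qed (use Db g(2) in auto)
      moreover have "?f t \<in> A c'" if "c' \<in> L" "t \<in> gcell d m c'" for c' t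
      proof (cases "c' = c")
        case True
        then show ?thesis
          using that gA[of t] g(2)[of t] Db[of t] by (cases "t \<in> ?D") (simp_all only: if_True if_False)
      next
        case False
        then show ?thesis
          using that f(3) by auto
      qed
      ultimately show ?thesis
        using f(2) by auto
    qed
  qed
  from this[of "grid d m"] obtain f where f: "continuous_map (subtopology (cube d) (?U (grid d m))) W f"
    "\<And>t. t \<in> cube_boundary d \<Longrightarrow> f t = f0 t" "\<And>c t. c \<in> grid d m \<Longrightarrow> t \<in> gcell d m c \<Longrightarrow> f t \<in> A c"
    by blast
  have "?U (grid d m) = topspace (cube d)"
  proof (intro subset_antisym subsetI)
    fix t assume "t \<in> topspace (cube d)"
    then show "t \<in> ?U (grid d m)"
      using gcell_cover[OF _ m] by (metis UN_I UnI2)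
  next
    fix t assume "t \<in> ?U (grid d m)"
    then show "t \<in> topspace (cube d)"
      using cube_boundary_subset[of d] sub by auto
  qed
  then show thesis
    using f that by simp
qed

section \<open>Grids subordinate to an open cover\<close>

lemma openin_cube_box:
  assumes "openin (cube d) U" "t \<in> U"
  obtains e where "e > 0" "\<And>s. s \<in> topspace (cube d) \<Longrightarrow> (\<And>i. i < d \<Longrightarrow> \<bar>s i - t i\<bar> < e) \<Longrightarrow> s \<in> U"
proof -
  obtain V where V: "\<And>i. i < d \<Longrightarrow> openin I01 (V i)" "t \<in> PiE {..<d} V" "PiE {..<d} V \<subseteq> U"
    using assms unfolding cube_def openin_product_topology_alt by (metis lessThan_iff)
  have "\<exists>e>0. \<forall>y\<in>{0..1}. \<bar>y - t i\<bar> < e \<longrightarrow> y \<in> V i" if "i < d" for i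
  proof -
    have "t i \<in> V i"
      using V(2) that by (auto simp: PiE_iff)
    then show ?thesis
      using V(1)[OF that] unfolding openin_euclidean_subtopology_iff by (auto simp: dist_real_def)
  qed
  then obtain e where e: "\<And>i. i < d \<Longrightarrow> e i > 0" "\<And>i y. i < d \<Longrightarrow> y \<in> {0..1} \<Longrightarrow> \<bar>y - t i\<bar> < e i \<Longrightarrow> y \<in> V i"
    by metis
  show thesis
  proof (rule that[of "Min (insert 1 (e ` {..<d}))"])
    show "0 < Min (insert 1 (e ` {..<d}))"
      using e(1) by (subst Min_gr_iff) auto
    fix s assume s: "s \<in> topspace (cube d)" "\<And>i. i < d \<Longrightarrow> \<bar>s i - t i\<bar> < Min (insert 1 (e ` {..<d}))"
    have "s i \<in> V i" if "i < d" for i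
      using s(1) s(2)[OF that] that by (intro e(2)) (auto simp: topspace_cube PiE_iff)
    then have "s \<in> PiE {..<d} V"
      using s(1) by (auto simp: topspace_cube PiE_iff)
    then show "s \<in> U"
      using V(3) by blast
  qed
qed

lemma compact_space_cube: "compact_space (cube d)"
  unfolding cube_def by (auto simp: compact_space_product_topology compact_space_subtopology)

text \<open>A Lebesgue number argument in the sup norm: finitely many boxes cover the cube, and any
  two points of a cell differ by at most 1 / m in each coordinate.\<close>

lemma grid_fine:
  assumes "\<And>U. U \<in> \<U> \<Longrightarrow> openin (cube d) U" "topspace (cube d) \<subseteq> \<Union>\<U>"
  obtains m where "m > 0" "\<And>c. c \<in> grid d m \<Longrightarrow> \<exists>U\<in>\<U>. gcell d m c \<subseteq> U"
proof -
  \<comment> \<open>The cover uses boxes of half the admissible radius, so that a cell meeting a box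
    still lies in the box of twice its radius.\<close>
  have "\<exists>U e. U \<in> \<U> \<and> e > 0 \<and> (\<forall>s\<in>topspace (cube d). (\<forall>i<d. \<bar>s i - t i\<bar> < 2 * e) \<longrightarrow> s \<in> U)"
    if t: "t \<in> topspace (cube d)" for t
  proof -
    obtain U where U: "U \<in> \<U>" "t \<in> U"
      using t assms(2) by blast
    obtain e where "e > 0" "\<And>s. s \<in> topspace (cube d) \<Longrightarrow> (\<And>i. i < d \<Longrightarrow> \<bar>s i - t i\<bar> < e) \<Longrightarrow> s \<in> U"
      using openin_cube_box[OF assms(1)[OF U(1)] U(2)] by blast
    then show ?thesis
      using U(1) by (intro exI[of _ U] exI[of _ "e / 2"]) auto
  qed
  then obtain U e where Ue: "\<And>t. t \<in> topspace (cube d) \<Longrightarrow> U t \<in> \<U> \<and> e t > 0 \<and>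
      (\<forall>s\<in>topspace (cube d). (\<forall>i<d. \<bar>s i - t i\<bar> < 2 * e t) \<longrightarrow> s \<in> U t)"
    by metis
  define box where "box t = {s \<in> topspace (cube d). \<forall>i\<in>{..<d}. \<bar>s i - t i\<bar> < e t}" for t
  have "openin (cube d) (box t)" for t
  proof -
    have 1: "openin (cube d) {s \<in> topspace (cube d). \<bar>s i - t i\<bar> \<in> {..<e t}}" if "i < d" for i
      using that by (intro openin_continuous_map_preimage[of _ euclideanreal] continuous_map_real_abs continuous_map_diff
          continuous_map_cube_coord) auto
    have "box t = topspace (cube d) \<inter> (\<Inter>i\<in>{..<d}. {s \<in> topspace (cube d). \<bar>s i - t i\<bar> < e t})"
      by (auto simp: box_def)
    also have "openin (cube d) \<dots>"
      using 1 by (cases "d = 0") (auto intro!: openin_Inter openin_Int)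
    finally show ?thesis .
  qed
  moreover have "topspace (cube d) \<subseteq> \<Union>(box ` topspace (cube d))"
    using Ue by (auto simp: box_def)
  ultimately obtain \<F> where F: "finite \<F>" "\<F> \<subseteq> box ` topspace (cube d)" "topspace (cube d) \<subseteq> \<Union>\<F>"
    using compact_space_cube[of d] unfolding compact_space_alt by (metis (no_types, lifting) image_iff)
  then obtain T where T: "finite T" "T \<subseteq> topspace (cube d)" "\<F> = box ` T"
    by (meson finite_subset_image)
  define \<delta> where "\<delta> = Min (insert 1 (e ` T))"
  have \<delta>: "\<delta> > 0" "\<And>t. t \<in> T \<Longrightarrow> \<delta> \<le> e t"
    using T Ue unfolding \<delta>_def by (auto intro!: Min_le)
  obtain m where m: "m > 0" "1 / real m < \<delta>"
    using ex_inverse_of_nat_less[OF \<delta>(1)] by (auto simp: inverse_eq_divide)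
  show thesis
  proof (rule that[OF m(1)])
    fix c assume c: "c \<in> grid d m"
    obtain t where t: "t \<in> gcell d m c"
      using gcell_nonempty[OF c m(1)] by blast
    then obtain s where s: "s \<in> T" "t \<in> box s"
      using F(3) T(3) by (auto simp: gcell_def)
    have "gcell d m c \<subseteq> U s"
    proof
      fix t' assume t': "t' \<in> gcell d m c"
      have "\<bar>t' i - s i\<bar> < 2 * e s" if i: "i < d" for i
      proof -
        have "\<bar>2 * real m * t i - c i\<bar> \<le> 1" "\<bar>2 * real m * t' i - c i\<bar> \<le> 1"
          using t t' i by (auto simp: gcell_def split: if_splits)
        then have "\<bar>2 * real m * t' i - 2 * real m * t i\<bar> \<le> 2"
          by linarith
        then have "2 * real m * \<bar>t' i - t i\<bar> \<le> 2"
          by (simp add: abs_mult flip: right_diff_distrib)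
        then have "\<bar>t' i - t i\<bar> \<le> 1 / m"
          using m(1) by (simp add: field_simps)
        then have "\<bar>t' i - t i\<bar> < e s"
          using m(2) \<delta>(2)[OF s(1)] by linarith
        moreover have "\<bar>t i - s i\<bar> < e s"
          using s(2) i by (auto simp: box_def)
        ultimately show ?thesis by linarith
      qed
      then show "t' \<in> U s"
        using Ue[of s] s(1) T(2) t' by (auto simp: gcell_def)
    qed
    then show "\<exists>U\<in>\<U>. gcell d m c \<subseteq> U"
      using Ue s(1) T(2) by blast
  qed
qed

section \<open>Filtrations by translates\<close>

lemma continuous_map_supp_space:
  "continuous_map X (supp_space L K) f \<longleftrightarrow>
    continuous_map X (realization (vset_sset L)) f \<and> (\<forall>x\<in>topspace X. K (supp (f x)))"
  by (auto simp: continuous_map_in_subtopology)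

lemma rmap_rmap:
  assumes "vertex_map L K \<phi>" "vertex_map K M \<psi>" "c \<in> topspace (realization (vset_sset L))"
  shows "rmap M \<psi> (rmap K \<phi> c) = rmap M (\<psi> \<circ> \<phi>) c"
proof -
  interpret \<phi>: vertex_map L K \<phi> by fact
  interpret \<psi>: vertex_map K M \<psi> by fact
  interpret \<psi>\<phi>: vertex_map L M "\<psi> \<circ> \<phi>"
  proof
    fix F assume "L F"
    then show "M ((\<psi> \<circ> \<phi>) ` F)"
      using \<psi>.K_image[OF \<phi>.K_image] by (simp only: image_comp)
  qed
  from assms(3) show ?thesis
    by (rule realization_pointE) simp
qed

lemma rmap_id:
  assumes "\<And>x. L {x} \<Longrightarrow> \<phi> x = x" "hereditary L" "c \<in> topspace (realization (vset_sset L))"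
  shows "rmap L \<phi> c = c"
proof -
  have *: "\<phi> x = x" if "L F" "x \<in> F" for x F
    using assms(1) hereditaryD[OF assms(2) that(1), of "{x}"] that(2) by auto
  interpret vertex_map L L \<phi>
  proof
    fix F assume "L F"
    then show "L (\<phi> ` F)"
      using *[of F] by simp
  qed
  obtain n xs t where c: "length xs = Suc n" "L (set xs)" "c = realization_point (vset_sset L) ((n, xs), t)"
    using assms(3) by (auto elim!: realization_pointE)
  then show ?thesis
    using *[OF c(2)] by (simp add: map_idI)
qed

text \<open>A list of n + 1 equal vertices is an iterated degeneracy of that vertex, so all its
  points are identified with it.\<close>

lemma rmap_const:
  assumes "hereditary L" "L {v}" "c \<in> topspace (realization (vset_sset K))"
  shows "rmap L (\<lambda>_. v) c = vertex L v"
proof -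
  have L: "L F" if "F \<subseteq> {v}" for F
    using hereditaryD[OF assms(1,2) that] .
  interpret vertex_map K L "\<lambda>_. v"
    by unfold_locales (rule L, auto)
  obtain n xs t where c: "length xs = Suc n" "t \<in> standard_simplex n" "c = realization_point (vset_sset K) ((n, xs), t)"
    using assms(3) by (auto elim!: realization_pointE)
  have "realization_point (vset_sset L) ((n, replicate (Suc n) v), t) = vertex L v"
    using c(2)
  proof (induction n arbitrary: t)
    case 0
    then show ?case
      by (simp add: standard_simplex_0 vertex_point_def)
  next
    case (Suc n)
    have "double_at 0 (replicate (Suc n) v) = replicate (Suc (Suc n)) v"
      by (simp add: double_at_def)
    moreover have "L (set (replicate (Suc n) v))"
      by (rule L) auto
    ultimately have "realization_point (vset_sset L) ((Suc n, replicate (Suc (Suc n)) v), t)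
      = realization_point (vset_sset L) ((n, replicate (Suc n) v), simplicial_codegen 0 t)"
      using realization_point_degen[of "replicate (Suc n) v" n L 0 t] Suc.prems by simp
    also have "\<dots> = vertex L v"
      by (rule Suc.IH) (use Suc.prems in \<open>auto intro: simplicial_codegen_mem\<close>)
    finally show ?case .
  qed
  moreover have "map (\<lambda>_. v) xs = replicate (Suc n) v"
    using c(1) by (simp add: map_replicate_const)
  ultimately show ?thesis
    by (simp only: c(3) rmap_point)
qed

section \<open>The realization of E S: induced maps, contiguity and cones\<close>

abbreviation ES :: "'a set \<Rightarrow> 'a list spt set topology" where
  "ES S \<equiv> realization (vset_sset (\<lambda>F. F \<subseteq> S))"

abbreviation vmap :: "'b set \<Rightarrow> ('a \<Rightarrow> 'b) \<Rightarrow> 'a list spt set \<Rightarrow> 'b list spt set" where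
  "vmap S \<equiv> rmap (\<lambda>F. F \<subseteq> S)"

abbreviation vtx :: "'a set \<Rightarrow> 'a \<Rightarrow> 'a list spt set" where
  "vtx S \<equiv> vertex (\<lambda>F. F \<subseteq> S)"

abbreviation sspace :: "'a set \<Rightarrow> ('a set \<Rightarrow> bool) \<Rightarrow> 'a list spt set topology" where
  "sspace S K \<equiv> supp_space (\<lambda>F. F \<subseteq> S) K"

lemma hereditary_subset [simp]: "hereditary (\<lambda>F. F \<subseteq> S)"
  by (auto simp: hereditary_def)

lemma vertex_map_subset: "\<phi> \<in> S \<rightarrow> S' \<Longrightarrow> vertex_map (\<lambda>F. F \<subseteq> S) (\<lambda>F. F \<subseteq> S') \<phi>"
  by unfold_locales auto

lemmas continuous_map_vmap = vertex_map.continuous_map_rmap[OF vertex_map_subset]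
lemmas supp_vmap = vertex_map.supp_rmap[OF vertex_map_subset]
lemmas vmap_vtx = rmap_vertex[OF vertex_map_subset]
lemmas vmap_vmap = rmap_rmap[OF vertex_map_subset vertex_map_subset]

lemma supp_ES: "c \<in> topspace (ES S) \<Longrightarrow> finite (supp c) \<and> supp c \<noteq> {} \<and> supp c \<subseteq> S"
  using supp_props[of c "\<lambda>F. F \<subseteq> S"] by simp

lemma vmap_id: "(\<And>x. x \<in> S \<Longrightarrow> \<phi> x = x) \<Longrightarrow> c \<in> topspace (ES S) \<Longrightarrow> vmap S \<phi> c = c"
  by (rule rmap_id) auto

lemma vmap_const: "v \<in> S \<Longrightarrow> c \<in> topspace (ES S') \<Longrightarrow> vmap S (\<lambda>_. v) c = vtx S v"
  by (rule rmap_const) auto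

lemma continuous_map_vmap_sspace:
  assumes "\<phi> \<in> S \<rightarrow> S'" "\<And>F. F \<subseteq> S \<Longrightarrow> K F \<Longrightarrow> K' (\<phi> ` F)"
  shows "continuous_map (sspace S K) (sspace S' K') (vmap S' \<phi>)"
  unfolding continuous_map_supp_space
proof (intro conjI ballI continuous_map_from_subtopology continuous_map_vmap assms(1))
  fix c assume "c \<in> topspace (sspace S K)"
  then have c: "c \<in> topspace (ES S)" "K (supp c)"
    by auto
  then show "K' (supp (vmap S' \<phi> c))"
    using assms(2)[of "supp c"] supp_ES[OF c(1)] by (simp add: supp_vmap[OF assms(1)])
qed

text \<open>The track of a point only involves the images of its support under both vertex maps,
  hence the condition on their union.\<close>

lemma homotopic_contiguous:
  assumes f: "continuous_map Z (ES S) f" and \<phi>: "\<phi> \<in> S \<rightarrow> S'" and \<psi>: "\<psi> \<in> S \<rightarrow> S'"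
    and K: "hereditary K" "\<And>z. z \<in> topspace Z \<Longrightarrow> K (\<phi> ` supp (f z) \<union> \<psi> ` supp (f z))"
  shows "homotopic_with (\<lambda>_. True) Z (sspace S' K) (vmap S' \<phi> \<circ> f) (vmap S' \<psi> \<circ> f)"
proof -
  interpret contiguous_maps "\<lambda>F. F \<subseteq> S" "\<lambda>F. F \<subseteq> S'" \<phi> \<psi>
    using \<phi> \<psi> by unfold_locales auto
  let ?h = "\<lambda>(s, z). rjoin (\<lambda>F. F \<subseteq> S') \<phi> \<psi> s (f z)"
  have fz: "f z \<in> topspace (ES S)" if "z \<in> topspace Z" for z
    using continuous_map_in[OF f that] .
  have "continuous_map (prod_topology I01 Z) (prod_topology I01 (ES S)) (\<lambda>x. (fst x, f (snd x)))"
    by (intro continuous_map_pairedI continuous_map_fst continuous_map_prod_snd f)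
  from continuous_map_compose[OF this continuous_map_rjoin]
  have "continuous_map (prod_topology I01 Z) (ES S') ?h"
    by (simp add: o_def case_prod_unfold)
  moreover have "K (supp (?h x))" if "x \<in> topspace (prod_topology I01 Z)" for x
  proof -
    have "snd x \<in> topspace Z" "fst x \<in> {0..1}"
      using that by auto
    then show ?thesis
      using hereditaryD[OF K(1) K(2)[of "snd x"]] supp_rjoin[OF fz] by (simp add: case_prod_unfold)
  qed
  ultimately have "continuous_map (prod_topology I01 Z) (sspace S' K) ?h"
    unfolding continuous_map_supp_space by blast
  then show ?thesis
    using fz by (subst homotopic_with) (auto simp: rjoin_0 rjoin_1 intro!: exI[of _ ?h])
qed

text \<open>The identity and the constant vertex map \<open>v\<close> are contiguous: this is the
  cone with apex \<open>v\<close>.\<close>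

lemma homotopic_cone:
  assumes f: "continuous_map Z (ES S) f" and v: "v \<in> S"
    and K: "hereditary K" "\<And>z. z \<in> topspace Z \<Longrightarrow> K (insert v (supp (f z)))"
  shows "homotopic_with (\<lambda>_. True) Z (sspace S K) f (\<lambda>_. vtx S v)"
proof -
  have "homotopic_with (\<lambda>_. True) Z (sspace S K) (vmap S (\<lambda>x. x) \<circ> f) (vmap S (\<lambda>_. v) \<circ> f)"
  proof (rule homotopic_contiguous[OF f])
    show "K ((\<lambda>x. x) ` supp (f z) \<union> (\<lambda>_. v) ` supp (f z))" if "z \<in> topspace Z" for z
      by (rule hereditaryD[OF K(1) K(2)[OF that]]) auto
  qed (use v K(1) in auto)
  then show ?thesis
    by (rule homotopic_with_eq) (use continuous_map_in[OF f] vmap_const[OF v continuous_map_in[OF f]] in \<open>simp_all add: vmap_id\<close>)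
qed

text \<open>The full simplex on \<open>S'\<close> is a cone over each of its vertices, so every
  sphere in it bounds there.\<close>

lemma fills_simplex:
  assumes "S' \<subseteq> S" "S' \<noteq> {}"
  shows "fills k (sspace S (\<lambda>F. F \<subseteq> S')) (sspace S (\<lambda>F. F \<subseteq> S'))"
  unfolding fills_def
proof (intro allI impI)
  fix f assume f: "continuous_map (subtopology (cube k) (cube_boundary k)) (sspace S (\<lambda>F. F \<subseteq> S')) f"
  obtain v where v: "v \<in> S'"
    using assms(2) by blast
  have h1: "homotopic_with (\<lambda>_. True) (subtopology (cube k) (cube_boundary k)) (sspace S (\<lambda>F. F \<subseteq> S')) f (\<lambda>_. vtx S v)"
    using f v assms(1) by (intro homotopic_cone) (auto simp: continuous_map_in_subtopology)
  have h2: "vtx S v \<in> topspace (sspace S (\<lambda>F. F \<subseteq> S'))"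
    using vertex_in[of "\<lambda>F. F \<subseteq> S" v] v assms(1) by auto
  show "\<exists>g. continuous_map (cube k) (sspace S (\<lambda>F. F \<subseteq> S')) g \<and> (\<forall>t\<in>cube_boundary k. g t = f t)"
    by (rule nullhomotopic_extends_cube[OF h1 h2]) blast
qed

section \<open>Translates of compact sets as conditions on supports\<close>

definition in_translate :: "('a, 'm) monoid_scheme \<Rightarrow> 'a set \<Rightarrow> 'a set \<Rightarrow> 'a set \<Rightarrow> bool" where
  "in_translate G H C F \<longleftrightarrow> (\<exists>h\<in>H. F \<subseteq> (\<lambda>x. h \<otimes>\<^bsub>G\<^esub> x) ` C)"

abbreviation tspace :: "('a, 'm) monoid_scheme \<Rightarrow> 'a set \<Rightarrow> 'a set \<Rightarrow> 'a list spt set topology" where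
  "tspace G H C \<equiv> sspace (carrier G) (in_translate G H C)"

lemma hereditary_in_translate [simp]: "hereditary (in_translate G H C)"
  unfolding hereditary_def in_translate_def by blast

lemma in_translate_mono: "in_translate G H C F \<Longrightarrow> H \<subseteq> H' \<Longrightarrow> C \<subseteq> C' \<Longrightarrow> in_translate G H' C' F"
  unfolding in_translate_def by blast

lemma E_sset_eq_vset: "E_sset S = vset_sset (\<lambda>F. F \<subseteq> S)"
  by (simp add: E_sset_def vset_sset_def)

lemma translates_eq_vset: "translates G H C = vset_sset (in_translate G H C)"
proof -
  have "(\<Union>g\<in>H. map (\<lambda>x. g \<otimes>\<^bsub>G\<^esub> x) ` smp (E_sset C) n) = {xs. length xs = Suc n \<and> in_translate G H C (set xs)}" for n
  proof (intro subset_antisym subsetI)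
    fix xs assume "xs \<in> (\<Union>g\<in>H. map (\<lambda>x. g \<otimes>\<^bsub>G\<^esub> x) ` smp (E_sset C) n)"
    then show "xs \<in> {xs. length xs = Suc n \<and> in_translate G H C (set xs)}"
      by (fastforce simp: E_sset_def in_translate_def)
  next
    fix xs assume "xs \<in> {xs. length xs = Suc n \<and> in_translate G H C (set xs)}"
    then obtain g where g: "g \<in> H" "set xs \<subseteq> (\<lambda>x. g \<otimes>\<^bsub>G\<^esub> x) ` C" "length xs = Suc n"
      by (auto simp: in_translate_def)
    then have "xs \<in> lists ((\<lambda>x. g \<otimes>\<^bsub>G\<^esub> x) ` C)"
      by blast
    then obtain ys where "set ys \<subseteq> C" "xs = map (\<lambda>x. g \<otimes>\<^bsub>G\<^esub> x) ys"
      unfolding lists_image by blast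
    then show "xs \<in> (\<Union>g\<in>H. map (\<lambda>x. g \<otimes>\<^bsub>G\<^esub> x) ` smp (E_sset C) n)"
      using g by (auto simp: E_sset_def)
  qed
  then show ?thesis
    by (simp add: translates_def vset_sset_def E_sset_def)
qed

lemma essentially_connected_translates_iff:
  assumes "group G" "topspace T = carrier G" "H \<subseteq> carrier G"
  shows "essentially_connected n (E_sset (carrier G)) {C. compactin T C} (translates G H) \<longleftrightarrow>
    (\<forall>v k C. int k \<le> n \<longrightarrow> compactin T C \<longrightarrow> in_translate G H C {v} \<longrightarrow> (\<exists>D. compactin T D \<and> C \<subseteq> D \<and>
      (\<forall>f\<in>loops k (tspace G H C) (vtx (carrier G) v).
         homotopic_rel k (vtx (carrier G) v) (tspace G H D) f (\<lambda>_. vtx (carrier G) v))))"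
proof -
  interpret group G by fact
  have sub: "F \<subseteq> carrier G" if C: "compactin T C" and F: "in_translate G H C F" for C F
  proof -
    have "C \<subseteq> carrier G"
      using compactin_subset_topspace[OF C] assms(2) by simp
    moreover obtain h where "h \<in> H" "F \<subseteq> (\<lambda>x. h \<otimes>\<^bsub>G\<^esub> x) ` C"
      using F by (auto simp: in_translate_def)
    ultimately show ?thesis
      using assms(3) by (auto intro!: m_closed dest!: subsetD[of F])
  qed
  have "essentially_connected n (E_sset (carrier G)) {C. compactin T C} (translates G H) \<longleftrightarrow>
    essentially_connected n (vset_sset (\<lambda>F. F \<subseteq> carrier G)) {C. compactin T C} (\<lambda>C. vset_sset (in_translate G H C))"
    by (simp add: E_sset_eq_vset translates_eq_vset[abs_def])
  also have "\<dots> \<longleftrightarrow> (\<forall>v k C. int k \<le> n \<longrightarrow> C \<in> {C. compactin T C} \<longrightarrow> in_translate G H C {v} \<longrightarrow> (\<exists>D\<in>{C. compactin T C}. C \<subseteq> D \<and>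
      (\<forall>f\<in>loops k (tspace G H C) (vtx (carrier G) v).
         homotopic_rel k (vtx (carrier G) v) (tspace G H D) f (\<lambda>_. vtx (carrier G) v))))"
    using sub by (intro essentially_connected_vset_iff) (auto intro: in_translate_mono)
  finally show ?thesis
    by (simp only: mem_Collect_eq Bex_def)
qed

lemma type_C_iff:
  assumes "lch_group G T"
  shows "type_C n G T \<longleftrightarrow>
    (\<forall>v k C. k < n \<longrightarrow> compactin T C \<longrightarrow> in_translate G (carrier G) C {v} \<longrightarrow> (\<exists>D. compactin T D \<and> C \<subseteq> D \<and>
      (\<forall>f\<in>loops k (tspace G (carrier G) C) (vtx (carrier G) v).
         homotopic_rel k (vtx (carrier G) v) (tspace G (carrier G) D) f (\<lambda>_. vtx (carrier G) v))))"
proof -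
  have "int k \<le> int n - 1 \<longleftrightarrow> k < n" for k
    by linarith
  then show ?thesis
    using assms unfolding type_C_def lch_group_def by (subst essentially_connected_translates_iff) auto
qed

lemma Sigma_top_iff:
  assumes "lch_group G T"
  shows "\<psi> \<in> Sigma_top n G T \<longleftrightarrow> character G T \<psi> \<and>
    (\<forall>v k C. k < n \<longrightarrow> compactin T C \<longrightarrow> in_translate G (halfspace G \<psi>) C {v} \<longrightarrow> (\<exists>D. compactin T D \<and> C \<subseteq> D \<and>
      (\<forall>f\<in>loops k (tspace G (halfspace G \<psi>) C) (vtx (carrier G) v).
         homotopic_rel k (vtx (carrier G) v) (tspace G (halfspace G \<psi>) D) f (\<lambda>_. vtx (carrier G) v))))"
proof -
  have "int k \<le> int n - 1 \<longleftrightarrow> k < n" for k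
    by linarith
  moreover have "halfspace G \<psi> \<subseteq> carrier G"
    by (auto simp: halfspace_def)
  ultimately show ?thesis
    using assms unfolding Sigma_top_def lch_group_def mem_Collect_eq
    by (subst essentially_connected_translates_iff) auto
qed

lemma compactin_set_mult:
  assumes "lch_group G T" "compactin T A" "compactin T B"
  shows "compactin T (A <#>\<^bsub>G\<^esub> B)"
proof -
  have "A <#>\<^bsub>G\<^esub> B = (\<lambda>(x, y). x \<otimes>\<^bsub>G\<^esub> y) ` (A \<times> B)"
    by (auto simp: set_mult_def)
  moreover have "compactin (prod_topology T T) (A \<times> B)"
    using assms by (simp add: compactin_Times)
  ultimately show ?thesis
    using assms(1) unfolding lch_group_def by (metis image_compactin)
qed

lemma compactin_set_inv:
  assumes "lch_group G T" "compactin T A"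
  shows "compactin T ((\<lambda>x. inv\<^bsub>G\<^esub> x) ` A)"
  using assms unfolding lch_group_def by (metis image_compactin)

lemma in_translate_image:
  assumes "\<phi> \<in> hom G G'" "H \<subseteq> carrier G" "C \<subseteq> carrier G" "\<phi> ` H \<subseteq> H'" "\<phi> ` C \<subseteq> C'" "in_translate G H C F"
  shows "in_translate G' H' C' (\<phi> ` F)"
proof -
  obtain h where h: "h \<in> H" "F \<subseteq> (\<lambda>x. h \<otimes>\<^bsub>G\<^esub> x) ` C"
    using assms(6) by (auto simp: in_translate_def)
  have "\<phi> ` F \<subseteq> (\<lambda>x. \<phi> h \<otimes>\<^bsub>G'\<^esub> x) ` C'"
  proof
    fix y assume "y \<in> \<phi> ` F"
    then obtain c where c: "c \<in> C" "y = \<phi> (h \<otimes>\<^bsub>G\<^esub> c)"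
      using h(2) by blast
    then have "y = \<phi> h \<otimes>\<^bsub>G'\<^esub> \<phi> c"
      using hom_mult[OF assms(1)] h(1) assms(2,3) by blast
    then show "y \<in> (\<lambda>x. \<phi> h \<otimes>\<^bsub>G'\<^esub> x) ` C'"
      using c(1) assms(5) by blast
  qed
  then show ?thesis
    using h(1) assms(4) unfolding in_translate_def by blast
qed

lemma (in group) in_translate_left_mult:
  assumes "g \<in> carrier G" "H \<subseteq> carrier G" "C \<subseteq> carrier G" "\<And>h. h \<in> H \<Longrightarrow> g \<otimes> h \<in> H'" "in_translate G H C F"
  shows "in_translate G H' C ((\<lambda>x. g \<otimes> x) ` F)"
proof -
  obtain h where h: "h \<in> H" "F \<subseteq> (\<lambda>x. h \<otimes> x) ` C"
    using assms(5) by (auto simp: in_translate_def)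
  have "(\<lambda>x. g \<otimes> x) ` F \<subseteq> (\<lambda>x. (g \<otimes> h) \<otimes> x) ` C"
  proof
    fix y assume "y \<in> (\<lambda>x. g \<otimes> x) ` F"
    then obtain c where c: "c \<in> C" "y = g \<otimes> (h \<otimes> c)"
      using h(2) by blast
    moreover have "h \<in> carrier G" "c \<in> carrier G"
      using assms(2,3) h(1) c(1) by blast+
    ultimately have "y = (g \<otimes> h) \<otimes> c"
      using m_assoc[of g h c] assms(1) by simp
    then show "y \<in> (\<lambda>x. (g \<otimes> h) \<otimes> x) ` C"
      using c(1) by blast
  qed
  then show ?thesis
    using h(1) assms(4) unfolding in_translate_def by blast
qed

text \<open>Type C speaks of spheres based at one vertex, while cells give free spheres anywhere in
  \<open>N\<close>. A free sphere is moved by a group element so that one of its points has support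
  in \<open>C\<close>, joined to the base vertex, filled there and moved back. The translates by all
  of \<open>N\<close> are invariant under this, so one \<open>D\<close> serves all spheres.\<close>

lemma type_C_fills:
  assumes N: "lch_group N TN" and tC: "type_C n N TN" and j: "j < n" and C: "compactin TN C"
  obtains D where "compactin TN D" "fills (Suc j) (tspace N (carrier N) C) (tspace N (carrier N) D)"
proof -
  interpret group N
    using N by (simp add: lch_group_def)
  have top: "topspace TN = carrier N"
    using N by (simp add: lch_group_def)
  \<comment> \<open>The identity is adjoined so that the base vertex and \<open>C\<close> lie in one
    translate and can be joined by a cone.\<close>
  let ?S = "carrier N" and ?C = "insert \<one>\<^bsub>N\<^esub> C"
  let ?X = "tspace N ?S ?C"
  have "compactin TN {\<one>\<^bsub>N\<^esub>}"
    by (rule finite_imp_compactin) (simp_all add: top)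
  then have "compactin TN ({\<one>\<^bsub>N\<^esub>} \<union> C)"
    using C by (rule compactin_Un)
  then have C1: "compactin TN ?C"
    by simp
  then have CN: "?C \<subseteq> ?S"
    using compactin_subset_topspace top by metis
  have "in_translate N ?S ?C {\<one>\<^bsub>N\<^esub>}"
    unfolding in_translate_def by (rule bexI[of _ "\<one>\<^bsub>N\<^esub>"]) auto
  then obtain D where D: "compactin TN D" "?C \<subseteq> D"
    "\<And>f. f \<in> loops j ?X (vtx ?S \<one>\<^bsub>N\<^esub>) \<Longrightarrow> homotopic_rel j (vtx ?S \<one>\<^bsub>N\<^esub>) (tspace N ?S D) f (\<lambda>_. vtx ?S \<one>\<^bsub>N\<^esub>)"
    using tC[unfolded type_C_iff[OF N], rule_format, OF j C1] by metis
  have DN: "D \<subseteq> ?S"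
    using compactin_subset_topspace[OF D(1)] top by simp
  have "fills (Suc j) (tspace N ?S C) (tspace N ?S D)"
    unfolding fills_def
  proof (intro allI impI)
    fix f assume f: "continuous_map (subtopology (cube (Suc j)) (cube_boundary (Suc j))) (tspace N ?S C) f"
    define t0 :: "nat \<Rightarrow> real" where "t0 = restrict (\<lambda>_. 0) {..<Suc j}"
    have t0: "t0 \<in> box_wall j" "t0 \<in> topspace (subtopology (cube (Suc j)) (cube_boundary (Suc j)))"
      by (auto simp: box_wall_def t0_def topspace_cube cube_boundary_def)
    have ft: "f t \<in> topspace (ES ?S)" if "t \<in> topspace (subtopology (cube (Suc j)) (cube_boundary (Suc j)))" for t
      using continuous_map_in[OF f that] by simp
    obtain a where a: "a \<in> ?S" "supp (f t0) \<subseteq> (\<lambda>x. a \<otimes>\<^bsub>N\<^esub> x) ` C"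
      using continuous_map_in[OF f t0(2)] by (auto simp: in_translate_def)
    let ?L = "\<lambda>x. inv\<^bsub>N\<^esub> a \<otimes>\<^bsub>N\<^esub> x" and ?R = "\<lambda>x. a \<otimes>\<^bsub>N\<^esub> x"
    have LR: "?L \<in> ?S \<rightarrow> ?S" "?R \<in> ?S \<rightarrow> ?S"
      using a(1) by auto
    have cL: "continuous_map (tspace N ?S C) ?X (vmap ?S ?L)"
    proof (rule continuous_map_vmap_sspace[OF LR(1)])
      fix F assume "in_translate N ?S C F"
      then show "in_translate N ?S ?C (?L ` F)"
        using a(1) CN by (intro in_translate_left_mult[where H = ?S]) (auto intro: in_translate_mono)
    qed
    have f': "continuous_map (subtopology (cube (Suc j)) (cube_boundary (Suc j))) ?X (vmap ?S ?L \<circ> f)"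
      using f cL by (rule continuous_map_compose)
    have f't0: "(vmap ?S ?L \<circ> f) t0 \<in> topspace (ES ?S)"
      using continuous_map_in[OF f' t0(2)] by simp
    have "supp ((vmap ?S ?L \<circ> f) t0) \<subseteq> C"
    proof -
      have "?L ` ((\<lambda>x. a \<otimes>\<^bsub>N\<^esub> x) ` C) \<subseteq> C"
        using a(1) CN by (auto simp: m_assoc[symmetric] subset_iff)
      then have "?L ` supp (f t0) \<subseteq> C"
        using image_mono[OF a(2), of ?L] by (rule order_trans[rotated])
      then show ?thesis
        by (simp only: comp_apply supp_vmap[OF LR(1) ft[OF t0(2)]])
    qed
    then have "insert \<one>\<^bsub>N\<^esub> (supp ((vmap ?S ?L \<circ> f) t0)) \<subseteq> (\<lambda>x. \<one>\<^bsub>N\<^esub> \<otimes>\<^bsub>N\<^esub> x) ` ?C"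
      using CN by (auto simp: image_iff subset_iff)
    then have "in_translate N ?S ?C (insert \<one>\<^bsub>N\<^esub> (supp ((vmap ?S ?L \<circ> f) t0)))"
      unfolding in_translate_def by blast
    \<comment> \<open>On the one-point cube the cone homotopy is a path from the chosen point of the
      sphere to the base vertex.\<close>
    then have "homotopic_with (\<lambda>_. True) (cube 0) ?X (\<lambda>_. (vmap ?S ?L \<circ> f) t0) (\<lambda>_. vtx ?S \<one>\<^bsub>N\<^esub>)"
      using f't0 by (intro homotopic_cone) auto
    moreover have "topspace (cube 0) \<noteq> {}"
      by (simp add: topspace_cube)
    ultimately have path: "path_component_of ?X ((vmap ?S ?L \<circ> f) t0) (vtx ?S \<one>\<^bsub>N\<^esub>)"
      by (simp only: homotopic_constant_maps null_topspace_iff_trivial simp_thms)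
    have XD: "continuous_map ?X (tspace N ?S D) id"
      using D(2) by (auto simp: continuous_map_in_subtopology intro!: continuous_map_from_subtopology
          intro: in_translate_mono)
    obtain g where g: "continuous_map (cube (Suc j)) (tspace N ?S D) g"
      "\<And>t. t \<in> cube_boundary (Suc j) \<Longrightarrow> g t = (vmap ?S ?L \<circ> f) t"
      by (rule extends_cube_if_pointed[OF XD f' t0(1) path D(3)]) (assumption, rule that)
    have "continuous_map (tspace N ?S D) (tspace N ?S D) (vmap ?S ?R)"
      using a(1) DN by (intro continuous_map_vmap_sspace[OF LR(2)] in_translate_left_mult[where H = ?S]) auto
    then have "continuous_map (cube (Suc j)) (tspace N ?S D) (vmap ?S ?R \<circ> g)"
      by (rule continuous_map_compose[OF g(1)])
    moreover have "(vmap ?S ?R \<circ> g) t = f t" if "t \<in> cube_boundary (Suc j)" for t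
    proof -
      have "f t \<in> topspace (ES ?S)"
        using that cube_boundary_subset by (intro ft) auto
      then show ?thesis
        using a(1) by (simp add: g(2)[OF that] vmap_vmap[OF LR] vmap_id m_assoc[symmetric])
    qed
    ultimately show "\<exists>g. continuous_map (cube (Suc j)) (tspace N ?S D) g \<and> (\<forall>t\<in>cube_boundary (Suc j). g t = f t)"
      by blast
  qed
  then show thesis
    using that D(1) by blast
qed

lemma fillsE:
  assumes "fills k X Y" "continuous_map (subtopology (cube k) (cube_boundary k)) X f"
  obtains g where "continuous_map (cube k) Y g" "\<And>t. t \<in> cube_boundary k \<Longrightarrow> g t = f t"
  using assms unfolding fills_def by blast

lemma fills_0: "y \<in> topspace Y \<Longrightarrow> fills 0 X Y"
  unfolding fills_def by (auto simp: cube_boundary_def intro!: exI[of _ "\<lambda>_. y"])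

section \<open>Short exact sequences\<close>

locale lch_exact =
  fixes N :: "('n, 'm1) monoid_scheme" and TN :: "'n topology"
    and G :: "('g, 'm2) monoid_scheme" and TG :: "'g topology"
    and Q :: "('q, 'm3) monoid_scheme" and TQ :: "'q topology"
    and \<iota> :: "'n \<Rightarrow> 'g" and p :: "'g \<Rightarrow> 'q"
  assumes exact: "lch_short_exact N TN G TG Q TQ \<iota> p"
begin

lemma lch: "lch_group N TN" "lch_group G TG" "lch_group Q TQ"
  using exact by (auto simp: lch_short_exact_def)

lemma topspaces [simp]: "topspace TN = carrier N" "topspace TG = carrier G" "topspace TQ = carrier Q"
  using lch by (auto simp: lch_group_def)

sublocale N: group N using lch(1) by (simp add: lch_group_def)
sublocale G: group G using lch(2) by (simp add: lch_group_def)
sublocale Q: group Q using lch(3) by (simp add: lch_group_def)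

sublocale p: group_hom G Q p
  using exact by unfold_locales (auto simp: lch_short_exact_def epi_def)

sublocale \<iota>: group_hom N G \<iota>
  using exact by unfold_locales (auto simp: lch_short_exact_def mon_def)

lemma p_image: "p ` carrier G = carrier Q"
  using exact by (simp add: lch_short_exact_def epi_def)

lemma p_surj: "q \<in> carrier Q \<Longrightarrow> \<exists>g\<in>carrier G. p g = q"
  unfolding p_image[symmetric] by blast

lemma kernel_eq: "x \<in> carrier G \<Longrightarrow> p x = \<one>\<^bsub>Q\<^esub> \<longleftrightarrow> x \<in> \<iota> ` carrier N"
  using exact by (auto simp: lch_short_exact_def kernel_def set_eq_iff)

lemma continuous_p: "continuous_map TG TQ p"
  using exact by (auto simp: lch_short_exact_def quotient_imp_continuous_map)

lemma compact_carrier: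
  "compactin TN A \<Longrightarrow> A \<subseteq> carrier N" "compactin TG B \<Longrightarrow> B \<subseteq> carrier G" "compactin TQ C \<Longrightarrow> C \<subseteq> carrier Q"
  using compactin_subset_topspace by fastforce+

text \<open>The saturation of \<open>U\<close> is a union of right translates of \<open>U\<close> by
  elements of the kernel, hence open, and \<open>p\<close> is a quotient map.\<close>

lemma open_p:
  assumes "openin TG U"
  shows "openin TQ (p ` U)"
proof -
  have U: "U \<subseteq> carrier G"
    using openin_subset[OF assms] by simp
  let ?K = "{k \<in> carrier G. p k = \<one>\<^bsub>Q\<^esub>}"
  have "openin TG {x \<in> topspace TG. x \<otimes>\<^bsub>G\<^esub> k \<in> U}" if "k \<in> ?K" for k
  proof (rule openin_continuous_map_preimage[OF _ assms])
    have "continuous_map TG (prod_topology TG TG) (\<lambda>x. (x, k))"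
      using that by (auto simp: continuous_map_pairedI)
    from continuous_map_compose[OF this, of TG "\<lambda>(x, y). x \<otimes>\<^bsub>G\<^esub> y"] lch(2)
    show "continuous_map TG TG (\<lambda>x. x \<otimes>\<^bsub>G\<^esub> k)"
      by (simp add: lch_group_def o_def)
  qed
  then have "openin TG (\<Union>k\<in>?K. {x \<in> topspace TG. x \<otimes>\<^bsub>G\<^esub> k \<in> U})"
    by (intro openin_Union) auto
  moreover have "(\<Union>k\<in>?K. {x \<in> topspace TG. x \<otimes>\<^bsub>G\<^esub> k \<in> U}) = {x \<in> topspace TG. p x \<in> p ` U}"
  proof (intro subset_antisym subsetI)
    fix x assume "x \<in> (\<Union>k\<in>?K. {x \<in> topspace TG. x \<otimes>\<^bsub>G\<^esub> k \<in> U})"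
    then obtain k where k: "k \<in> carrier G" "p k = \<one>\<^bsub>Q\<^esub>" "x \<in> carrier G" "x \<otimes>\<^bsub>G\<^esub> k \<in> U"
      by auto
    then have "p x = p (x \<otimes>\<^bsub>G\<^esub> k)"
      by simp
    then have "p x \<in> p ` U"
      using k(4) by blast
    then show "x \<in> {x \<in> topspace TG. p x \<in> p ` U}"
      using k(3) by simp
  next
    fix x assume "x \<in> {x \<in> topspace TG. p x \<in> p ` U}"
    then obtain u where u: "x \<in> carrier G" "u \<in> U" "p x = p u"
      by auto
    then have "inv\<^bsub>G\<^esub> x \<otimes>\<^bsub>G\<^esub> u \<in> ?K" "x \<otimes>\<^bsub>G\<^esub> (inv\<^bsub>G\<^esub> x \<otimes>\<^bsub>G\<^esub> u) = u"
      using U by (auto simp: subset_iff G.m_assoc[symmetric])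
    then show "x \<in> (\<Union>k\<in>?K. {x \<in> topspace TG. x \<otimes>\<^bsub>G\<^esub> k \<in> U})"
      using u by auto
  qed
  moreover have "p ` U \<subseteq> topspace TQ"
    using U by auto
  ultimately show ?thesis
    using exact unfolding lch_short_exact_def quotient_map_def by metis
qed

text \<open>Each point of \<open>D\<close> lies in the image of an open set that is contained in a
  compact one. These images are open, so finitely many of them cover \<open>D\<close>; the
  corresponding compact sets are united.\<close>

lemma compact_lift:
  assumes "compactin TQ D"
  obtains D' where "compactin TG D'" "D \<subseteq> p ` D'"
proof -
  have "\<exists>U K. openin TG U \<and> compactin TG K \<and> q \<in> p ` U \<and> U \<subseteq> K" if q: "q \<in> D" for q
  proof -
    obtain g where g: "g \<in> carrier G" "p g = q"
      using p_surj compact_carrier(3)[OF assms] q by blast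
    then obtain U K where "openin TG U" "compactin TG K" "g \<in> U" "U \<subseteq> K"
      using lch(2) by (auto simp: lch_group_def locally_compact_space_def)
    then show ?thesis
      using g by blast
  qed
  then obtain U K where UK: "\<And>q. q \<in> D \<Longrightarrow> openin TG (U q) \<and> compactin TG (K q) \<and> q \<in> p ` U q \<and> U q \<subseteq> K q"
    by metis
  have "\<exists>\<F>. finite \<F> \<and> \<F> \<subseteq> (\<lambda>q. p ` U q) ` D \<and> D \<subseteq> \<Union>\<F>"
    using UK open_p by (intro compactinD[OF assms]) auto
  then obtain T where T: "finite T" "T \<subseteq> D" "D \<subseteq> \<Union>((\<lambda>q. p ` U q) ` T)"
    by (metis finite_subset_image)
  have "compactin TG (\<Union>(K ` T))"
    using T UK by (intro compactin_Union) auto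
  moreover have "D \<subseteq> p ` \<Union>(K ` T)"
  proof
    fix q assume "q \<in> D"
    then obtain t where t: "t \<in> T" "q \<in> p ` U t"
      using T(3) by blast
    then have "U t \<subseteq> K t"
      using UK T(2) by blast
    then show "q \<in> p ` \<Union>(K ` T)"
      using t by blast
  qed
  ultimately show thesis
    by (rule that)
qed

text \<open>The kernel is closed because Q is Hausdorff, so it meets \<open>E\<close> in a compact
  set, and \<open>\<iota>\<close> is a homeomorphism onto the kernel.\<close>

lemma compact_preimage_\<iota>:
  assumes "compactin TG E"
  shows "compactin TN {x \<in> carrier N. \<iota> x \<in> E}"
proof -
  have "closedin TQ {\<one>\<^bsub>Q\<^esub>}"
    using lch(3) by (simp add: lch_group_def closedin_Hausdorff_sing_eq)
  then have "closedin TG {x \<in> topspace TG. p x \<in> {\<one>\<^bsub>Q\<^esub>}}"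
    by (rule closedin_continuous_map_preimage[OF continuous_p])
  moreover have "{x \<in> topspace TG. p x \<in> {\<one>\<^bsub>Q\<^esub>}} = \<iota> ` carrier N"
    using kernel_eq by auto
  ultimately have "compactin TG (\<iota> ` carrier N \<inter> E)"
    using assms by (simp add: closed_Int_compactin)
  then have c: "compactin (subtopology TG (\<iota> ` carrier N)) (\<iota> ` carrier N \<inter> E)"
    by (simp add: compactin_subtopology)
  obtain r where r: "homeomorphic_maps TN (subtopology TG (\<iota> ` carrier N)) \<iota> r"
    using exact by (auto simp: lch_short_exact_def embedding_map_def homeomorphic_map_maps)
  then have "compactin TN (r ` (\<iota> ` carrier N \<inter> E))"
    using c by (auto simp: homeomorphic_maps_def intro: image_compactin)
  moreover have "r ` (\<iota> ` carrier N \<inter> E) = {x \<in> carrier N. \<iota> x \<in> E}"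
  proof -
    have r\<iota>: "r (\<iota> x) = x" if "x \<in> carrier N" for x
      using r that by (auto simp: homeomorphic_maps_def)
    then show ?thesis
      by (auto simp: r\<iota>) (metis IntI image_eqI r\<iota>)
  qed
  ultimately show ?thesis by simp
qed

lemma continuous_\<iota>: "continuous_map TN TG \<iota>"
  using exact by (auto simp: lch_short_exact_def embedding_map_def homeomorphic_map_def
      quotient_imp_continuous_map dest: quotient_imp_continuous_map continuous_map_in_subtopology[THEN iffD1])

definition fiber :: "'q \<Rightarrow> 'g set" where
  "fiber q = {g \<in> carrier G. p g = q}"

text \<open>A vertex in a translate \<open>g \<iota>(n) E\<close> is retracted to \<open>\<iota>(n')\<close>, where \<open>n'\<close> is any element of \<open>N\<close>
  with the same property; this moves it by an element of the compact set \<open>E E\<inverse> \<inter> \<iota>(N)\<close>.  Hence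
  translates by a fibre are filled as in \<open>N\<close> itself.\<close>

lemma fiber_fills:
  assumes tC: "type_C n N TN" and k: "k \<le> n" and E: "compactin TG E"
  obtains E' where "compactin TG E'" "E \<subseteq> E'"
    "\<And>q. q \<in> carrier Q \<Longrightarrow> fills k (tspace G (fiber q) E) (tspace G (fiber q) E')"
proof (cases k)
  case 0
  \<comment> \<open>For \<open>k\<close> = 0 only a point is wanted; the identity is adjoined
    because \<open>E\<close> may be empty.\<close>
  have 1: "compactin TG (insert \<one>\<^bsub>G\<^esub> E)"
    using compactin_Un[OF finite_imp_compactin[of "{\<one>\<^bsub>G\<^esub>}" TG] E] by simp
  show thesis
  proof (rule that[OF 1])
    fix q assume "q \<in> carrier Q"
    then obtain g where g: "g \<in> carrier G" "p g = q"
      using p_surj by blast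
    have "in_translate G (fiber q) (insert \<one>\<^bsub>G\<^esub> E) {g}"
      using g unfolding in_translate_def fiber_def by (intro bexI[of _ g]) auto
    then have "vtx (carrier G) g \<in> topspace (tspace G (fiber q) (insert \<one>\<^bsub>G\<^esub> E))"
      using vertex_in[of "\<lambda>F. F \<subseteq> carrier G" g] g(1) by simp
    then show "fills k (tspace G (fiber q) E) (tspace G (fiber q) (insert \<one>\<^bsub>G\<^esub> E))"
      unfolding 0 by (rule fills_0)
  qed auto
next
  case (Suc j)
  let ?EE = "E <#>\<^bsub>G\<^esub> (\<lambda>x. inv\<^bsub>G\<^esub> x) ` E"
  define EN where "EN = {x \<in> carrier N. \<iota> x \<in> ?EE}"
  have EN: "compactin TN EN"
    unfolding EN_def using E by (intro compact_preimage_\<iota> compactin_set_mult[OF lch(2)] compactin_set_inv[OF lch(2)])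
  obtain D where D: "compactin TN D" "fills (Suc j) (tspace N (carrier N) EN) (tspace N (carrier N) D)"
    using type_C_fills[OF lch(1) tC _ EN, of j] k Suc by auto
  have DN: "D \<subseteq> carrier N" and EG: "E \<subseteq> carrier G"
    using compact_carrier D(1) E by auto
  \<comment> \<open>\<open>E\<close> holds the vertices of the sphere, \<open>\<iota>\<close> of
    \<open>EN\<close> the retracted ones, and \<open>\<iota>\<close> of \<open>D\<close> those of
    the filling.\<close>
  define E' where "E' = E \<union> \<iota> ` EN \<union> \<iota> ` D"
  have E': "compactin TG E'"
    unfolding E'_def using E image_compactin[OF EN continuous_\<iota>] image_compactin[OF D(1) continuous_\<iota>]
    by (intro compactin_Un)
  \<comment> \<open>The second alternative makes the choice possible for every \<open>x\<close>,
    also outside the translates in question.\<close>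
  define r where "r x = (SOME a. a \<in> carrier N \<and> (x \<in> (\<lambda>e. \<iota> a \<otimes>\<^bsub>G\<^esub> e) ` E \<or> x \<notin> \<iota> ` carrier N <#>\<^bsub>G\<^esub> E))" for x
  have r: "r x \<in> carrier N \<and> (x \<in> (\<lambda>e. \<iota> (r x) \<otimes>\<^bsub>G\<^esub> e) ` E \<or> x \<notin> \<iota> ` carrier N <#>\<^bsub>G\<^esub> E)" for x
    unfolding r_def by (rule someI_ex) (auto simp: set_mult_def)
  \<comment> \<open>Writing \<open>x\<close> both as \<iota>(a) e and as \<iota>(r x) e' gives
    \<iota>(a)^-1 \<iota>(r x) = e e'^-1, an element of \<open>?EE\<close>.\<close>
  have r_close: "inv\<^bsub>N\<^esub> a \<otimes>\<^bsub>N\<^esub> r x \<in> EN" if a: "a \<in> carrier N" and e: "e \<in> E" and x: "x = \<iota> a \<otimes>\<^bsub>G\<^esub> e" for a e x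
  proof -
    have "x \<in> \<iota> ` carrier N <#>\<^bsub>G\<^esub> E"
      using a e x by (auto simp: set_mult_def)
    then obtain e' where e': "e' \<in> E" "x = \<iota> (r x) \<otimes>\<^bsub>G\<^esub> e'"
      using r[of x] by auto
    have mem: "e \<in> carrier G" "e' \<in> carrier G" "\<iota> a \<in> carrier G" "\<iota> (r x) \<in> carrier G" "r x \<in> carrier N"
      using EG e e'(1) a r[of x] by auto
    have "\<iota> (r x) = \<iota> a \<otimes>\<^bsub>G\<^esub> (e \<otimes>\<^bsub>G\<^esub> inv\<^bsub>G\<^esub> e')"
      using mem e'(2) x by (metis G.inv_closed G.inv_solve_right G.m_assoc G.m_closed)
    then have "\<iota> (inv\<^bsub>N\<^esub> a \<otimes>\<^bsub>N\<^esub> r x) = e \<otimes>\<^bsub>G\<^esub> inv\<^bsub>G\<^esub> e'"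
      using mem a by (simp add: G.m_assoc[symmetric])
    then show ?thesis
      using a mem e e'(1) by (auto simp: EN_def set_mult_def)
  qed
  show thesis
  proof (rule that[OF E'])
    show "E \<subseteq> E'" by (auto simp: E'_def)
    fix q assume "q \<in> carrier Q"
    then obtain g where g: "g \<in> carrier G" "p g = q"
      using p_surj by blast
    let ?B = "subtopology (cube (Suc j)) (cube_boundary (Suc j))"
    \<comment> \<open>Translation by \<open>g\<close> identifies the fibre over \<open>q\<close>
      with the kernel; \<open>?\<rho>\<close> goes to \<open>N\<close> and \<open>?\<sigma>\<close>
      comes back.\<close>
    let ?\<rho> = "\<lambda>x. r (inv\<^bsub>G\<^esub> g \<otimes>\<^bsub>G\<^esub> x)" and ?\<sigma> = "\<lambda>a. g \<otimes>\<^bsub>G\<^esub> \<iota> a"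
    have \<rho>: "?\<rho> \<in> carrier G \<rightarrow> carrier N" and \<sigma>: "?\<sigma> \<in> carrier N \<rightarrow> carrier G"
      using r g(1) by auto
    have close: "\<exists>a\<in>carrier N. h = g \<otimes>\<^bsub>G\<^esub> \<iota> a \<and> (\<forall>e\<in>E. inv\<^bsub>N\<^esub> a \<otimes>\<^bsub>N\<^esub> ?\<rho> (h \<otimes>\<^bsub>G\<^esub> e) \<in> EN)" if h: "h \<in> fiber q" for h
    proof -
      have hG: "h \<in> carrier G" "p h = p g"
        using h g(2) by (auto simp: fiber_def)
      then have "inv\<^bsub>G\<^esub> g \<otimes>\<^bsub>G\<^esub> h \<in> \<iota> ` carrier N"
        using g(1) by (subst kernel_eq[symmetric]) auto
      then obtain a where a: "a \<in> carrier N" "\<iota> a = inv\<^bsub>G\<^esub> g \<otimes>\<^bsub>G\<^esub> h"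
        by auto
      have "h = g \<otimes>\<^bsub>G\<^esub> \<iota> a"
        using a(2) g(1) hG(1) by (simp add: G.m_assoc[symmetric])
      moreover have "inv\<^bsub>N\<^esub> a \<otimes>\<^bsub>N\<^esub> ?\<rho> (h \<otimes>\<^bsub>G\<^esub> e) \<in> EN" if "e \<in> E" for e
        using r_close[OF a(1) that] a g(1) hG(1) EG that by (auto simp: G.m_assoc)
      ultimately show ?thesis
        using a(1) by blast
    qed
    have tr\<rho>: "in_translate N (carrier N) EN (?\<rho> ` F)" if F: "in_translate G (fiber q) E F" for F
    proof -
      obtain h where h: "h \<in> fiber q" "F \<subseteq> (\<lambda>x. h \<otimes>\<^bsub>G\<^esub> x) ` E"
        using F by (auto simp: in_translate_def)
      obtain a where a: "a \<in> carrier N" "\<And>e. e \<in> E \<Longrightarrow> inv\<^bsub>N\<^esub> a \<otimes>\<^bsub>N\<^esub> ?\<rho> (h \<otimes>\<^bsub>G\<^esub> e) \<in> EN"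
        using close[OF h(1)] by blast
      have "?\<rho> (h \<otimes>\<^bsub>G\<^esub> e) \<in> (\<lambda>x. a \<otimes>\<^bsub>N\<^esub> x) ` EN" if "e \<in> E" for e
        by (rule image_eqI[OF _ a(2)[OF that]]) (use a(1) r in \<open>simp add: N.m_assoc[symmetric]\<close>)
      then show ?thesis
        using h(2) a(1) unfolding in_translate_def by blast
    qed
    have tr\<sigma>: "in_translate G (fiber q) E' (?\<sigma> ` F)" if F: "in_translate N (carrier N) D F" for F
    proof -
      obtain a where a: "a \<in> carrier N" "F \<subseteq> (\<lambda>x. a \<otimes>\<^bsub>N\<^esub> x) ` D"
        using F by (auto simp: in_translate_def)
      have "?\<sigma> (a \<otimes>\<^bsub>N\<^esub> x) = ?\<sigma> a \<otimes>\<^bsub>G\<^esub> \<iota> x" if "x \<in> D" for x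
        using a(1) g(1) that DN by (auto simp: G.m_assoc)
      then have "?\<sigma> ` F \<subseteq> (\<lambda>x. ?\<sigma> a \<otimes>\<^bsub>G\<^esub> x) ` E'"
        using a(2) unfolding E'_def by (auto dest!: subsetD)
      moreover have "?\<sigma> a \<in> fiber q"
        using a(1) g kernel_eq[of "\<iota> a"] by (auto simp: fiber_def)
      ultimately show ?thesis
        unfolding in_translate_def by blast
    qed
    \<comment> \<open>Going to \<open>N\<close> and back moves the vertices of a simplex inside a
      single translate of \<open>E'\<close>, so the round trip is contiguous to the
      identity.\<close>
    have tr_join: "in_translate G (fiber q) E' ((\<lambda>x. x) ` F \<union> (?\<sigma> \<circ> ?\<rho>) ` F)" if F: "in_translate G (fiber q) E F" for F
    proof -
      obtain h where h: "h \<in> fiber q" "F \<subseteq> (\<lambda>x. h \<otimes>\<^bsub>G\<^esub> x) ` E"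
        using F by (auto simp: in_translate_def)
      obtain a where a: "a \<in> carrier N" "h = g \<otimes>\<^bsub>G\<^esub> \<iota> a" "\<And>e. e \<in> E \<Longrightarrow> inv\<^bsub>N\<^esub> a \<otimes>\<^bsub>N\<^esub> ?\<rho> (h \<otimes>\<^bsub>G\<^esub> e) \<in> EN"
        using close[OF h(1)] by blast
      have "(?\<sigma> \<circ> ?\<rho>) (h \<otimes>\<^bsub>G\<^esub> e) = h \<otimes>\<^bsub>G\<^esub> \<iota> (inv\<^bsub>N\<^esub> a \<otimes>\<^bsub>N\<^esub> ?\<rho> (h \<otimes>\<^bsub>G\<^esub> e))" for e
      proof -
        have b: "?\<rho> (h \<otimes>\<^bsub>G\<^esub> e) \<in> carrier N"
          using r by simp
        have "\<iota> (?\<rho> (h \<otimes>\<^bsub>G\<^esub> e)) = \<iota> a \<otimes>\<^bsub>G\<^esub> \<iota> (inv\<^bsub>N\<^esub> a \<otimes>\<^bsub>N\<^esub> ?\<rho> (h \<otimes>\<^bsub>G\<^esub> e))"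
          using a(1) b by (simp add: G.m_assoc[symmetric])
        then show ?thesis
          using a(1) b g(1) unfolding comp_def by (simp add: a(2) G.m_assoc)
      qed
      then have "(?\<sigma> \<circ> ?\<rho>) (h \<otimes>\<^bsub>G\<^esub> e) \<in> (\<lambda>x. h \<otimes>\<^bsub>G\<^esub> x) ` E'" if "e \<in> E" for e
        using a(3)[OF that] unfolding E'_def by (metis UnI1 UnI2 imageI)
      then have "(\<lambda>x. x) ` F \<union> (?\<sigma> \<circ> ?\<rho>) ` F \<subseteq> (\<lambda>x. h \<otimes>\<^bsub>G\<^esub> x) ` E'"
        using h(2) unfolding E'_def by blast
      then show ?thesis
        using h(1) unfolding in_translate_def by blast
    qed
    show "fills k (tspace G (fiber q) E) (tspace G (fiber q) E')"
      unfolding fills_def Suc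
    proof (intro allI impI)
      fix f assume f: "continuous_map ?B (tspace G (fiber q) E) f"
      have fE: "continuous_map ?B (ES (carrier G)) f" "\<And>t. t \<in> topspace ?B \<Longrightarrow> in_translate G (fiber q) E (supp (f t))"
        using f by (auto simp: continuous_map_in_subtopology)
      have "continuous_map ?B (tspace N (carrier N) EN) (vmap (carrier N) ?\<rho> \<circ> f)"
        by (rule continuous_map_compose[OF f], rule continuous_map_vmap_sspace[OF \<rho>], rule tr\<rho>)
      then obtain h where h: "continuous_map (cube (Suc j)) (tspace N (carrier N) D) h"
        "\<And>t. t \<in> cube_boundary (Suc j) \<Longrightarrow> h t = (vmap (carrier N) ?\<rho> \<circ> f) t"
        by (rule fillsE[OF D(2)]) blast
      let ?h = "vmap (carrier G) ?\<sigma> \<circ> h"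
      have h': "continuous_map (cube (Suc j)) (tspace G (fiber q) E') ?h"
        by (rule continuous_map_compose[OF h(1)], rule continuous_map_vmap_sspace[OF \<sigma>], rule tr\<sigma>)
      \<comment> \<open>The sphere is homotopic to its round trip, which bounds the filling carried
        over from \<open>N\<close> and thus contracts to the image \<open>?c\<close> of the centre
        of the cube.\<close>
      let ?c = "?h (cscale (Suc j) 0 undefined)"
      have 1: "homotopic_with (\<lambda>_. True) ?B (tspace G (fiber q) E') ?h (\<lambda>_. ?c)"
        by (rule homotopic_from_subtopology[OF homotopic_cube_const[OF h']])
      have "homotopic_with (\<lambda>_. True) ?B (tspace G (fiber q) E') (vmap (carrier G) (\<lambda>x. x) \<circ> f) (vmap (carrier G) (?\<sigma> \<circ> ?\<rho>) \<circ> f)"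
        by (rule homotopic_contiguous[OF fE(1)]) (use \<rho> \<sigma> tr_join[OF fE(2)] in auto)
      then have 2: "homotopic_with (\<lambda>_. True) ?B (tspace G (fiber q) E') f ?h"
      proof (rule homotopic_with_eq)
        fix t assume t: "t \<in> topspace ?B"
        then have ft: "f t \<in> topspace (ES (carrier G))"
          by (rule continuous_map_in[OF fE(1)])
        then show "f t = (vmap (carrier G) (\<lambda>x. x) \<circ> f) t"
          by (simp add: vmap_id)
        show "?h t = (vmap (carrier G) (?\<sigma> \<circ> ?\<rho>) \<circ> f) t"
          using t h(2)[of t] vmap_vmap[OF \<rho> \<sigma> ft] by simp
      qed simp
      have "?c \<in> topspace (tspace G (fiber q) E')"
        by (rule continuous_map_in[OF h' cscale_in_cube]) simp
      then show "\<exists>g. continuous_map (cube (Suc j)) (tspace G (fiber q) E') g \<and> (\<forall>t\<in>cube_boundary (Suc j). g t = f t)"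
        using nullhomotopic_extends_cube[OF homotopic_with_trans[OF 2 1]] by metis
    qed
  qed
qed

end

section \<open>Grid cells labelled by translates\<close>

definition thicken :: "('a, 'm) monoid_scheme \<Rightarrow> 'a set \<Rightarrow> 'a set" where
  "thicken G C = C <#>\<^bsub>G\<^esub> (\<lambda>x. inv\<^bsub>G\<^esub> x) ` C <#>\<^bsub>G\<^esub> C"

text \<open>The possible differences of labels: if q C and q' C share a vertex q a = q' b, then q' =
  q (a b^-1).\<close>

definition quotients :: "('a, 'm) monoid_scheme \<Rightarrow> 'a set \<Rightarrow> 'a set" where
  "quotients G C = C <#>\<^bsub>G\<^esub> (\<lambda>x. inv\<^bsub>G\<^esub> x) ` C"

lemma compactin_quotients: "lch_group G T \<Longrightarrow> compactin T C \<Longrightarrow> compactin T (quotients G C)"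
  unfolding quotients_def by (intro compactin_set_mult compactin_set_inv)

lemma compactin_thicken: "lch_group G T \<Longrightarrow> compactin T C \<Longrightarrow> compactin T (thicken G C)"
  unfolding thicken_def by (intro compactin_set_mult compactin_set_inv)

lemma thickenI: "a \<in> C \<Longrightarrow> b \<in> C \<Longrightarrow> c \<in> C \<Longrightarrow> a \<otimes>\<^bsub>G\<^esub> inv\<^bsub>G\<^esub> b \<otimes>\<^bsub>G\<^esub> c \<in> thicken G C"
  unfolding thicken_def set_mult_def by blast

lemma quotientsI: "a \<in> C \<Longrightarrow> b \<in> C \<Longrightarrow> a \<otimes>\<^bsub>G\<^esub> inv\<^bsub>G\<^esub> b \<in> quotients G C"
  unfolding quotients_def set_mult_def by blast

lemma (in group) subset_thicken: "C \<subseteq> carrier G \<Longrightarrow> C \<subseteq> thicken G C"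
proof
  fix c assume "C \<subseteq> carrier G" "c \<in> C"
  then show "c \<in> thicken G C"
    using thickenI[of c C c c G] by auto
qed

text \<open>If \<open>q C\<close> and \<open>q' C\<close> have a common vertex then \<open>q' C \<subseteq> q C C\<inverse> C\<close>, so a small cube that is mapped to
  the star of one vertex goes to one translate of \<open>C C\<inverse> C\<close>.\<close>

lemma (in group) grid_translates:
  assumes F: "continuous_map (cube d) (tspace G H C) F" and H: "H \<subseteq> carrier G" and C: "C \<subseteq> carrier G"
  obtains m qc where "m > 0" "\<And>c. c \<in> grid d m \<Longrightarrow> qc c \<in> H"
    "\<And>c t. c \<in> grid d m \<Longrightarrow> t \<in> gcell d m c \<Longrightarrow> supp (F t) \<subseteq> (\<lambda>x. qc c \<otimes> x) ` thicken G C"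
proof -
  have F1: "continuous_map (cube d) (ES (carrier G)) F"
    and F2: "\<And>t. t \<in> topspace (cube d) \<Longrightarrow> in_translate G H C (supp (F t))"
    using F by (auto simp: continuous_map_in_subtopology)
  let ?U = "\<lambda>v. {t \<in> topspace (cube d). F t \<in> {c \<in> topspace (ES (carrier G)). v \<in> supp c}}"
  have "openin (cube d) (?U v)" for v
    by (rule openin_continuous_map_preimage[OF F1 openin_star])
  moreover have "topspace (cube d) \<subseteq> \<Union>(range ?U)"
  proof
    fix t assume t: "t \<in> topspace (cube d)"
    then have "F t \<in> topspace (ES (carrier G))"
      by (rule continuous_map_in[OF F1])
    then show "t \<in> \<Union>(range ?U)"
      using t supp_ES[of "F t"] by fastforce
  qed
  ultimately obtain m where m: "m > 0" "\<And>c. c \<in> grid d m \<Longrightarrow> \<exists>U\<in>range ?U. gcell d m c \<subseteq> U"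
    by (elim grid_fine[rotated]) blast+
  have "\<exists>q\<in>H. \<forall>t\<in>gcell d m c. supp (F t) \<subseteq> (\<lambda>x. q \<otimes> x) ` thicken G C" if c: "c \<in> grid d m" for c
  proof -
    obtain v where v: "\<And>t. t \<in> gcell d m c \<Longrightarrow> v \<in> supp (F t)"
      using m(2)[OF c] by blast
    obtain t0 where t0: "t0 \<in> gcell d m c"
      using gcell_nonempty[OF c m(1)] by blast
    have top: "t \<in> topspace (cube d)" if "t \<in> gcell d m c" for t
      using that by (simp add: gcell_def)
    obtain q where q: "q \<in> H" "supp (F t0) \<subseteq> (\<lambda>x. q \<otimes> x) ` C"
      using F2[OF top[OF t0]] by (auto simp: in_translate_def)
    obtain a where a: "a \<in> C" "v = q \<otimes> a"
      using q(2) v[OF t0] by blast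
    have "supp (F t) \<subseteq> (\<lambda>x. q \<otimes> x) ` thicken G C" if t: "t \<in> gcell d m c" for t
    proof
      fix x assume x: "x \<in> supp (F t)"
      obtain q' where q': "q' \<in> H" "supp (F t) \<subseteq> (\<lambda>x. q' \<otimes> x) ` C"
        using F2[OF top[OF t]] by (auto simp: in_translate_def)
      obtain b e where be: "b \<in> C" "v = q' \<otimes> b" "e \<in> C" "x = q' \<otimes> e"
        using q'(2) v[OF t] x by blast
      have mem: "q \<in> carrier G" "q' \<in> carrier G" "a \<in> carrier G" "b \<in> carrier G" "e \<in> carrier G"
        using H C q(1) q'(1) a(1) be(1,3) by auto
      have "q' = q \<otimes> a \<otimes> inv b"
        using mem a(2) be(2) by (metis inv_solve_right m_closed)
      then have "x = q \<otimes> (a \<otimes> inv b \<otimes> e)"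
        using mem be(4) by (simp add: m_assoc)
      then show "x \<in> (\<lambda>x. q \<otimes> x) ` thicken G C"
        using thickenI[OF a(1) be(1,3)] by blast
    qed
    then show ?thesis
      using q(1) by blast
  qed
  then obtain qc where "\<And>c. c \<in> grid d m \<Longrightarrow> qc c \<in> H \<and> (\<forall>t\<in>gcell d m c. supp (F t) \<subseteq> (\<lambda>x. qc c \<otimes> x) ` thicken G C)"
    by metis
  then show thesis
    using that[of m qc] m(1) by blast
qed

text \<open>On the smaller cell the support is nonempty and lies in both translates, so they share a
  vertex.\<close>

lemma (in group) translates_overlap:
  assumes "c' \<in> grid d m" "m > 0" "gface d c' c" "M \<subseteq> carrier G" "q \<in> carrier G" "q' \<in> carrier G"
    and "\<And>t. t \<in> gcell d m c \<Longrightarrow> supp (F t) \<subseteq> (\<lambda>x. q \<otimes> x) ` M"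
    and "\<And>t. t \<in> gcell d m c' \<Longrightarrow> supp (F t) \<subseteq> (\<lambda>x. q' \<otimes> x) ` M"
    and "\<And>t. t \<in> gcell d m c' \<Longrightarrow> supp (F t) \<noteq> {}"
  shows "\<exists>\<mu>\<in>quotients G M. q' = q \<otimes> \<mu>"
proof -
  obtain t where t: "t \<in> gcell d m c'" "t \<in> gcell d m c"
    using gcell_nonempty[OF assms(1,2)] gface_gcell[OF assms(3)] by blast
  obtain x where x: "x \<in> supp (F t)"
    using assms(9)[OF t(1)] by blast
  obtain a b where ab: "a \<in> M" "b \<in> M" "x = q \<otimes> a" "x = q' \<otimes> b"
    using subsetD[OF assms(7)[OF t(2)] x] subsetD[OF assms(8)[OF t(1)] x] by blast
  then have mem: "a \<in> carrier G" "b \<in> carrier G"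
    using assms(4) by auto
  have "q' = x \<otimes> inv b"
    using mem assms(6) ab(4) by (simp add: m_assoc)
  also have "\<dots> = q \<otimes> (a \<otimes> inv b)"
    using mem assms(5) ab(3) by (simp add: m_assoc)
  finally show ?thesis
    using quotientsI[OF ab(1,2)] by blast
qed

text \<open>Bottom, top and side wall of a prism are closed, and the three maps agree where they
  meet because loops take the value \<open>x\<close> on the boundary. Together with the converse
  below, a homotopy of loops becomes an extension problem for a single cube.\<close>

lemma continuous_map_prism_boundary:
  assumes a: "a \<in> loops k X x" and b: "b \<in> loops k X x" and x: "x \<in> topspace X"
  shows "continuous_map (subtopology (cube (Suc k)) (cube_boundary (Suc k))) X
    (\<lambda>t. if t k = 0 then a (restrict t {..<k}) else if t k = 1 then b (restrict t {..<k}) else x)"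
    (is "continuous_map ?B X ?f")
proof -
  let ?r = "\<lambda>t. restrict t {..<k}"
  let ?T = "\<lambda>i::nat. if i = 0 then {t \<in> topspace (cube (Suc k)). t k = 0}
    else if i = 1 then {t \<in> topspace (cube (Suc k)). t k = 1} else {t \<in> topspace (cube (Suc k)). ?r t \<in> cube_boundary k}"
  let ?g = "\<lambda>i::nat. if i = 0 then a \<circ> ?r else if i = 1 then b \<circ> ?r else (\<lambda>_. x)"
  have ab: "continuous_map (cube k) X a" "continuous_map (cube k) X b"
    "\<And>u. u \<in> cube_boundary k \<Longrightarrow> a u = x" "\<And>u. u \<in> cube_boundary k \<Longrightarrow> b u = x"
    using a b by (auto simp: loops_def)
  have TB: "?T i \<subseteq> cube_boundary (Suc k)" for i
    by (auto simp: cube_boundary_Suc)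
  have clT: "closedin (cube (Suc k)) (?T i)" for i
    using closedin_continuous_map_preimage[OF continuous_map_cube_restrict closedin_cube_boundary]
    by (auto intro!: closedin_cube_face)
  show ?thesis
  proof (rule pasting_lemma_closed[where I = "{0, 1, 2}" and T = ?T and f = ?g])
    show "closedin ?B (?T i)" for i
      unfolding closedin_closed_subtopology[OF closedin_cube_boundary] using clT TB by blast
    show "continuous_map (subtopology ?B (?T i)) X (?g i)" for i
      using continuous_map_compose[OF continuous_map_cube_restrict ab(1)] continuous_map_compose[OF continuous_map_cube_restrict ab(2)] x
      by (auto intro!: continuous_map_from_subtopology)
    show "?g i t = ?g j t" if "i \<in> {0, 1, 2}" "j \<in> {0, 1, 2}" "t \<in> topspace ?B \<inter> ?T i \<inter> ?T j" for i j t
      using that ab(3,4) by (auto split: if_splits)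
    show "\<exists>j. j \<in> {0, 1, 2} \<and> t \<in> ?T j \<and> ?f t = ?g j t" if "t \<in> topspace ?B" for t
    proof -
      have t: "t \<in> topspace (cube (Suc k))" "t k = 0 \<or> t k = 1 \<or> ?r t \<in> cube_boundary k"
        using that cube_boundary_Suc[of t k] by auto
      consider "t k = 0" | "t k = 1" | "t k \<noteq> 0" "t k \<noteq> 1" "?r t \<in> cube_boundary k"
        using t(2) by blast
      then show ?thesis
      proof cases
        case 1 then show ?thesis using t(1) by (intro exI[of _ 0]) auto
      next
        case 2 then show ?thesis using t(1) by (intro exI[of _ 1]) auto
      next
        case 3 then show ?thesis using t(1) by (intro exI[of _ 2]) auto
      qed
    qed
  qed simp
qed

lemma homotopic_rel_of_prism:
  assumes a: "a \<in> loops k X x" and b: "b \<in> loops k X x" and F: "continuous_map (cube (Suc k)) X F"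
    and "\<And>t. t \<in> cube_boundary (Suc k) \<Longrightarrow>
      F t = (if t k = 0 then a (restrict t {..<k}) else if t k = 1 then b (restrict t {..<k}) else x)"
  shows "homotopic_rel k x X a b"
proof (rule homotopic_rel_of_cube[OF F])
  have F': "F (u(k := s)) = (if s = 0 then a u else if s = 1 then b u else x)"
    if "u \<in> topspace (cube k)" "s \<in> {0..1}" "s = 0 \<or> s = 1 \<or> u \<in> cube_boundary k" for u s
    using that assms(4)[of "u(k := s)"] cube_boundary_Suc[OF cube_upd[OF that(1,2)]] restrict_upd_cube[OF that(1), of s]
    by auto
  show "F (u(k := 0)) = a u" "F (u(k := 1)) = b u" if "u \<in> topspace (cube k)" for u
    using F'[OF that, of 0] F'[OF that, of 1] by auto
  show "F (u(k := s)) = x" if "u \<in> cube_boundary k" "s \<in> {0..1}" for u s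
    using F'[OF subsetD[OF cube_boundary_subset that(1)] that(2)] that(1) a b by (auto simp: loops_def)
qed

section \<open>Lifting along \<open>p\<close> over a labelled grid\<close>

context lch_exact
begin

text \<open>For \<open>h\<close> over q' the element h \<tau>^-1 lies over \<open>q\<close>, and h e
  = (h \<tau>^-1)(\<tau> e): a change of fibre costs a left factor from \<open>T\<close>.\<close>

lemma in_translate_fiber_cong:
  assumes "in_translate G (fiber q') E F" "E \<subseteq> carrier G" "T \<subseteq> carrier G" "\<tau> \<in> T" "q' = q \<otimes>\<^bsub>Q\<^esub> p \<tau>" "q \<in> carrier Q"
  shows "in_translate G (fiber q) (T <#>\<^bsub>G\<^esub> E) F"
proof -
  obtain h where h: "h \<in> fiber q'" "F \<subseteq> (\<lambda>x. h \<otimes>\<^bsub>G\<^esub> x) ` E"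
    using assms(1) by (auto simp: in_translate_def)
  have mem: "h \<in> carrier G" "p h = q'" "\<tau> \<in> carrier G"
    using h(1) assms(3,4) by (auto simp: fiber_def)
  let ?g = "h \<otimes>\<^bsub>G\<^esub> inv\<^bsub>G\<^esub> \<tau>"
  have "p ?g = q"
    using mem assms(5,6) by (simp add: Q.m_assoc)
  then have "?g \<in> fiber q"
    using mem by (simp add: fiber_def)
  moreover have "F \<subseteq> (\<lambda>x. ?g \<otimes>\<^bsub>G\<^esub> x) ` (T <#>\<^bsub>G\<^esub> E)"
  proof
    fix x assume "x \<in> F"
    then obtain e where e: "e \<in> E" "x = h \<otimes>\<^bsub>G\<^esub> e"
      using h(2) by blast
    then have "x = ?g \<otimes>\<^bsub>G\<^esub> (\<tau> \<otimes>\<^bsub>G\<^esub> e)"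
      using mem assms(2) by (auto simp: G.m_assoc subset_iff) (simp add: G.m_assoc[symmetric])
    then show "x \<in> (\<lambda>x. ?g \<otimes>\<^bsub>G\<^esub> x) ` (T <#>\<^bsub>G\<^esub> E)"
      using e(1) assms(4) by (auto simp: set_mult_def)
  qed
  ultimately show ?thesis
    unfolding in_translate_def by blast
qed

text \<open>The map to be lifted enters only through the labels \<open>qc\<close> of its cells.
  Mesh, labels and boundary values are quantified inside, so \<open>E\<close> depends on
  \<open>d\<close>, \<open>E0\<close> and \<open>M\<close> alone; this is the uniformity over all
  loops that essential connectedness demands.\<close>

definition lifts :: "nat \<Rightarrow> 'g set \<Rightarrow> 'q set \<Rightarrow> 'g set \<Rightarrow> bool" where
  "lifts d E0 M E \<longleftrightarrow> (\<forall>m qc f0. m > 0 \<longrightarrow> (\<forall>c\<in>grid d m. qc c \<in> carrier Q) \<longrightarrow>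
      (\<forall>c\<in>grid d m. \<forall>c'\<in>grid d m. gface d c' c \<longrightarrow> (\<exists>\<mu>\<in>M. qc c' = qc c \<otimes>\<^bsub>Q\<^esub> \<mu>)) \<longrightarrow>
      continuous_map (subtopology (cube d) (cube_boundary d)) (ES (carrier G)) f0 \<longrightarrow>
      (\<forall>c\<in>grid d m. gcell d m c \<subseteq> cube_boundary d \<longrightarrow>
        (\<forall>t\<in>gcell d m c. in_translate G (fiber (qc c)) E0 (supp (f0 t)))) \<longrightarrow>
      (\<exists>F. continuous_map (cube d) (ES (carrier G)) F \<and> (\<forall>t\<in>cube_boundary d. F t = f0 t) \<and>
        (\<forall>c\<in>grid d m. \<forall>t\<in>gcell d m c. in_translate G (fiber (qc c)) E (supp (F t)))))"

lemma liftsE: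
  assumes "lifts d E0 M E" "m > 0" "\<And>c. c \<in> grid d m \<Longrightarrow> qc c \<in> carrier Q"
    and "\<And>c c'. c \<in> grid d m \<Longrightarrow> c' \<in> grid d m \<Longrightarrow> gface d c' c \<Longrightarrow> \<exists>\<mu>\<in>M. qc c' = qc c \<otimes>\<^bsub>Q\<^esub> \<mu>"
    and "continuous_map (subtopology (cube d) (cube_boundary d)) (ES (carrier G)) f0"
    and "\<And>c t. c \<in> grid d m \<Longrightarrow> gcell d m c \<subseteq> cube_boundary d \<Longrightarrow> t \<in> gcell d m c \<Longrightarrow>
        in_translate G (fiber (qc c)) E0 (supp (f0 t))"
  obtains F where "continuous_map (cube d) (ES (carrier G)) F" "\<And>t. t \<in> cube_boundary d \<Longrightarrow> F t = f0 t"
    "\<And>c t. c \<in> grid d m \<Longrightarrow> t \<in> gcell d m c \<Longrightarrow> in_translate G (fiber (qc c)) E (supp (F t))"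
proof -
  have "\<exists>F. continuous_map (cube d) (ES (carrier G)) F \<and> (\<forall>t\<in>cube_boundary d. F t = f0 t) \<and>
        (\<forall>c\<in>grid d m. \<forall>t\<in>gcell d m c. in_translate G (fiber (qc c)) E (supp (F t)))"
    using assms(2-) by (intro assms(1)[unfolded lifts_def, rule_format]) blast+
  then show thesis
    using that by blast
qed

text \<open>The lift is built cell by cell: the proper faces of a cell of dimension \<open>j + 1\<close> lie in translates
  of \<open>Es j\<close> by fibres that differ from the fibre of the cell by an element of \<open>p ` T\<close>.\<close>

lemma lift_extension:
  assumes tC: "type_C n N TN" and d: "d \<le> n" and E0: "compactin TG E0" and M: "compactin TQ M"
  obtains E where "compactin TG E" "lifts d E0 M E"
proof -
  obtain T where T: "compactin TG T" "M \<subseteq> p ` T"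
    by (rule compact_lift[OF M])
  let ?P = "\<lambda>k E E'. compactin TG E \<longrightarrow> compactin TG E' \<and> E \<subseteq> E' \<and>
      (k \<le> n \<longrightarrow> (\<forall>q\<in>carrier Q. fills k (tspace G (fiber q) E) (tspace G (fiber q) E')))"
  \<comment> \<open>Compactness and the bound on \<open>k\<close> are premises inside
    \<open>?P\<close>, so a witness always exists and \<open>\<Phi>\<close> is a total function over
    which one can recurse.\<close>
  have ex: "\<exists>E'. ?P k E E'" for k E
  proof (cases "compactin TG E \<and> k \<le> n")
    case True
    then obtain E' where "compactin TG E'" "E \<subseteq> E'"
      "\<And>q. q \<in> carrier Q \<Longrightarrow> fills k (tspace G (fiber q) E) (tspace G (fiber q) E')"
      using fiber_fills[OF tC, of k E] by blast
    then show ?thesis by blast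
  qed blast
  define \<Phi> where "\<Phi> k E = (SOME E'. ?P k E E')" for k E
  have \<Phi>: "compactin TG (\<Phi> k E) \<and> E \<subseteq> \<Phi> k E \<and>
      (k \<le> n \<longrightarrow> (\<forall>q\<in>carrier Q. fills k (tspace G (fiber q) E) (tspace G (fiber q) (\<Phi> k E))))"
    if "compactin TG E" for k E
    using someI_ex[OF ex[where k = k and E = E]] that unfolding \<Phi>_def by (rule mp)
  \<comment> \<open>Cells of dimension \<open>k\<close> are lifted to translates of
    \<open>Es k\<close>, their boundaries to translates of \<open>Bs k\<close>. Keeping
    \<open>Es j\<close> itself in the union makes the sequence increasing, so that faces of all
    lower dimensions and the boundary values in \<open>E0\<close> fit as well.\<close>
  define Es where "Es = rec_nat (\<Phi> 0 E0) (\<lambda>j A. \<Phi> (Suc j) (A \<union> (T <#>\<^bsub>G\<^esub> A)))"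
  define Bs where "Bs k = (case k of 0 \<Rightarrow> E0 | Suc j \<Rightarrow> Es j \<union> (T <#>\<^bsub>G\<^esub> Es j))" for k
  have Es: "Es k = \<Phi> k (Bs k)" for k
    by (cases k) (simp_all add: Es_def Bs_def)
  have cEB: "compactin TG (Es k) \<and> compactin TG (Bs k)" for k
  proof (induction k)
    case 0
    then show ?case using E0 \<Phi> by (simp add: Es Bs_def)
  next
    case (Suc k)
    then have "compactin TG (Bs (Suc k))"
      using T(1) by (auto simp: Bs_def intro!: compactin_Un compactin_set_mult[OF lch(2)])
    then show ?case using \<Phi> by (simp add: Es)
  qed
  have EsSuc: "Es k \<subseteq> Es (Suc k)" for k
  proof -
    have "Es k \<subseteq> Bs (Suc k)"
      by (simp add: Bs_def)
    also have "\<dots> \<subseteq> \<Phi> (Suc k) (Bs (Suc k))"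
      using \<Phi> cEB by blast
    finally show ?thesis
      by (simp only: Es[symmetric])
  qed
  have Es_mono: "Es i \<subseteq> Es j" if "i \<le> j" for i j
    by (rule lift_Suc_mono_le[of Es, OF EsSuc that])
  have "E0 \<subseteq> Es 0"
    using \<Phi>[OF E0] by (simp add: Es[of 0] Bs_def)
  then have E0Es: "E0 \<subseteq> Es k" for k
    using Es_mono[of 0 k] by auto
  have "lifts d E0 M (Es d)"
    unfolding lifts_def
  proof (intro allI impI)
    fix m qc f0
    assume m: "m > 0" and qcb: "\<forall>c\<in>grid d m. qc c \<in> carrier Q"
      and ov: "\<forall>c\<in>grid d m. \<forall>c'\<in>grid d m. gface d c' c \<longrightarrow> (\<exists>\<mu>\<in>M. qc c' = qc c \<otimes>\<^bsub>Q\<^esub> \<mu>)"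
      and f0: "continuous_map (subtopology (cube d) (cube_boundary d)) (ES (carrier G)) f0"
      and bdb: "\<forall>c\<in>grid d m. gcell d m c \<subseteq> cube_boundary d \<longrightarrow>
        (\<forall>t\<in>gcell d m c. in_translate G (fiber (qc c)) E0 (supp (f0 t)))"
    note qc = bspec[OF qcb]
    have overlap: "\<exists>\<mu>\<in>M. qc c' = qc c \<otimes>\<^bsub>Q\<^esub> \<mu>" if "c \<in> grid d m" "c' \<in> grid d m" "gface d c' c" for c c'
      using ov that by blast
    have bd: "in_translate G (fiber (qc c)) E0 (supp (f0 t))"
      if "c \<in> grid d m" "gcell d m c \<subseteq> cube_boundary d" "t \<in> gcell d m c" for c t
      using bdb that by blast
    let ?A = "\<lambda>c. {z. in_translate G (fiber (qc c)) (Es (gdim d c)) (supp z)}"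
    let ?B = "\<lambda>c. {z. in_translate G (fiber (qc c)) (Bs (gdim d c)) (supp z)}"
    have fill: "fills (gdim d c) (subtopology (ES (carrier G)) (?B c)) (subtopology (ES (carrier G)) (?A c))"
      if "c \<in> grid d m" for c
      using \<Phi>[where k = "gdim d c" and E = "Bs (gdim d c)"] cEB[of "gdim d c"] gdim_le[of d c] d qc[OF that]
      by (simp add: Es[of "gdim d c"])
    have mono: "?A c' \<subseteq> ?B c" if c: "c \<in> grid d m" and c': "c' \<in> grid d m" and f: "gface d c' c" and ne: "c' \<noteq> c" for c c'
    proof
      fix z assume z: "z \<in> ?A c'"
      obtain j where j: "gdim d c = Suc j" "gdim d c' \<le> j"
        using gface_dim_less[OF f ne c c'] by (cases "gdim d c") auto
      obtain \<mu> where \<mu>: "\<mu> \<in> M" "qc c' = qc c \<otimes>\<^bsub>Q\<^esub> \<mu>"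
        using overlap[OF c c' f] by blast
      then obtain \<tau> where \<tau>: "\<tau> \<in> T" "\<mu> = p \<tau>"
        using T(2) by blast
      have "in_translate G (fiber (qc c')) (Es j) (supp z)"
        using z Es_mono[OF j(2)] by (auto intro: in_translate_mono)
      then have "in_translate G (fiber (qc c)) (T <#>\<^bsub>G\<^esub> Es j) (supp z)"
        using cEB[of j] T(1) \<tau> \<mu>(2) qc[OF c] compact_carrier(2) by (intro in_translate_fiber_cong) auto
      then show "z \<in> ?B c"
        by (auto simp: j(1) Bs_def intro: in_translate_mono)
    qed
    have bd': "f0 t \<in> ?A c" if "c \<in> grid d m" "gcell d m c \<subseteq> cube_boundary d" "t \<in> gcell d m c" for c t
      using bd[OF that] E0Es by (auto intro: in_translate_mono)
    obtain F where F: "continuous_map (cube d) (ES (carrier G)) F" "\<And>t. t \<in> cube_boundary d \<Longrightarrow> F t = f0 t"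
      "\<And>c t. c \<in> grid d m \<Longrightarrow> t \<in> gcell d m c \<Longrightarrow> F t \<in> ?A c"
      by (rule grid_extension[OF m fill mono f0 bd']) (assumption+, rule that)
    have "in_translate G (fiber (qc c)) (Es d) (supp (F t))" if "c \<in> grid d m" "t \<in> gcell d m c" for c t
      using F(3)[OF that] Es_mono[OF gdim_le[of d c]] by (auto intro: in_translate_mono)
    then show "\<exists>F. continuous_map (cube d) (ES (carrier G)) F \<and> (\<forall>t\<in>cube_boundary d. F t = f0 t) \<and>
        (\<forall>c\<in>grid d m. \<forall>t\<in>gcell d m c. in_translate G (fiber (qc c)) (Es d) (supp (F t)))"
      using F(1,2) by blast
  qed
  then show thesis
    using that cEB by blast
qed

end

lemma Sigma_topE:
  assumes "lch_group G T" "\<psi> \<in> Sigma_top n G T" "k < n" "compactin T C" "in_translate G (halfspace G \<psi>) C {v}"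
  obtains D where "compactin T D" "C \<subseteq> D"
    "\<And>f. f \<in> loops k (tspace G (halfspace G \<psi>) C) (vtx (carrier G) v) \<Longrightarrow>
      homotopic_rel k (vtx (carrier G) v) (tspace G (halfspace G \<psi>) D) f (\<lambda>_. vtx (carrier G) v)"
proof -
  have "\<exists>D. compactin T D \<and> C \<subseteq> D \<and> (\<forall>f\<in>loops k (tspace G (halfspace G \<psi>) C) (vtx (carrier G) v).
         homotopic_rel k (vtx (carrier G) v) (tspace G (halfspace G \<psi>) D) f (\<lambda>_. vtx (carrier G) v))"
    using assms(2)[unfolded Sigma_top_iff[OF assms(1)]] assms(3-5) by simp
  then show thesis
    using that by (elim exE conjE) simp
qed

lemma Sigma_topI:
  assumes "lch_group G T" "character G T \<psi>"
    and "\<And>v k C. k < n \<Longrightarrow> compactin T C \<Longrightarrow> in_translate G (halfspace G \<psi>) C {v} \<Longrightarrow>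
      \<exists>D. compactin T D \<and> (\<forall>f\<in>loops k (tspace G (halfspace G \<psi>) C) (vtx (carrier G) v).
        homotopic_rel k (vtx (carrier G) v) (tspace G (halfspace G \<psi>) (C \<union> D)) f (\<lambda>_. vtx (carrier G) v))"
  shows "\<psi> \<in> Sigma_top n G T"
  unfolding Sigma_top_iff[OF assms(1)]
proof (intro conjI allI impI)
  fix v k C
  assume kC: "k < n" "compactin T C" "in_translate G (halfspace G \<psi>) C {v}"
  from assms(3)[OF kC] obtain D where D: "compactin T D"
    "\<forall>f\<in>loops k (tspace G (halfspace G \<psi>) C) (vtx (carrier G) v).
        homotopic_rel k (vtx (carrier G) v) (tspace G (halfspace G \<psi>) (C \<union> D)) f (\<lambda>_. vtx (carrier G) v)"
    by (elim exE conjE)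
  show "\<exists>D. compactin T D \<and> C \<subseteq> D \<and> (\<forall>f\<in>loops k (tspace G (halfspace G \<psi>) C) (vtx (carrier G) v).
      homotopic_rel k (vtx (carrier G) v) (tspace G (halfspace G \<psi>) D) f (\<lambda>_. vtx (carrier G) v))"
    using compactin_Un[OF kC(2) D(1)] D(2) by (intro exI[of _ "C \<union> D"] conjI) simp_all
qed (rule assms(2))

lemma continuous_map_tspace_mono:
  "H \<subseteq> H' \<Longrightarrow> C \<subseteq> C' \<Longrightarrow> continuous_map (tspace G H C) (tspace G H' C') (\<lambda>x. x)"
  by (auto simp: continuous_map_in_subtopology intro!: continuous_map_from_subtopology intro: in_translate_mono)

lemma homotopic_rel_tspace_mono:
  assumes "homotopic_rel k x (tspace G H C) f g" "C \<subseteq> C'"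
  shows "homotopic_rel k x (tspace G H C') f g"
  using homotopic_rel_compose_left[OF assms(1) continuous_map_tspace_mono[OF order_refl assms(2)] refl]
  by (simp add: o_def)

lemma loops_tspace_mono:
  assumes "f \<in> loops k (tspace G H C) x" "C \<subseteq> C'"
  shows "f \<in> loops k (tspace G H C') x"
  using loops_compose[OF assms(1) continuous_map_tspace_mono[OF order_refl assms(2)] refl] by (simp add: o_def)

lemma const_loop: "x \<in> topspace X \<Longrightarrow> (\<lambda>_. x) \<in> loops k X x"
  by (auto simp: loops_def)

lemma vtx_in_tspace: "in_translate G H C {v} \<Longrightarrow> v \<in> carrier G \<Longrightarrow> vtx (carrier G) v \<in> topspace (tspace G H C)"
  using vertex_in[of "\<lambda>F. F \<subseteq> carrier G" v] by simp

lemma (in group) in_translate_carrier: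
  assumes "in_translate G H C F" "H \<subseteq> carrier G" "C \<subseteq> carrier G"
  shows "F \<subseteq> carrier G"
proof
  fix x assume "x \<in> F"
  then obtain h c where "h \<in> H" "c \<in> C" "x = h \<otimes> c"
    using assms(1) unfolding in_translate_def by blast
  then show "x \<in> carrier G"
    using assms(2,3) by auto
qed

lemma halfspace_subset: "halfspace G \<psi> \<subseteq> carrier G"
  by (auto simp: halfspace_def)

section \<open>The three implications for a fixed character\<close>

context lch_exact
begin

context
  fixes \<psi> :: "'q \<Rightarrow> real"
  assumes char: "character Q TQ \<psi>"
begin

abbreviation "HQ \<equiv> halfspace Q \<psi>"
abbreviation "HG \<equiv> halfspace G (\<psi> \<circ> p)"

lemma character_comp: "character G TG (\<psi> \<circ> p)"
  using char continuous_map_compose[OF continuous_p] by (auto simp: character_def)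

lemma HG_iff: "h \<in> HG \<longleftrightarrow> h \<in> carrier G \<and> p h \<in> HQ"
  by (auto simp: halfspace_def)

lemma fiber_HG: "q \<in> HQ \<Longrightarrow> fiber q \<subseteq> HG"
  by (auto simp: fiber_def HG_iff)

lemma in_translate_p:
  assumes "in_translate G HG C F" "C \<subseteq> carrier G"
  shows "in_translate Q HQ (p ` C) (p ` F)"
  using in_translate_image[OF p.homh halfspace_subset assms(2) _ order_refl assms(1)] HG_iff by blast

lemma p_Pi: "p \<in> carrier G \<rightarrow> carrier Q"
  by auto

lemma continuous_map_p:
  assumes "C \<subseteq> carrier G"
  shows "continuous_map (tspace G HG C) (tspace Q HQ (p ` C)) (vmap (carrier Q) p)"
  by (rule continuous_map_vmap_sspace[OF p_Pi], rule in_translate_p[OF _ assms])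

text \<open>With x = g c and p x = q p(\<mu>), the element h = x \<mu>^-1 lies over
  \<open>q\<close>, and g e = h \<mu> c^-1 e. One vertex over q M thus determines the fibre,
  although the translating element \<open>g\<close> is unknown.\<close>

lemma in_translate_fiberI:
  assumes "in_translate G HG C F" "x \<in> F" "p x \<in> (\<lambda>y. q \<otimes>\<^bsub>Q\<^esub> y) ` M" "M \<subseteq> p ` M'"
    and sub: "C \<subseteq> carrier G" "M' \<subseteq> carrier G" "q \<in> carrier Q"
  shows "in_translate G (fiber q) (M' <#>\<^bsub>G\<^esub> ((\<lambda>x. inv\<^bsub>G\<^esub> x) ` C <#>\<^bsub>G\<^esub> C)) F"
proof -
  obtain g where g: "g \<in> HG" "F \<subseteq> (\<lambda>x. g \<otimes>\<^bsub>G\<^esub> x) ` C"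
    using assms(1) by (auto simp: in_translate_def)
  obtain c where c: "c \<in> C" "x = g \<otimes>\<^bsub>G\<^esub> c"
    using g(2) assms(2) by blast
  obtain \<mu> where \<mu>: "\<mu> \<in> M'" "p x = q \<otimes>\<^bsub>Q\<^esub> p \<mu>"
    using assms(3,4) by blast
  have mem: "g \<in> carrier G" "c \<in> carrier G" "\<mu> \<in> carrier G" "x \<in> carrier G"
    using g(1) c sub \<mu>(1) by (auto simp: HG_iff)
  let ?h = "x \<otimes>\<^bsub>G\<^esub> inv\<^bsub>G\<^esub> \<mu>"
  have "p ?h = q"
    using mem \<mu>(2) sub(3) by (simp add: Q.m_assoc)
  then have "?h \<in> fiber q"
    using mem by (simp add: fiber_def)
  moreover have "F \<subseteq> (\<lambda>x. ?h \<otimes>\<^bsub>G\<^esub> x) ` (M' <#>\<^bsub>G\<^esub> ((\<lambda>x. inv\<^bsub>G\<^esub> x) ` C <#>\<^bsub>G\<^esub> C))"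
  proof
    fix y assume "y \<in> F"
    then obtain e where e: "e \<in> C" "y = g \<otimes>\<^bsub>G\<^esub> e"
      using g(2) by blast
    then have eG: "e \<in> carrier G"
      using sub(1) by blast
    have cancel: "inv\<^bsub>G\<^esub> a \<otimes>\<^bsub>G\<^esub> (a \<otimes>\<^bsub>G\<^esub> z) = z" "a \<otimes>\<^bsub>G\<^esub> (inv\<^bsub>G\<^esub> a \<otimes>\<^bsub>G\<^esub> z) = z"
      if "a \<in> carrier G" "z \<in> carrier G" for a z
      using that by (simp_all add: G.m_assoc[symmetric])
    have "?h \<otimes>\<^bsub>G\<^esub> (\<mu> \<otimes>\<^bsub>G\<^esub> (inv\<^bsub>G\<^esub> c \<otimes>\<^bsub>G\<^esub> e)) = x \<otimes>\<^bsub>G\<^esub> (inv\<^bsub>G\<^esub> c \<otimes>\<^bsub>G\<^esub> e)"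
      using mem eG by (simp add: G.m_assoc cancel)
    also have "\<dots> = y"
      using mem eG e(2) unfolding c(2) by (simp add: G.m_assoc cancel)
    finally have "y = ?h \<otimes>\<^bsub>G\<^esub> (\<mu> \<otimes>\<^bsub>G\<^esub> (inv\<^bsub>G\<^esub> c \<otimes>\<^bsub>G\<^esub> e))"
      by (rule sym)
    moreover have "\<mu> \<otimes>\<^bsub>G\<^esub> (inv\<^bsub>G\<^esub> c \<otimes>\<^bsub>G\<^esub> e) \<in> M' <#>\<^bsub>G\<^esub> ((\<lambda>x. inv\<^bsub>G\<^esub> x) ` C <#>\<^bsub>G\<^esub> C)"
      using \<mu>(1) c(1) e(1) unfolding set_mult_def by blast
    ultimately show "y \<in> (\<lambda>x. ?h \<otimes>\<^bsub>G\<^esub> x) ` (M' <#>\<^bsub>G\<^esub> ((\<lambda>x. inv\<^bsub>G\<^esub> x) ` C <#>\<^bsub>G\<^esub> C))"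
      by (rule image_eqI)
  qed
  ultimately show ?thesis
    unfolding in_translate_def by blast
qed

text \<open>Since p s is the identity, \<open>s\<close> maps the half-space of Q into that of G. A
  loop is pushed forward by \<open>s\<close>, contracted there, and the null homotopy is projected
  by \<open>p\<close>, with a compact set that depends on \<open>s\<close> and \<open>C\<close>
  only.\<close>

lemma Sigma_top_of_section:
  assumes "has_section G TG Q TQ p" "\<psi> \<circ> p \<in> Sigma_top n G TG"
  shows "\<psi> \<in> Sigma_top n Q TQ"
proof (rule Sigma_topI[OF lch(3) char])
  fix v k C
  assume k: "k < n" and C: "compactin TQ C" and v: "in_translate Q HQ C {v}"
  obtain s where s: "s \<in> hom Q G" "continuous_map TQ TG s" "\<And>x. x \<in> carrier Q \<Longrightarrow> p (s x) = x"
    using assms(1) by (auto simp: has_section_def)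
  have CQ: "C \<subseteq> carrier Q"
    by (rule compact_carrier(3)[OF C])
  have vQ: "v \<in> carrier Q"
    using Q.in_translate_carrier[OF v halfspace_subset CQ] by simp
  have sPi: "s \<in> carrier Q \<rightarrow> carrier G"
    using s(1) by (auto simp: hom_def)
  have sH: "s ` HQ \<subseteq> HG"
  proof
    fix g assume "g \<in> s ` HQ"
    then obtain h where h: "h \<in> HQ" "g = s h" by blast
    moreover have "h \<in> carrier Q"
      by (rule subsetD[OF halfspace_subset h(1)])
    ultimately show "g \<in> HG"
      using sPi s(3) by (auto simp: HG_iff)
  qed
  have trs: "in_translate G HG (s ` C) (s ` F)" if "in_translate Q HQ C F" for F
    by (rule in_translate_image[OF s(1) halfspace_subset CQ sH order_refl that])
  have sC: "compactin TG (s ` C)"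
    by (rule image_compactin[OF C s(2)])
  obtain D where D: "compactin TG D" "s ` C \<subseteq> D"
    "\<And>f. f \<in> loops k (tspace G HG (s ` C)) (vtx (carrier G) (s v)) \<Longrightarrow>
      homotopic_rel k (vtx (carrier G) (s v)) (tspace G HG D) f (\<lambda>_. vtx (carrier G) (s v))"
    using Sigma_topE[OF lch(2) assms(2) k sC, of "s v"] trs[OF v] by auto
  have DG: "D \<subseteq> carrier G"
    by (rule compact_carrier(2)[OF D(1)])
  have vs: "vmap (carrier G) s (vtx (carrier Q) v) = vtx (carrier G) (s v)"
    "vmap (carrier Q) p (vtx (carrier G) (s v)) = vtx (carrier Q) v"
    using vmap_vtx[OF sPi] vmap_vtx[OF p_Pi] s(3)[OF vQ] by simp_all
  show "\<exists>D. compactin TQ D \<and> (\<forall>f\<in>loops k (tspace Q HQ C) (vtx (carrier Q) v).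
      homotopic_rel k (vtx (carrier Q) v) (tspace Q HQ (C \<union> D)) f (\<lambda>_. vtx (carrier Q) v))"
  proof (intro exI conjI ballI)
    show "compactin TQ (p ` D)"
      by (rule image_compactin[OF D(1) continuous_p])
    fix f assume f: "f \<in> loops k (tspace Q HQ C) (vtx (carrier Q) v)"
    have cs: "continuous_map (tspace Q HQ C) (tspace G HG (s ` C)) (vmap (carrier G) s)"
      by (rule continuous_map_vmap_sspace[OF sPi], rule trs)
    have "homotopic_rel k (vtx (carrier G) (s v)) (tspace G HG D) (vmap (carrier G) s \<circ> f) (\<lambda>_. vtx (carrier G) (s v))"
      by (rule D(3)[OF loops_compose[OF f cs vs(1)]])
    from homotopic_rel_compose_left[OF this continuous_map_p[OF DG] vs(2)]
    have "homotopic_rel k (vtx (carrier Q) v) (tspace Q HQ (p ` D)) f (\<lambda>_. vtx (carrier Q) v)"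
    proof (rule homotopic_rel_eq)
      fix t assume "t \<in> topspace (cube k)"
      then have "f t \<in> topspace (ES (carrier Q))"
        using loops_in[OF f] by simp
      then show "f t = (vmap (carrier Q) p \<circ> (vmap (carrier G) s \<circ> f)) t"
        using s(3) by (simp add: vmap_vmap[OF sPi p_Pi] vmap_id)
    qed (simp add: vs)
    then show "homotopic_rel k (vtx (carrier Q) v) (tspace Q HQ (C \<union> p ` D)) f (\<lambda>_. vtx (carrier Q) v)"
      by (rule homotopic_rel_tspace_mono) blast
  qed
qed

text \<open>The projected loop is contracted in translates of some compact \<open>D\<close>; this
  null homotopy, seen as a cube of dimension k + 1, labels the cells of a grid and is lifted with
  the given loop as boundary value. The lift is itself a null homotopy of the loop.\<close>

lemma Sigma_top_pullback:
  assumes tC: "type_C n N TN" and S: "\<psi> \<in> Sigma_top n Q TQ"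
  shows "\<psi> \<circ> p \<in> Sigma_top n G TG"
proof (rule Sigma_topI[OF lch(2) character_comp])
  fix v k C
  assume k: "k < n" and C: "compactin TG C" and v: "in_translate G HG C {v}"
  have CG: "C \<subseteq> carrier G"
    by (rule compact_carrier(2)[OF C])
  have vG: "v \<in> carrier G"
    using G.in_translate_carrier[OF v halfspace_subset CG] by simp
  let ?x = "vtx (carrier G) v" and ?y = "vtx (carrier Q) (p v)"
  have pv: "vmap (carrier Q) p ?x = ?y"
    by (rule vmap_vtx[OF p_Pi])
  have pC: "compactin TQ (p ` C)"
    by (rule image_compactin[OF C continuous_p])
  obtain D where D: "compactin TQ D" "p ` C \<subseteq> D"
    "\<And>f. f \<in> loops k (tspace Q HQ (p ` C)) ?y \<Longrightarrow> homotopic_rel k ?y (tspace Q HQ D) f (\<lambda>_. ?y)"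
    using Sigma_topE[OF lch(3) S k pC, of "p v"] in_translate_p[OF v CG] by auto
  have DQ: "D \<subseteq> carrier Q"
    by (rule compact_carrier(3)[OF D(1)])
  let ?M = "thicken Q D"
  have M: "compactin TQ ?M" "?M \<subseteq> carrier Q"
    using compactin_thicken[OF lch(3) D(1)] compact_carrier(3) by blast+
  obtain M' where M': "compactin TG M'" "?M \<subseteq> p ` M'"
    by (rule compact_lift[OF M(1)])
  have M'G: "M' \<subseteq> carrier G"
    by (rule compact_carrier(2)[OF M'(1)])
  \<comment> \<open>The set of \<open>in_translate_fiberI\<close>: it takes a translate of
    \<open>C\<close> with a vertex over q M into a translate by the fibre over
    \<open>q\<close>.\<close>
  let ?E0 = "M' <#>\<^bsub>G\<^esub> ((\<lambda>x. inv\<^bsub>G\<^esub> x) ` C <#>\<^bsub>G\<^esub> C)"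
  have E0: "compactin TG ?E0"
    using M'(1) C by (intro compactin_set_mult[OF lch(2)] compactin_set_inv[OF lch(2)])
  \<comment> \<open>The cube to be lifted is the homotopy, of dimension one more than the
    loop.\<close>
  have kn: "Suc k \<le> n" using k by simp
  obtain E where E: "compactin TG E" "lifts (Suc k) ?E0 (quotients Q ?M) E"
    by (rule lift_extension[OF tC kn E0 compactin_quotients[OF lch(3) M(1)]])
  show "\<exists>D. compactin TG D \<and> (\<forall>f\<in>loops k (tspace G HG C) ?x. homotopic_rel k ?x (tspace G HG (C \<union> D)) f (\<lambda>_. ?x))"
  proof (intro exI[of _ E] conjI ballI E(1))
    fix f assume f: "f \<in> loops k (tspace G HG C) ?x"
    have x: "?x \<in> topspace (tspace G HG C)"
      by (rule vtx_in_tspace[OF v vG])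
    have "homotopic_rel k ?y (tspace Q HQ D) (vmap (carrier Q) p \<circ> f) (\<lambda>_. ?y)"
      by (rule D(3)[OF loops_compose[OF f continuous_map_p[OF CG] pv]])
    then obtain \<Phi> where \<Phi>: "continuous_map (cube (Suc k)) (tspace Q HQ D) \<Phi>"
      "\<And>t. t \<in> topspace (cube (Suc k)) \<Longrightarrow> t k = 0 \<Longrightarrow> \<Phi> t = (vmap (carrier Q) p \<circ> f) (restrict t {..<k})"
      "\<And>t. t \<in> topspace (cube (Suc k)) \<Longrightarrow> t k = 1 \<Longrightarrow> \<Phi> t = ?y"
      "\<And>t. t \<in> topspace (cube (Suc k)) \<Longrightarrow> restrict t {..<k} \<in> cube_boundary k \<Longrightarrow> \<Phi> t = ?y"
      by (rule cube_of_homotopic_rel) (rule that)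
    obtain m qc where m: "m > 0" and qc: "\<And>c. c \<in> grid (Suc k) m \<Longrightarrow> qc c \<in> HQ"
      "\<And>c t. c \<in> grid (Suc k) m \<Longrightarrow> t \<in> gcell (Suc k) m c \<Longrightarrow> supp (\<Phi> t) \<subseteq> (\<lambda>x. qc c \<otimes>\<^bsub>Q\<^esub> x) ` ?M"
      by (rule Q.grid_translates[OF \<Phi>(1) halfspace_subset DQ]) (rule that)
    have qcQ: "qc c \<in> carrier Q" if "c \<in> grid (Suc k) m" for c
      by (rule subsetD[OF halfspace_subset qc(1)[OF that]])
    have \<Phi>ne: "supp (\<Phi> t) \<noteq> {}" if "t \<in> gcell (Suc k) m c" for t c
      using continuous_map_in[OF \<Phi>(1), of t] that supp_ES by (auto simp: gcell_def)
    \<comment> \<open>The loop at the bottom, the base vertex on top and sides; the two equal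
      branches match the general form of a prism boundary.\<close>
    define f0 where "f0 t = (if t k = 0 then f (restrict t {..<k}) else if t k = 1 then ?x else ?x)" for t
    have f0: "continuous_map (subtopology (cube (Suc k)) (cube_boundary (Suc k))) (tspace G HG C) f0"
      unfolding f0_def by (rule continuous_map_prism_boundary[OF f const_loop[OF x] x])
    have f0ES: "continuous_map (subtopology (cube (Suc k)) (cube_boundary (Suc k))) (ES (carrier G)) f0"
      and f0C: "\<And>t. t \<in> cube_boundary (Suc k) \<Longrightarrow> f0 t \<in> topspace (ES (carrier G)) \<and> in_translate G HG C (supp (f0 t))"
      using f0 continuous_map_in[OF f0] cube_boundary_subset[of "Suc k"] by (auto simp: continuous_map_in_subtopology)
    have pf0: "vmap (carrier Q) p (f0 t) = \<Phi> t" if t: "t \<in> cube_boundary (Suc k)" for t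
    proof -
      have tc: "t \<in> topspace (cube (Suc k))"
        using t cube_boundary_subset by blast
      then show ?thesis
        using cube_boundary_Suc[OF tc] t \<Phi>(2-4)[OF tc] pv by (auto simp: f0_def)
    qed
    obtain F where F: "continuous_map (cube (Suc k)) (ES (carrier G)) F" "\<And>t. t \<in> cube_boundary (Suc k) \<Longrightarrow> F t = f0 t"
      "\<And>c t. c \<in> grid (Suc k) m \<Longrightarrow> t \<in> gcell (Suc k) m c \<Longrightarrow> in_translate G (fiber (qc c)) E (supp (F t))"
    proof (rule liftsE[OF E(2) m qcQ _ f0ES])
      show "\<exists>\<mu>\<in>quotients Q ?M. qc c' = qc c \<otimes>\<^bsub>Q\<^esub> \<mu>"
        if "c \<in> grid (Suc k) m" "c' \<in> grid (Suc k) m" "gface (Suc k) c' c" for c c'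
        by (rule Q.translates_overlap[where F = \<Phi>, OF that(2) m that(3) M(2) qcQ[OF that(1)] qcQ[OF that(2)]
              qc(2)[OF that(1)] qc(2)[OF that(2)] \<Phi>ne])
      show "in_translate G (fiber (qc c)) ?E0 (supp (f0 t))"
        if c: "c \<in> grid (Suc k) m" "gcell (Suc k) m c \<subseteq> cube_boundary (Suc k)" "t \<in> gcell (Suc k) m c" for c t
      proof -
        have tb: "t \<in> cube_boundary (Suc k)"
          using c by blast
        obtain u where u: "u \<in> supp (f0 t)"
          using f0C[OF tb] supp_ES by blast
        have "p ` supp (f0 t) \<subseteq> (\<lambda>x. qc c \<otimes>\<^bsub>Q\<^esub> x) ` ?M"
          using qc(2)[OF c(1,3)] pf0[OF tb] supp_vmap[OF p_Pi, of "f0 t"] f0C[OF tb] by simp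
        \<comment> \<open>The label controls only the projected support; the vertex \<open>u\<close>
          ties the translate in G to the fibre over \<open>qc c\<close>.\<close>
        then have "p u \<in> (\<lambda>x. qc c \<otimes>\<^bsub>Q\<^esub> x) ` ?M"
          using u by blast
        then show ?thesis
          using f0C[OF tb] u M'(2) CG M'G qcQ[OF c(1)] by (intro in_translate_fiberI) auto
      qed
    qed (assumption | rule that)+
    \<comment> \<open>All labels lie in \<open>HQ\<close>, and a fibre over such a label lies in
      \<open>HG\<close>; here the half-space condition passes from Q to G.\<close>
    have "in_translate G HG (C \<union> E) (supp (F t))" if t: "t \<in> topspace (cube (Suc k))" for t
    proof -
      obtain c where c: "c \<in> grid (Suc k) m" "t \<in> gcell (Suc k) m c"
        by (rule gcell_cover[OF t m])
      show ?thesis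
        by (rule in_translate_mono[OF F(3)[OF c] fiber_HG[OF qc(1)[OF c(1)]]]) blast
    qed
    then have "continuous_map (cube (Suc k)) (tspace G HG (C \<union> E)) F"
      using F(1) by (auto simp: continuous_map_in_subtopology)
    then show "homotopic_rel k ?x (tspace G HG (C \<union> E)) f (\<lambda>_. ?x)"
      using loops_tspace_mono[OF f] loops_tspace_mono[OF const_loop[OF x]] F(2)
      by (intro homotopic_rel_of_prism[where F = F]) (auto simp: f0_def)
  qed
qed

lemma in_translate_fiber_vertex:
  assumes "w \<in> carrier G" "p w \<in> (\<lambda>y. q \<otimes>\<^bsub>Q\<^esub> y) ` M" "M \<subseteq> p ` M'" "M' \<subseteq> carrier G" "q \<in> carrier Q"
  shows "in_translate G (fiber q) M' {w}"
proof -
  obtain \<mu> where \<mu>: "\<mu> \<in> M'" "p w = q \<otimes>\<^bsub>Q\<^esub> p \<mu>"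
    using assms(2,3) by blast
  then have mem: "\<mu> \<in> carrier G"
    using assms(4) by blast
  have "p (w \<otimes>\<^bsub>G\<^esub> inv\<^bsub>G\<^esub> \<mu>) = q"
    using mem assms(1,5) \<mu>(2) by (simp add: Q.m_assoc)
  then have "w \<otimes>\<^bsub>G\<^esub> inv\<^bsub>G\<^esub> \<mu> \<in> fiber q"
    using mem assms(1) by (simp add: fiber_def)
  moreover have "w = (w \<otimes>\<^bsub>G\<^esub> inv\<^bsub>G\<^esub> \<mu>) \<otimes>\<^bsub>G\<^esub> \<mu>"
    using mem assms(1) by (simp add: G.m_assoc)
  ultimately show ?thesis
    using \<mu>(1) unfolding in_translate_def by blast
qed

lemma p_fiber_translate:
  assumes "in_translate G (fiber q) E F" "E \<subseteq> carrier G"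
  shows "p ` F \<subseteq> (\<lambda>y. q \<otimes>\<^bsub>Q\<^esub> y) ` p ` E"
proof -
  obtain h where h: "h \<in> fiber q" "F \<subseteq> (\<lambda>x. h \<otimes>\<^bsub>G\<^esub> x) ` E"
    using assms(1) by (auto simp: in_translate_def)
  have "p (h \<otimes>\<^bsub>G\<^esub> e) = q \<otimes>\<^bsub>Q\<^esub> p e" if "e \<in> E" for e
    using that h(1) assms(2) by (auto simp: fiber_def)
  then show ?thesis
    using h(2) by blast
qed

text \<open>The loop \<open>f\<close> is lifted to a loop \<open>h\<close> in G, which is contracted
  there, and the contraction is projected. It remains to join \<open>f\<close> to the projection of
  \<open>h\<close>: on each cell both stay in translates of a compact set by the same label, so the
  prism between them is filled inside full simplices.\<close>

lemma Sigma_top_descend: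
  assumes tC: "type_C n N TN" and S: "\<psi> \<circ> p \<in> Sigma_top (n + 1) G TG"
  shows "\<psi> \<in> Sigma_top (n + 1) Q TQ"
proof (rule Sigma_topI[OF lch(3) char])
  fix v k C
  assume k: "k < n + 1" and C: "compactin TQ C" and v: "in_translate Q HQ C {v}"
  have CQ: "C \<subseteq> carrier Q"
    by (rule compact_carrier(3)[OF C])
  have vQ: "v \<in> carrier Q"
    using Q.in_translate_carrier[OF v halfspace_subset CQ] by simp
  let ?M = "thicken Q C"
  have M: "compactin TQ ?M" "?M \<subseteq> carrier Q"
    using compactin_thicken[OF lch(3) C] compact_carrier(3) by blast+
  obtain M' where M': "compactin TG M'" "?M \<subseteq> p ` M'"
    by (rule compact_lift[OF M(1)])
  have M'G: "M' \<subseteq> carrier G"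
    by (rule compact_carrier(2)[OF M'(1)])
  obtain w where w: "w \<in> carrier G" "p w = v"
    using p_surj[OF vQ] by blast
  let ?x = "vtx (carrier Q) v" and ?y = "vtx (carrier G) w"
  have kn: "k \<le> n" using k by simp
  obtain E where E: "compactin TG E" "lifts k M' (quotients Q ?M) E"
    by (rule lift_extension[OF tC kn M'(1) compactin_quotients[OF lch(3) M(1)]])
  have EG: "E \<subseteq> carrier G"
    by (rule compact_carrier(2)[OF E(1)])
  \<comment> \<open>\<open>M'\<close> accommodates the base vertex \<open>w\<close>,
    \<open>E\<close> the lifted loop.\<close>
  let ?E1 = "M' \<union> E"
  have E1: "compactin TG ?E1"
    by (rule compactin_Un[OF M'(1) E(1)])
  have tw: "in_translate G HG ?E1 {w}"
  proof -
    obtain h c where h: "h \<in> HQ" "c \<in> C" "v = h \<otimes>\<^bsub>Q\<^esub> c"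
      using v by (auto simp: in_translate_def)
    then have "p w \<in> (\<lambda>y. h \<otimes>\<^bsub>Q\<^esub> y) ` ?M"
      using Q.subset_thicken[OF CQ] w(2) by blast
    from in_translate_fiber_vertex[OF w(1) this M'(2) M'G subsetD[OF halfspace_subset h(1)]]
    show ?thesis
      by (rule in_translate_mono[OF _ fiber_HG[OF h(1)]]) blast
  qed
  have kn1: "k < n + 1" using k by simp
  obtain D where D: "compactin TG D" "?E1 \<subseteq> D"
    "\<And>f. f \<in> loops k (tspace G HG ?E1) ?y \<Longrightarrow> homotopic_rel k ?y (tspace G HG D) f (\<lambda>_. ?y)"
    using Sigma_topE[OF lch(2) S kn1 E1 tw] by metis
  have DG: "D \<subseteq> carrier G"
    by (rule compact_carrier(2)[OF D(1)])
  let ?P = "?M \<union> p ` E"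
  \<comment> \<open>\<open>?P\<close> holds the supports of \<open>f\<close> and of the projected
    lift relative to the label of a cell; the factor on the left absorbs the change of label from a
    face to the cell.\<close>
  let ?R = "quotients Q ?M <#>\<^bsub>Q\<^esub> ?P"
  have P: "compactin TQ ?P" "?P \<subseteq> carrier Q"
    using compactin_Un[OF M(1) image_compactin[OF E(1) continuous_p]] compact_carrier(3) by blast+
  have qM: "compactin TQ (quotients Q ?M)" "quotients Q ?M \<subseteq> carrier Q"
    using compactin_quotients[OF lch(3) M(1)] compact_carrier(3) by blast+
  let ?D = "p ` D \<union> ?R"
  have cD: "compactin TQ ?D"
    by (intro compactin_Un image_compactin[OF D(1) continuous_p] compactin_set_mult[OF lch(3)] qM(1) P(1))
  have yx: "vmap (carrier Q) p ?y = ?x"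
    using vmap_vtx[OF p_Pi] w(2) by simp
  show "\<exists>D. compactin TQ D \<and> (\<forall>f\<in>loops k (tspace Q HQ C) ?x. homotopic_rel k ?x (tspace Q HQ (C \<union> D)) f (\<lambda>_. ?x))"
  proof (intro exI[of _ ?D] conjI ballI cD)
    fix f assume f: "f \<in> loops k (tspace Q HQ C) ?x"
    have fc: "continuous_map (cube k) (tspace Q HQ C) f" and fb: "\<And>t. t \<in> cube_boundary k \<Longrightarrow> f t = ?x"
      using f by (auto simp: loops_def)
    obtain m qc where m: "m > 0" and qc: "\<And>c. c \<in> grid k m \<Longrightarrow> qc c \<in> HQ"
      "\<And>c t. c \<in> grid k m \<Longrightarrow> t \<in> gcell k m c \<Longrightarrow> supp (f t) \<subseteq> (\<lambda>x. qc c \<otimes>\<^bsub>Q\<^esub> x) ` ?M"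
      by (rule Q.grid_translates[OF fc halfspace_subset CQ]) (rule that)
    have qcQ: "qc c \<in> carrier Q" if "c \<in> grid k m" for c
      by (rule subsetD[OF halfspace_subset qc(1)[OF that]])
    have fne: "supp (f t) \<noteq> {}" if "t \<in> gcell k m c" for t c
      using continuous_map_in[OF fc, of t] that supp_ES by (auto simp: gcell_def)
    have overlap: "\<exists>\<mu>\<in>quotients Q ?M. qc c' = qc c \<otimes>\<^bsub>Q\<^esub> \<mu>"
      if "c \<in> grid k m" "c' \<in> grid k m" "gface k c' c" for c c'
      by (rule Q.translates_overlap[where F = f, OF that(2) m that(3) M(2) qcQ[OF that(1)] qcQ[OF that(2)]
            qc(2)[OF that(1)] qc(2)[OF that(2)] fne])
    have yES: "?y \<in> topspace (ES (carrier G))"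
      using vertex_in[of "\<lambda>F. F \<subseteq> carrier G" w] w(1) by simp
    have y_cont: "continuous_map (subtopology (cube k) (cube_boundary k)) (ES (carrier G)) (\<lambda>_. ?y)"
      using yES by simp
    \<comment> \<open>With the vertex of \<open>w\<close> prescribed on the whole boundary of the
      cube, the lift is a loop based there.\<close>
    obtain h where h: "continuous_map (cube k) (ES (carrier G)) h" "\<And>t. t \<in> cube_boundary k \<Longrightarrow> h t = ?y"
      "\<And>c t. c \<in> grid k m \<Longrightarrow> t \<in> gcell k m c \<Longrightarrow> in_translate G (fiber (qc c)) E (supp (h t))"
    proof (rule liftsE[OF E(2) m qcQ overlap y_cont])
      show "in_translate G (fiber (qc c)) M' (supp ?y)"
        if c: "c \<in> grid k m" "gcell k m c \<subseteq> cube_boundary k" "t \<in> gcell k m c" for c t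
      proof -
        have "p w \<in> (\<lambda>x. qc c \<otimes>\<^bsub>Q\<^esub> x) ` ?M"
          using qc(2)[OF c(1,3)] fb[of t] c w(2) by auto
        then show ?thesis
          using in_translate_fiber_vertex[OF w(1) _ M'(2) M'G qcQ[OF c(1)]] by simp
      qed
    qed (assumption | rule that)+
    have h_tr: "in_translate G HG ?E1 (supp (h t))" if t: "t \<in> topspace (cube k)" for t
    proof -
      obtain c where c: "c \<in> grid k m" "t \<in> gcell k m c"
        by (rule gcell_cover[OF t m])
      show ?thesis
        by (rule in_translate_mono[OF h(3)[OF c] fiber_HG[OF qc(1)[OF c(1)]]]) blast
    qed
    have h_loop: "h \<in> loops k (tspace G HG ?E1) ?y"
      using h(1,2) h_tr by (auto simp: loops_def continuous_map_in_subtopology)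
    let ?g = "vmap (carrier Q) p \<circ> h"
    have g_null: "homotopic_rel k ?x (tspace Q HQ (p ` D)) ?g (\<lambda>_. ?x)"
      using homotopic_rel_compose_left[OF D(3)[OF h_loop] continuous_map_p[OF DG] yx] yx by (simp add: o_def)
    have E1G: "?E1 \<subseteq> carrier G"
      using M'G EG by blast
    have g_loop: "?g \<in> loops k (tspace Q HQ (p ` ?E1)) ?x"
      by (rule loops_compose[OF h_loop continuous_map_p[OF E1G] yx])
    \<comment> \<open>The prism has its own grid of dimension k + 1; \<open>bar\<close> projects a
      cell to the one of the base grid below it, which carries the label.\<close>
    define bar :: "(nat \<Rightarrow> nat) \<Rightarrow> nat \<Rightarrow> nat" where "bar c = restrict c {..<k}" for c
    have bar: "bar c \<in> grid k m" if "c \<in> grid (Suc k) m" for c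
      using that by (auto simp: bar_def grid_def PiE_iff)
    have bar_cell: "restrict t {..<k} \<in> gcell k m (bar c)" if "t \<in> gcell (Suc k) m c" for t c
      using that by (auto simp: bar_def gcell_def cube_restrict)
    have bar_face: "gface k (bar c') (bar c)" if "gface (Suc k) c' c" for c c'
      using that by (auto simp: bar_def gface_def)
    \<comment> \<open>The union over all faces of the base cell makes \<open>S\<close> monotone
      under faces, as the extension over the grid requires; a single translate would not be.\<close>
    define S where "S c = (\<Union>b\<in>{b \<in> grid k m. gface k b (bar c)}. (\<lambda>x. qc b \<otimes>\<^bsub>Q\<^esub> x) ` ?P)" for c
    have cell_S: "(\<lambda>x. qc (bar c) \<otimes>\<^bsub>Q\<^esub> x) ` ?P \<subseteq> S c" if "c \<in> grid (Suc k) m" for c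
    proof -
      have "gface k (bar c) (bar c)"
        by (simp add: gface_def)
      then show ?thesis
        using bar[OF that] unfolding S_def by blast
    qed
    have S_mono: "S c' \<subseteq> S c" if "gface (Suc k) c' c" for c c'
      using gface_trans[OF _ bar_face[OF that]] unfolding S_def by blast
    have S_R: "S c \<subseteq> (\<lambda>x. qc (bar c) \<otimes>\<^bsub>Q\<^esub> x) ` ?R" if c: "c \<in> grid (Suc k) m" for c
    proof
      fix x assume "x \<in> S c"
      then obtain b y where b: "b \<in> grid k m" "gface k b (bar c)" "y \<in> ?P" "x = qc b \<otimes>\<^bsub>Q\<^esub> y"
        unfolding S_def by blast
      obtain \<mu> where \<mu>: "\<mu> \<in> quotients Q ?M" "qc b = qc (bar c) \<otimes>\<^bsub>Q\<^esub> \<mu>"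
        using overlap[OF bar[OF c] b(1,2)] by blast
      have "\<mu> \<in> carrier Q" "y \<in> carrier Q"
        using \<mu>(1) qM(2) b(3) P(2) by blast+
      then have "x = qc (bar c) \<otimes>\<^bsub>Q\<^esub> (\<mu> \<otimes>\<^bsub>Q\<^esub> y)"
        using b(4) \<mu>(2) qcQ[OF bar[OF c]] by (simp add: Q.m_assoc)
      moreover have "\<mu> \<otimes>\<^bsub>Q\<^esub> y \<in> ?R"
        using \<mu>(1) b(3) unfolding set_mult_def by blast
      ultimately show "x \<in> (\<lambda>x. qc (bar c) \<otimes>\<^bsub>Q\<^esub> x) ` ?R"
        by (rule image_eqI)
    qed
    have S_carrier: "S c \<subseteq> carrier Q" for c
    proof
      fix x assume "x \<in> S c"
      then obtain b y where b: "b \<in> grid k m" "y \<in> ?P" "x = qc b \<otimes>\<^bsub>Q\<^esub> y"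
        unfolding S_def by blast
      then have "y \<in> carrier Q"
        using P(2) by blast
      then show "x \<in> carrier Q"
        using b qcQ by simp
    qed
    have f_S: "supp (f (restrict t {..<k})) \<subseteq> S c" if c: "c \<in> grid (Suc k) m" "t \<in> gcell (Suc k) m c" for c t
      using qc(2)[OF bar[OF c(1)] bar_cell[OF c(2)]] cell_S[OF c(1)] by blast
    have g_S: "supp (?g (restrict t {..<k})) \<subseteq> S c" if c: "c \<in> grid (Suc k) m" "t \<in> gcell (Suc k) m c" for c t
    proof -
      have rt: "restrict t {..<k} \<in> topspace (cube k)"
        using bar_cell[OF c(2)] by (simp add: gcell_def)
      have "p ` supp (h (restrict t {..<k})) \<subseteq> (\<lambda>y. qc (bar c) \<otimes>\<^bsub>Q\<^esub> y) ` p ` E"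
        by (rule p_fiber_translate[OF h(3)[OF bar[OF c(1)] bar_cell[OF c(2)]] EG])
      moreover have "supp (?g (restrict t {..<k})) = p ` supp (h (restrict t {..<k}))"
        using supp_vmap[OF p_Pi continuous_map_in[OF h(1) rt]] by simp
      moreover have "(\<lambda>y. qc (bar c) \<otimes>\<^bsub>Q\<^esub> y) ` p ` E \<subseteq> S c"
        by (rule order_trans[OF image_mono[OF Un_upper2] cell_S[OF c(1)]])
      ultimately show ?thesis
        by (simp only: order_trans)
    qed
    have S_ne: "S c \<noteq> {}" if c: "c \<in> grid (Suc k) m" for c
    proof -
      obtain t where t: "t \<in> gcell (Suc k) m c"
        using gcell_nonempty[OF c m] by blast
      show ?thesis
        using f_S[OF c t] fne[OF bar_cell[OF t]] by blast
    qed
    let ?X = "tspace Q HQ (C \<union> ?D)"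
    have f': "f \<in> loops k ?X ?x"
      by (rule loops_tspace_mono[OF f]) blast
    have g': "?g \<in> loops k ?X ?x"
      by (rule loops_tspace_mono[OF g_loop]) (use D(2) in blast)
    have x: "?x \<in> topspace ?X"
      by (rule vtx_in_tspace[OF in_translate_mono[OF v order_refl] vQ]) blast
    define f0 where "f0 t = (if t k = 0 then f (restrict t {..<k}) else if t k = 1 then ?g (restrict t {..<k}) else ?x)" for t
    have "continuous_map (subtopology (cube (Suc k)) (cube_boundary (Suc k))) ?X f0"
      unfolding f0_def by (rule continuous_map_prism_boundary[OF f' g' x])
    then have f0: "continuous_map (subtopology (cube (Suc k)) (cube_boundary (Suc k))) (ES (carrier Q)) f0"
      by (simp add: continuous_map_in_subtopology)
    have f0_S: "f0 t \<in> {z. supp z \<subseteq> S c}"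
      if c: "c \<in> grid (Suc k) m" "gcell (Suc k) m c \<subseteq> cube_boundary (Suc k)" "t \<in> gcell (Suc k) m c" for c t
    proof -
      have t: "t \<in> topspace (cube (Suc k))" "t \<in> cube_boundary (Suc k)"
        using c by (auto simp: gcell_def)
      then consider "t k = 0" | "t k = 1" | "t k \<noteq> 0" "t k \<noteq> 1" "restrict t {..<k} \<in> cube_boundary k"
        using cube_boundary_Suc[OF t(1)] by blast
      then show ?thesis
      proof cases
        \<comment> \<open>On the side wall \<open>f\<close> itself takes the value
          \<open>?x\<close>, so the bound for \<open>f\<close> applies.\<close>
        case 3
        then show ?thesis
          using f_S[OF c(1,3)] fb[of "restrict t {..<k}"] by (simp add: f0_def)
      qed (use f_S[OF c(1,3)] g_S[OF c(1,3)] in \<open>simp_all add: f0_def\<close>)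
    qed
    \<comment> \<open>Each cell may use the full simplex on \<open>S c\<close>, a cone, so
      \<open>B c\<close> and \<open>A c\<close> coincide and nothing grows with the
      dimension.\<close>
    have fill: "fills (gdim (Suc k) c) (subtopology (ES (carrier Q)) {z. supp z \<subseteq> S c}) (subtopology (ES (carrier Q)) {z. supp z \<subseteq> S c})"
      if "c \<in> grid (Suc k) m" for c
      by (rule fills_simplex[OF S_carrier S_ne[OF that]])
    have mono: "{z. supp z \<subseteq> S c'} \<subseteq> {z :: 'q list spt set. supp z \<subseteq> S c}"
      if "c \<in> grid (Suc k) m" "c' \<in> grid (Suc k) m" "gface (Suc k) c' c" "c' \<noteq> c" for c c'
      using S_mono[OF that(3)] by auto
    obtain F where F: "continuous_map (cube (Suc k)) (ES (carrier Q)) F" "\<And>t. t \<in> cube_boundary (Suc k) \<Longrightarrow> F t = f0 t"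
      "\<And>c t. c \<in> grid (Suc k) m \<Longrightarrow> t \<in> gcell (Suc k) m c \<Longrightarrow> F t \<in> {z. supp z \<subseteq> S c}"
      by (rule grid_extension[OF m fill mono f0 f0_S]) (assumption+, rule that)
    have "in_translate Q HQ (C \<union> ?D) (supp (F t))" if t: "t \<in> topspace (cube (Suc k))" for t
    proof -
      obtain c where c: "c \<in> grid (Suc k) m" "t \<in> gcell (Suc k) m c"
        by (rule gcell_cover[OF t m])
      have "supp (F t) \<subseteq> (\<lambda>x. qc (bar c) \<otimes>\<^bsub>Q\<^esub> x) ` ?R"
        using F(3)[OF c] S_R[OF c(1)] by auto
      then show ?thesis
        using qc(1)[OF bar[OF c(1)]] unfolding in_translate_def by blast
    qed
    then have "continuous_map (cube (Suc k)) ?X F"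
      using F(1) by (auto simp: continuous_map_in_subtopology)
    then have "homotopic_rel k ?x ?X f ?g"
      using F(2) by (intro homotopic_rel_of_prism[OF f' g', where F = F]) (simp_all add: f0_def)
    moreover have "homotopic_rel k ?x ?X ?g (\<lambda>_. ?x)"
      by (rule homotopic_rel_tspace_mono[OF g_null]) blast
    ultimately show "homotopic_rel k ?x ?X f (\<lambda>_. ?x)"
      by (rule homotopic_with_trans)
  qed
qed

end

end

theorem theorem8:
  fixes N :: "('n, 'm1) monoid_scheme" and TN :: "'n topology"
    and G :: "('g, 'm2) monoid_scheme" and TG :: "'g topology"
    and Q :: "('q, 'm3) monoid_scheme" and TQ :: "'q topology"
    and \<iota> :: "'n \<Rightarrow> 'g" and p :: "'g \<Rightarrow> 'q" and \<psi> :: "'q \<Rightarrow> real" and n :: nat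
  assumes "lch_short_exact N TN G TG Q TQ \<iota> p"
    and "character Q TQ \<psi>"
  shows "(has_section G TG Q TQ p \<and> \<psi> \<circ> p \<in> Sigma_top n G TG \<longrightarrow> \<psi> \<in> Sigma_top n Q TQ) \<and>
         (type_C n N TN \<and> \<psi> \<in> Sigma_top n Q TQ \<longrightarrow> \<psi> \<circ> p \<in> Sigma_top n G TG) \<and>
         (type_C n N TN \<and> \<psi> \<circ> p \<in> Sigma_top (n + 1) G TG \<longrightarrow> \<psi> \<in> Sigma_top (n + 1) Q TQ)"
proof -
  interpret lch_exact N TN G TG Q TQ \<iota> p
    using assms(1) by unfold_locales
  show ?thesis
    using Sigma_top_of_section[OF assms(2)] Sigma_top_pullback[OF assms(2)] Sigma_top_descend[OF assms(2)]
    by blast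
qed

end
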